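(* Let $N\ge 1$, $\alpha\in(0,N)$, $s\in(0,2)$ and $s<N$. Then for every $\varphi\in\dot H^{s/2}(\mathbb{R}^N)$, \[ \mathcal{D}_{N,s}\left(\int_{\mathbb{R}^N}\int_{\mathbb{R}^N}\frac{|\varphi(x)-\varphi(y)|^2}{|x-y|^{N+s}}\,dx\,dy -\int_{\mathbb{R}^N}\int_{\mathbb{R}^N}\frac{\bigl||x|^{\frac{N-s}{2}}\varphi(x)-|y|^{\frac{N-s}{2}}\varphi(y)\bigr|^2}{|x|^{\frac{N-s}{2}}\,|x-y|^{N+s}\,|y|^{\frac{N-s}{2}}}\,dx\,dy\right) \] \[ =\frac{1}{\mathcal{C}_{N,\alpha,s}}\left(\int_{\mathbb{R}^N}\int_{\mathbb{R}^N} \frac{\varphi(x)}{|x|^{\frac{\alpha+s}{2}}}\, I_\alpha(x-y)\, \frac{\varphi(y)}{|y|^{\frac{\alpha+s}{2}}}\,dx\,dy +\frac12\int_{\mathbb{R}^N}\int_{\mathbb{R}^N}\frac{I_\alpha(x-y)}{|x|^{\frac{N+\alpha}{2}}|y|^{\frac{N+\alpha}{2}}}\Bigl|\varphi(x)|x|^{\frac{N-s}{2}}-\varphi(y)|y|^{\frac{N-s}{2}}\Bigr|^2\,dx\,dy\right), \] where \[ \mathcal{C}_{N,\alpha,s}=\frac{1}{2^{\alpha+s}}\left(\frac{\Gamma\bigl(\frac{N-s}{4}\bigr)\Gamma\bigl(\frac{N-\alpha}{4}\bigr)}{\Gamma\bigl(\frac{N+s}{4}\bigr)\Gamma\bigl(\frac{N+\alpha}{4}\bigr)}\right)^2,\qquad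 \mathcal{D}_{N,s}=\frac{\Gamma\bigl(\frac{N+s}{2}\bigr)\,s}{2^{2-s}\pi^{N/2}\Gamma\bigl(1-\frac s2\bigr)} . \]
   Context: All functions are real-valued. For $\alpha\in(0,N)$ the Riesz potential is the function $I_\alpha:\mathbb{R}^N\setminus\{0\}\to\mathbb{R}$, \[ I_\alpha(x)=\frac{\mathcal{A}_\alpha}{|x|^{N-\alpha}},\qquad \mathcal{A}_\alpha=\frac{\Gamma\bigl(\frac{N-\alpha}{2}\bigr)}{2^\alpha\pi^{N/2}\Gamma\bigl(\frac\alpha2\bigr)}, \] where $\Gamma$ is Euler's Gamma function. For $s\in(0,2)$ with $s<N$, the homogeneous Sobolev space $\dot H^{s/2}(\mathbb{R}^N)$ is the completion of $C^\infty_c(\mathbb{R}^N)$ with respect to the norm $\|\cdot\|_{\dot H^{s/2}}$ defined by \[ \|\varphi\|_{\dot H^{s/2}}^2=\mathcal{D}_{N,s}\int_{\mathbb{R}^N}\int_{\mathbb{R}^N}\frac{|\varphi(x)-\varphi(y)|^2}{|x-y|^{N+s}}\,dx\,dy . \] *)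

theory Defs
  imports "HOL-Analysis.Analysis"
begin

definition double_integrable :: "(real^'n \<Rightarrow> real^'n \<Rightarrow> real) \<Rightarrow> bool" where
  "double_integrable f \<longleftrightarrow> integrable (lebesgue \<Otimes>\<^sub>M lebesgue) (\<lambda>(x, y). f x y)"

definition double_integral :: "(real^'n \<Rightarrow> real^'n \<Rightarrow> real) \<Rightarrow> real" where
  "double_integral f = (LINT y|lebesgue. LINT x|lebesgue. f x y)"

definition riesz_const :: "nat \<Rightarrow> real \<Rightarrow> real" where
  "riesz_const N \<alpha> =
     Gamma ((real N - \<alpha>) / 2) / (2 powr \<alpha> * pi powr (real N / 2) * Gamma (\<alpha> / 2))"

(* Used for x \<noteq> 0; division by zero makes the value at 0 equal to 0. *)
definition riesz_potential :: "real \<Rightarrow> real^'n \<Rightarrow> real" where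
  "riesz_potential \<alpha> x = riesz_const CARD('n) \<alpha> / norm x powr (real CARD('n) - \<alpha>)"

definition hardy_const :: "nat \<Rightarrow> real \<Rightarrow> real \<Rightarrow> real" where
  "hardy_const N \<alpha> s =
     1 / 2 powr (\<alpha> + s) *
     ((Gamma ((real N - s) / 4) * Gamma ((real N - \<alpha>) / 4)) /
      (Gamma ((real N + s) / 4) * Gamma ((real N + \<alpha>) / 4)))\<^sup>2"

definition gagliardo_const :: "nat \<Rightarrow> real \<Rightarrow> real" where
  "gagliardo_const N s =
     (Gamma ((real N + s) / 2) * s) /
     (2 powr (2 - s) * pi powr (real N / 2) * Gamma (1 - s / 2))"

fun times_cont_differentiable :: "nat \<Rightarrow> (real^'n \<Rightarrow> real) \<Rightarrow> bool" where
  "times_cont_differentiable 0 f \<longleftrightarrow> continuous_on UNIV f"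
| "times_cont_differentiable (Suc k) f \<longleftrightarrow>
     (\<forall>x. f differentiable (at x)) \<and>
     (\<forall>v. times_cont_differentiable k (\<lambda>x. frechet_derivative f (at x) v))"

definition test_function :: "(real^'n \<Rightarrow> real) \<Rightarrow> bool" where
  "test_function f \<longleftrightarrow>
     (\<forall>k. times_cont_differentiable k f) \<and> compact (closure {x. f x \<noteq> 0})"

(* Only ever applied to test functions, for which the double integral converges. *)
definition hs_norm :: "real \<Rightarrow> (real^'n \<Rightarrow> real) \<Rightarrow> real" where
  "hs_norm s \<phi> =
     sqrt (gagliardo_const CARD('n) s *
       double_integral (\<lambda>x y. \<bar>\<phi> x - \<phi> y\<bar>\<^sup>2 / norm (x - y) powr (real CARD('n) + s)))"

(* The completion of the test functions, realised as a set of measurable functions (all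
   representatives of the almost-everywhere classes). By the Sobolev inequality, for s < N a
   Cauchy sequence of test functions converges in L^(2N/(N-s)), hence almost everywhere along a
   subsequence, and its limit is almost everywhere 0 exactly when the norms tend to 0. So
   sending a Cauchy sequence to its limit identifies the abstract completion with the a.e.
   classes of the functions below. Convergence of the norms alone would not do, as it does not
   distinguish functions differing by a constant. *)
definition homogeneous_sobolev :: "real \<Rightarrow> (real^'n \<Rightarrow> real) set" where
  "homogeneous_sobolev s =
     {\<phi>. \<phi> \<in> borel_measurable lebesgue \<and>
        (\<exists>u. (\<forall>n. test_function (u n)) \<and>
             (\<forall>e>0. \<exists>M. \<forall>m\<ge>M. \<forall>n\<ge>M. hs_norm s (\<lambda>x. u m x - u n x) < e) \<and>
             (AE x in lebesgue. (\<lambda>n. u n x) \<longlonglongrightarrow> \<phi> x))}"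

end

theory Submission
  imports Defs "HOL-Real_Asymp.Real_Asymp"
begin

text \<open>
  Both sides equal a multiple of \<open>J = \<integral> \<phi>(x)\<^sup>2 / |x|\<^sup>s dx\<close>.

  On the right, expanding the square shows that the two integrands add up to
  \<open>I\<^sub>\<alpha>(x - y) (u(x)\<^sup>2 + u(y)\<^sup>2) / 2\<close>, divided by \<open>(|x| |y|)\<close> to the power \<open>(N + \<alpha>) / 2\<close>, where
  \<open>u(x) = |x|\<close> to the power \<open>(N - s) / 2\<close> times \<open>\<phi>(x)\<close>; the inner integral is then a convolution of two
  Riesz kernels.

  On the left, \<open>|x|\<close> to the power \<open>-(N - s) / 2\<close> is the ground state of the fractional Hardy operator. To
  avoid principal values, the singular kernel is written as a superposition of heat kernels \<open>p\<^sub>t\<close>, for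
  which the ground state substitution is an identity between absolutely convergent integrals.
  Powers of \<open>|x|\<close> are superpositions of \<open>p\<^sub>r\<close> as well, so the semigroup law reduces every constant to a
  one-dimensional Beta integral. This settles Lipschitz functions with compact support; since the
  identity also controls the other two quadratic forms by the Gagliardo form, all three pass to the
  limit in the completion.
\<close>

section \<open>Gaussian and Gamma integrals\<close>

text \<open>The difficulty lies in integrating the heat kernel identity against
  \<open>t powr (- 1 - k)\<close>, where \<open>k = s / 2\<close>. Besides the two quadratic forms
  it contains the mass of \<open>\<phi>\<close> squared and a copy of that mass weighted by the heat
  evolution of the ground state; each of these diverges at \<open>t = 0\<close>, and only their
  difference survives. In the heat parameter \<open>r\<close> this difference has density
  \<open>r powr (\<beta> - 1) - (r - t) powr (\<beta> - 1)\<close>, the second term being dropped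
  for \<open>t \<ge> r\<close>. Here \<open>\<beta> = (N + s) / 4\<close>, because the ground state
  must have exponent \<open>2 * \<beta> - N\<close>. For \<open>\<beta> < 1\<close> the density
  changes sign, so Tonelli is not enough: absolute convergence has to be proved, and mass, Hardy
  weight and Gagliardo energy must be finite before anything is subtracted. Elements of the
  completion need not be square integrable, hence the detour through a class of regular functions.
  The one-dimensional integral of the density is a quotient of Gamma values and yields the sharp
  Hardy constant \<open>herbst_const\<close>. The parameter \<open>\<alpha>\<close> enters only
  through the Riesz convolution, whose constant is \<open>hardy_const\<close> times
  \<open>herbst_const\<close>.\<close>

definition half_line :: "real measure" where
  "half_line = density lborel (indicator {0<..})"

lemma sets_half_line [measurable_cong, simp]: "sets half_line = sets borel"
  by (simp add: half_line_def)

lemma space_half_line [simp]: "space half_line = UNIV"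
  by (simp add: half_line_def)

interpretation half_line: sigma_finite_measure half_line
proof
  let ?A = "range (\<lambda>n::nat. {- real n..real n})"
  show "\<exists>A. countable A \<and> A \<subseteq> sets half_line \<and> \<Union> A = space half_line \<and> (\<forall>a\<in>A. emeasure half_line a \<noteq> \<infinity>)"
  proof (intro exI[of _ ?A] conjI ballI)
    show "\<Union> ?A = space half_line"
    proof (auto)
      fix x :: real
      obtain n where "\<bar>x\<bar> \<le> real n" using real_arch_simple by blast
      then show "\<exists>n. - real n \<le> x \<and> x \<le> real n" by (intro exI[of _ n]) auto
    qed
    fix a assume "a \<in> ?A"
    then obtain n where a: "a = {- real n..real n}" by auto
    have "emeasure half_line a \<le> emeasure lborel a"
      unfolding half_line_def a
      by (subst emeasure_density) (auto simp flip: nn_integral_indicator intro!: nn_integral_mono simp: indicator_def)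
    also have "\<dots> < \<infinity>" by (simp add: a)
    finally show "emeasure half_line a \<noteq> \<infinity>" by simp
  qed auto
qed

text \<open>The double integrals of the theorem live on products of the completed measure, where
  Fubini needs sigma-finiteness; a Borel exhaustion for \<open>lborel\<close> serves.\<close>

interpretation lebesgue: sigma_finite_measure "lebesgue :: 'a::euclidean_space measure"
proof
  obtain A where "countable A" "A \<subseteq> sets (lborel :: 'a measure)" "\<Union> A = space (lborel :: 'a measure)"
      "\<forall>a\<in>A. emeasure (lborel :: 'a measure) a \<noteq> \<infinity>"
    using lborel.sigma_finite_countable by blast
  then show "\<exists>A. countable A \<and> A \<subseteq> sets (lebesgue :: 'a measure) \<and> \<Union> A = space (lebesgue :: 'a measure)
      \<and> (\<forall>a\<in>A. emeasure (lebesgue :: 'a measure) a \<noteq> \<infinity>)"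
    by (intro exI[of _ A]) auto
qed

lemma AE_half_line: "AE t in half_line. 0 < t"
  unfolding half_line_def by (subst AE_density) (auto simp: indicator_def)

lemma nn_integral_half_line:
  assumes [measurable]: "f \<in> borel_measurable borel"
  shows "(\<integral>\<^sup>+t. f t \<partial>half_line) = (\<integral>\<^sup>+t. indicator {0<..} t * f t \<partial>lborel)"
  unfolding half_line_def by (subst nn_integral_density) auto

lemma nn_integral_half_line_cong:
  assumes "\<And>t. 0 < t \<Longrightarrow> f t = g t"
  shows "(\<integral>\<^sup>+t. f t \<partial>half_line) = (\<integral>\<^sup>+t. g t \<partial>half_line)"
  by (rule nn_integral_cong_AE) (use AE_half_line assms in auto)

section \<open>Gamma integrals and the total mass of a Gaussian\<close>

lemma nn_integral_Gamma:
  fixes b :: real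
  assumes "0 < b"
  shows "(\<integral>\<^sup>+t. ennreal (t powr (b - 1) * exp (- t)) \<partial>half_line) = ennreal (Gamma b)"
proof -
  have "(\<integral>\<^sup>+t. ennreal (t powr (b - 1) * exp (- t)) \<partial>half_line) =
        (\<integral>\<^sup>+t. ennreal (indicator {0..} t * t powr (b - 1) / exp t) \<partial>lborel)"
    by (subst nn_integral_half_line)
       (auto intro!: nn_integral_cong simp: indicator_def exp_minus field_simps)
  then show ?thesis using Gamma_conv_nn_integral_real[OF assms] by simp
qed

lemma has_integral_Gamma_half_line:
  fixes b :: real
  assumes "0 < b"
  shows "((\<lambda>t. t powr (b - 1) * exp (- t)) has_integral Gamma b) {0<..}"
proof -
  have "((\<lambda>t. t powr (b - 1) / exp t) has_integral Gamma b) {0..}"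
    by (rule Gamma_integral_real[OF assms])
  then have "((\<lambda>t. t powr (b - 1) / exp t) has_integral Gamma b) {0<..}"
    by (rule has_integral_spike_set_eq[THEN iffD1, rotated -1])
       (rule negligible_subset[of "{0}"], simp, force)+
  then show ?thesis by (simp add: exp_minus field_simps)
qed

lemma nn_integral_half_line_has_integral:
  assumes "f \<in> borel_measurable borel" "\<And>t. 0 < t \<Longrightarrow> 0 \<le> f t" "(f has_integral I) {0<..}"
  shows "(\<integral>\<^sup>+t. ennreal (f t) \<partial>half_line) = ennreal I"
proof -
  have "integral\<^sup>N lborel (\<lambda>x. ennreal (f x) * indicator {0<..} x) = ennreal I"
    by (rule nn_integral_has_integral_lebesgue') (use assms in auto)
  then show ?thesis using assms(1) by (subst nn_integral_half_line) (auto simp: mult.commute)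
qed

text \<open>The substitution of \<open>c / t\<close> for \<open>t\<close> in the Gamma integral.
  With \<open>c\<close> a quarter of the squared norm, this evaluates time integrals of heat kernels
  and so produces the powers of \<open>norm x\<close> used later.\<close>

lemma nn_integral_inverse_Gamma:
  fixes b c :: real
  assumes "0 < b" "0 < c"
  shows "(\<integral>\<^sup>+t. ennreal (t powr (- b - 1) * exp (- c / t)) \<partial>half_line) = ennreal (Gamma b * c powr (- b))"
proof (rule nn_integral_half_line_has_integral)
  let ?f = "\<lambda>t::real. t powr (b - 1) * exp (- t)"
  let ?g = "\<lambda>t::real. c / t"
  have img: "?g ` {0<..} = {0<..}"
  proof safe
    fix x :: real assume "0 < x"
    then show "x \<in> ?g ` {0<..}" using assms by (intro image_eqI[of _ _ "c / x"]) auto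
  qed (use assms in auto)
  have "?f absolutely_integrable_on {0<..} \<and> integral {0<..} ?f = Gamma b"
    using has_integral_Gamma_half_line[OF assms(1)]
    by (auto intro!: nonnegative_absolutely_integrable_1 simp: has_integral_iff)
  then have "(\<lambda>t. \<bar>- c / t^2\<bar> * ?f (?g t)) absolutely_integrable_on {0<..} \<and>
      integral {0<..} (\<lambda>t. \<bar>- c / t^2\<bar> * ?f (?g t)) = Gamma b"
    using assms by (subst has_absolute_integral_change_of_variables_1')
      (auto simp: img inj_on_def intro!: derivative_eq_intros simp: power2_eq_square)
  then have "((\<lambda>t. \<bar>- c / t^2\<bar> * ?f (?g t)) has_integral Gamma b) {0<..}"
    by (auto simp: has_integral_iff absolutely_integrable_on_def)
  then have "((\<lambda>t. c powr (- b) * (\<bar>- c / t^2\<bar> * ?f (?g t))) has_integral c powr (- b) * Gamma b) {0<..}"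
    by (rule has_integral_mult_right)
  moreover have "c powr (- b) * (\<bar>- c / t^2\<bar> * ?f (?g t)) = t powr (- b - 1) * exp (- c / t)" if "t \<in> {0<..}" for t
  proof -
    have "(c / t) powr (b - 1) = (c powr b / c) * (t / t powr b)"
      using that assms by (simp add: powr_divide powr_diff)
    moreover have "t powr (- b - 1) = 1 / (t powr b * t)" "c powr (- b) = 1 / c powr b"
      using that assms by (simp_all add: powr_diff powr_minus_divide)
    ultimately show ?thesis
      using that assms by (simp add: power2_eq_square)
  qed
  ultimately show "((\<lambda>t. t powr (- b - 1) * exp (- c / t)) has_integral Gamma b * c powr (- b)) {0<..}"
    unfolding mult.commute[of "Gamma b"] by (rule has_integral_eq[rotated])
qed auto

lemma nn_integral_scaled_Gamma:
  fixes b c :: real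
  assumes "0 < b" "0 < c"
  shows "(\<integral>\<^sup>+t. ennreal (t powr (b - 1) * exp (- c * t)) \<partial>half_line) = ennreal (Gamma b * c powr (- b))"
proof -
  have "ennreal (Gamma b) = (\<integral>\<^sup>+t. indicator {0<..} t * ennreal (t powr (b - 1) * exp (- t)) \<partial>lborel)"
    using nn_integral_Gamma[OF assms(1)] by (subst (asm) nn_integral_half_line) auto
  also have "\<dots> = ennreal \<bar>c\<bar> * (\<integral>\<^sup>+t. indicator {0<..} (0 + c * t) * ennreal ((0 + c * t) powr (b - 1) * exp (- (0 + c * t))) \<partial>lborel)"
    by (rule nn_integral_real_affine) (use assms in auto)
  also have "\<dots> = (\<integral>\<^sup>+t. ennreal (c powr b) * (indicator {0<..} t * ennreal (t powr (b - 1) * exp (- c * t))) \<partial>lborel)"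
    using assms by (subst nn_integral_cmult[symmetric])
     (auto intro!: nn_integral_cong simp: indicator_def ennreal_mult[symmetric] powr_mult powr_diff zero_less_mult_iff)
  also have "\<dots> = ennreal (c powr b) * (\<integral>\<^sup>+t. ennreal (t powr (b - 1) * exp (- c * t)) \<partial>half_line)"
    by (subst nn_integral_cmult) (auto simp: nn_integral_half_line)
  finally have "ennreal (c powr (-b)) * ennreal (Gamma b) = ennreal (c powr (-b)) * (ennreal (c powr b) * (\<integral>\<^sup>+t. ennreal (t powr (b - 1) * exp (- c * t)) \<partial>half_line))"
    by simp
  also have "\<dots> = (\<integral>\<^sup>+t. ennreal (t powr (b - 1) * exp (- c * t)) \<partial>half_line)"
    using assms by (simp add: mult.assoc[symmetric] ennreal_mult[symmetric] powr_add[symmetric])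
  finally show ?thesis using assms by (simp add: ennreal_mult[symmetric] mult.commute Gamma_real_pos)
qed

text \<open>Layer cake: \<open>exp (- c * R)\<close> is the integral of
  \<open>c * exp (- c * r)\<close> over \<open>r > R\<close>, so Tonelli leaves the volumes of balls
  of radius \<open>sqrt r\<close>. The Gamma value coming from the \<open>r\<close>-integral cancels
  the one inside \<open>unit_ball_vol\<close>, in every dimension at once.\<close>

lemma nn_integral_gaussian:
  assumes "0 < c"
  shows "(\<integral>\<^sup>+x. ennreal (exp (- c * (norm x)\<^sup>2)) \<partial>(lborel :: 'a::euclidean_space measure)) =
    ennreal ((pi / c) powr (real DIM('a) / 2))"
proof -
  let ?n = "real DIM('a)"
  interpret P: pair_sigma_finite "lborel :: 'a measure" half_line ..
  have layer: "ennreal (exp (- c * R)) = (\<integral>\<^sup>+r. indicator {R<..} r * ennreal (c * exp (- c * r)) \<partial>half_line)"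
    if "0 \<le> R" for R :: real
  proof -
    have "(\<integral>\<^sup>+r. ennreal (c * exp (- c * r)) * indicator {R..} r \<partial>lborel) = ennreal (0 - (- exp (- c * R)))"
    proof (rule nn_integral_FTC_atLeast)
      show "((\<lambda>r. - exp (- c * r)) \<longlongrightarrow> 0) at_top"
        using assms by real_asymp
    qed (use assms in \<open>auto intro!: derivative_eq_intros\<close>)
    moreover have "(\<integral>\<^sup>+r. ennreal (c * exp (- c * r)) * indicator {R..} r \<partial>lborel) =
        (\<integral>\<^sup>+r. indicator {R<..} r * ennreal (c * exp (- c * r)) \<partial>half_line)"
      using AE_lborel_singleton[of R] that
      by (subst nn_integral_half_line) (auto intro!: nn_integral_cong_AE simp: indicator_def mult.commute)
    ultimately show ?thesis by simp
  qed
  have "(\<integral>\<^sup>+x. ennreal (exp (- c * (norm x)\<^sup>2)) \<partial>(lborel :: 'a measure)) =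
     (\<integral>\<^sup>+(x::'a). \<integral>\<^sup>+r. indicator {(norm x)\<^sup>2<..} r * ennreal (c * exp (- c * r)) \<partial>half_line \<partial>lborel)"
    by (intro nn_integral_cong layer) auto
  also have "\<dots> = (\<integral>\<^sup>+r. \<integral>\<^sup>+(x::'a). indicator {x. (norm x)\<^sup>2 < r} x * ennreal (c * exp (- c * r)) \<partial>lborel \<partial>half_line)"
    by (subst P.Fubini'[symmetric]) (auto intro!: nn_integral_cong simp: indicator_def)
  also have "\<dots> = (\<integral>\<^sup>+r. ennreal (unit_ball_vol ?n * c) * ennreal (r powr ((?n / 2 + 1) - 1) * exp (- c * r)) \<partial>half_line)"
  proof (rule nn_integral_half_line_cong)
    fix r :: real assume r: "0 < r"
    have "{x::'a. (norm x)\<^sup>2 < r} = ball 0 (sqrt r)"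
      using r by (auto simp: real_less_rsqrt) (metis norm_ge_zero real_less_lsqrt not_le real_sqrt_less_iff real_sqrt_pow2 less_imp_le power_mono real_sqrt_abs abs_norm_cancel)
    moreover have "sqrt r ^ DIM('a) = r powr (?n / 2)"
      using r by (simp add: powr_half_sqrt[symmetric] powr_powr powr_realpow[symmetric])
    ultimately show "(\<integral>\<^sup>+(x::'a). indicator {x. (norm x)\<^sup>2 < r} x * ennreal (c * exp (- c * r)) \<partial>lborel) =
       ennreal (unit_ball_vol ?n * c) * ennreal (r powr ((?n / 2 + 1) - 1) * exp (- c * r))"
      using r assms by (subst nn_integral_multc)
        (simp_all add: borel_measurable_indicator nn_integral_indicator emeasure_ball ennreal_mult[symmetric] mult_ac)
  qed
  also have "\<dots> = ennreal (unit_ball_vol ?n * c) * ennreal (Gamma (?n / 2 + 1) * c powr (- (?n / 2 + 1)))"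
    using nn_integral_scaled_Gamma[of "?n / 2 + 1" c] assms by (subst nn_integral_cmult) simp_all
  also have "\<dots> = ennreal ((pi / c) powr (?n / 2))"
  proof -
    have "0 < ?n / 2 + 1" by simp
    then have "Gamma (?n / 2 + 1) \<noteq> 0" by (metis Gamma_real_pos less_irrefl)
    moreover have "c powr (- (?n / 2 + 1)) = 1 / (c * c powr (?n / 2))"
      using assms by (simp add: powr_diff powr_minus_divide)
    ultimately have "unit_ball_vol ?n * c * (Gamma (?n / 2 + 1) * c powr (- (?n / 2 + 1))) = (pi / c) powr (?n / 2)"
      using assms by (simp add: unit_ball_vol_def powr_divide)
    then show ?thesis using assms by (simp add: ennreal_mult'[symmetric])
  qed
  finally show ?thesis .
qed

section \<open>The heat kernel\<close>

definition heat :: "real \<Rightarrow> 'a::euclidean_space \<Rightarrow> real" where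
  "heat t x = (4 * pi * t) powr (- (real DIM('a) / 2)) * exp (- (norm x)\<^sup>2 / (4 * t))"

lemma heat_nonneg [simp]: "0 \<le> heat t x"
  by (simp add: heat_def)

lemma heat_minus_commute: "heat t (x - y) = heat t (y - x)"
  by (simp add: heat_def norm_minus_commute)

lemma heat_measurable [measurable]:
  "(\<lambda>z. heat (f z) (g z)) \<in> borel_measurable M"
  if [measurable]: "f \<in> borel_measurable M" "g \<in> borel_measurable M"
  unfolding heat_def by measurable

lemma nn_integral_translation:
  fixes f :: "'a::euclidean_space \<Rightarrow> ennreal"
  assumes [measurable]: "f \<in> borel_measurable borel"
  shows "(\<integral>\<^sup>+x. f (c + x) \<partial>lborel) = (\<integral>\<^sup>+x. f x \<partial>lborel)"
proof -
  have "(\<integral>\<^sup>+x. f x \<partial>lborel) = (\<integral>\<^sup>+x. f x \<partial>distr lborel borel ((+) c))"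
    by (simp add: lborel_distr_plus)
  also have "\<dots> = (\<integral>\<^sup>+x. f (c + x) \<partial>lborel)"
    by (rule nn_integral_distr) auto
  finally show ?thesis by simp
qed

lemma nn_integral_heat:
  fixes x :: "'a::euclidean_space"
  assumes "0 < t"
  shows "(\<integral>\<^sup>+y. ennreal (heat t (x - y)) \<partial>lborel) = 1"
proof -
  have "(\<integral>\<^sup>+y. ennreal (heat t (x - y)) \<partial>lborel) = (\<integral>\<^sup>+y. ennreal (heat t (x - (x + y))) \<partial>lborel)"
    by (rule nn_integral_translation[symmetric]) measurable
  also have "\<dots> = (\<integral>\<^sup>+(y::'a). ennreal ((4 * pi * t) powr (- (real DIM('a) / 2))) * ennreal (exp (- (1 / (4 * t)) * (norm y)\<^sup>2)) \<partial>lborel)"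
    using assms by (intro nn_integral_cong) (simp add: heat_def ennreal_mult)
  also have "\<dots> = ennreal ((4 * pi * t) powr (- (real DIM('a) / 2))) * ennreal ((pi / (1 / (4 * t))) powr (real DIM('a) / 2))"
    using assms nn_integral_gaussian[of "1 / (4 * t)", where 'a = 'a] by (subst nn_integral_cmult) simp_all
  also have "\<dots> = 1"
    using assms by (simp add: ennreal_mult[symmetric] powr_minus field_simps)
  finally show ?thesis .
qed

text \<open>Completing the square in \<open>y\<close>: the product is again Gaussian in
  \<open>y\<close>, centred at a multiple of \<open>x\<close> and with time
  \<open>t * r / (t + r)\<close>, and what remains is a heat kernel in \<open>x\<close> alone. Since
  the Gaussian in \<open>y\<close> has mass 1, the semigroup law follows.\<close>

lemma heat_mult:
  fixes x y :: "'a::euclidean_space"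
  assumes t: "0 < t" and r: "0 < r"
  shows "heat t (x - y) * heat r y = heat (t + r) x * heat (t * r / (t + r)) ((r / (t + r)) *\<^sub>R x - y)"
proof -
  have "(4 * pi * t) * (4 * pi * r) = (4 * pi * (t + r)) * (4 * pi * (t * r / (t + r)))"
    using t r by (simp add: field_simps)
  note eq = this
  have m: "a powr p * b powr p = (a * b) powr p" if "0 \<le> a" "0 \<le> b" for a b p :: real
    using that by (simp add: powr_mult)
  have c: "(4 * pi * t) powr p * (4 * pi * r) powr p = (4 * pi * (t + r)) powr p * (4 * pi * (t * r / (t + r))) powr p" for p
    using t r by (subst (1 2) m) (auto simp only: eq mult_nonneg_nonneg divide_nonneg_nonneg pi_ge_zero less_imp_le add_nonneg_nonneg zero_le_numeral)
  have e: "- (norm (x - y))\<^sup>2 / (4 * t) + - (norm y)\<^sup>2 / (4 * r) =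
     - (norm x)\<^sup>2 / (4 * (t + r)) + - (norm ((r / (t + r)) *\<^sub>R x - y))\<^sup>2 / (4 * (t * r / (t + r)))"
  proof -
    define a b c where "a = x \<bullet> x" and "b = x \<bullet> y" and "c = y \<bullet> y"
    have n1: "(norm (x - y))\<^sup>2 = a - 2 * b + c"
      by (simp add: power2_norm_eq_inner inner_diff_left inner_diff_right inner_commute a_def b_def c_def)
    have n2: "(norm ((r / (t + r)) *\<^sub>R x - y))\<^sup>2 = (r / (t + r))\<^sup>2 * a - 2 * (r / (t + r)) * b + c"
      unfolding power2_norm_eq_inner
      by (simp add: inner_diff_left inner_diff_right inner_commute a_def b_def c_def power2_eq_square algebra_simps)
    have n3: "(norm x)\<^sup>2 = a" "(norm y)\<^sup>2 = c" by (simp_all add: power2_norm_eq_inner a_def c_def)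
    define q where "q = t + r"
    have q: "q > 0" "r = q - t" using t r by (auto simp: q_def)
    have tq: "t \<noteq> 0" "q - t \<noteq> 0" "q \<noteq> 0" using t r by (auto simp: q_def)
    show ?thesis unfolding n1 n2 n3 using tq unfolding q_def[symmetric] unfolding q(2)
      by (simp add: divide_simps) (simp add: power2_eq_square algebra_simps)
  qed
  have "heat t (x - y) * heat r y = ((4 * pi * t) powr (- (real DIM('a) / 2)) * (4 * pi * r) powr (- (real DIM('a) / 2))) *
      exp (- (norm (x - y))\<^sup>2 / (4 * t) + - (norm y)\<^sup>2 / (4 * r))"
    by (simp only: heat_def exp_add mult_ac)
  also have "\<dots> = heat (t + r) x * heat (t * r / (t + r)) ((r / (t + r)) *\<^sub>R x - y)"
    unfolding c e by (simp only: heat_def exp_add mult_ac)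
  finally show ?thesis .
qed

lemma heat_semigroup:
  fixes x :: "'a::euclidean_space"
  assumes t: "0 < t" and r: "0 < r"
  shows "(\<integral>\<^sup>+y. ennreal (heat t (x - y)) * ennreal (heat r y) \<partial>lborel) = ennreal (heat (t + r) x)"
proof -
  have "(\<integral>\<^sup>+y. ennreal (heat t (x - y)) * ennreal (heat r y) \<partial>lborel) =
    (\<integral>\<^sup>+y. ennreal (heat (t + r) x) * ennreal (heat (t * r / (t + r)) ((r / (t + r)) *\<^sub>R x - y)) \<partial>lborel)"
    by (intro nn_integral_cong) (simp add: ennreal_mult[symmetric] heat_mult[OF t r])
  also have "\<dots> = ennreal (heat (t + r) x)"
    using assms by (subst nn_integral_cmult) (auto simp: nn_integral_heat)
  finally show ?thesis .
qed

text \<open>The coefficient of \<open>norm x powr (2 * b - N)\<close> in the superposition of heat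
  kernels with density \<open>t powr (b - 1)\<close>. Three ranges matter: \<open>b = - k\<close>
  for the singular kernel, \<open>b = \<beta>\<close> for the ground state, and positive
  \<open>b\<close> for Riesz kernels, up to a factor \<open>Gamma b\<close>.\<close>

definition heat_const :: "real \<Rightarrow> real \<Rightarrow> real" where
  "heat_const N b = Gamma (N / 2 - b) / (4 powr b * pi powr (N / 2))"

lemma heat_const_pos: "b < N / 2 \<Longrightarrow> 0 < heat_const N b"
  by (simp add: heat_const_def Gamma_real_pos)

text \<open>At \<open>t = 0\<close> the Gaussian factor forces convergence for every sign of
  \<open>b\<close>, because \<open>x \<noteq> 0\<close>; at infinity the decay of order minus half
  the dimension requires the bound on \<open>b\<close>. Negative \<open>b\<close> is what the
  singular kernel uses.\<close>

lemma nn_integral_power_heat: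
  fixes x :: "'a::euclidean_space"
  assumes b: "b < real DIM('a) / 2" and x: "x \<noteq> 0"
  shows "(\<integral>\<^sup>+t. ennreal (t powr (b - 1) * heat t x) \<partial>half_line) =
    ennreal (heat_const (real DIM('a)) b * norm x powr (2 * b - real DIM('a)))"
proof -
  define n where "n = real DIM('a)"
  define c where "c = (norm x)\<^sup>2 / 4"
  have c: "0 < c" using x by (simp add: c_def)
  have "(\<integral>\<^sup>+t. ennreal (t powr (b - 1) * heat t x) \<partial>half_line) =
     (\<integral>\<^sup>+t. ennreal ((4 * pi) powr (- n / 2)) * ennreal (t powr (- (n / 2 - b) - 1) * exp (- c / t)) \<partial>half_line)"
  proof (rule nn_integral_half_line_cong)
    fix t :: real assume t: "0 < t"
    have "t powr (- (n / 2 - b) - 1) = t powr (b - 1) * t powr (- n / 2)"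
      using t by (simp add: powr_add[symmetric] algebra_simps)
    then show "ennreal (t powr (b - 1) * heat t x) =
       ennreal ((4 * pi) powr (- n / 2)) * ennreal (t powr (- (n / 2 - b) - 1) * exp (- c / t))"
      using t by (simp add: ennreal_mult[symmetric] heat_def n_def c_def powr_mult mult_ac)
  qed
  also have "\<dots> = ennreal ((4 * pi) powr (- n / 2)) * ennreal (Gamma (n / 2 - b) * c powr (- (n / 2 - b)))"
    using nn_integral_inverse_Gamma[of "n / 2 - b" c] b c by (subst nn_integral_cmult) (simp_all add: n_def)
  also have "\<dots> = ennreal ((4 * pi) powr (- n / 2) * (Gamma (n / 2 - b) * c powr (- (n / 2 - b))))"
    by (simp add: ennreal_mult')
  also have "(4 * pi) powr (- n / 2) * (Gamma (n / 2 - b) * c powr (- (n / 2 - b))) = heat_const n b * norm x powr (2 * b - n)"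
  proof -
    have "c powr (- (n / 2 - b)) = norm x powr (2 * b - n) * 4 powr (n / 2 - b)"
    proof -
      have "c = (norm x / 2) powr 2" using x by (simp add: c_def powr_numeral power_divide)
      then have "c powr (- (n / 2 - b)) = (norm x / 2) powr (2 * b - n)"
        by (simp only: powr_powr) (simp add: algebra_simps)
      also have "\<dots> = norm x powr (2 * b - n) * 2 powr (n - 2 * b)"
        using powr_minus_divide[of 2 "n - 2 * b"] by (simp add: powr_divide)
      also have "(2::real) powr (n - 2 * b) = (2 powr 2) powr (n / 2 - b)"
        by (simp only: powr_powr) (simp add: algebra_simps)
      finally show ?thesis by simp
    qed
    moreover have "(4 * pi) powr (- n / 2) = 4 powr (- (n / 2)) / pi powr (n / 2)"
      by (simp add: powr_mult powr_minus_divide)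
    moreover have "4 powr (n / 2 - b) * 4 powr (- (n / 2)) = 1 / (4::real) powr b"
      unfolding powr_add[symmetric] by (simp add: powr_minus_divide)
    ultimately show ?thesis by (simp add: heat_const_def field_simps)
  qed
  finally show ?thesis by (simp add: n_def)
qed

lemma nn_integral_Beta:
  fixes a b \<rho> :: real
  assumes a: "0 < a" and b: "0 < b" and \<rho>: "0 < \<rho>"
  shows "(\<integral>\<^sup>+t. indicator {..<\<rho>} t * ennreal (t powr (a - 1) * (\<rho> - t) powr (b - 1)) \<partial>half_line) =
    ennreal (Beta a b * \<rho> powr (a + b - 1))"
proof -
  let ?g = "\<lambda>t. indicator {0<..<\<rho>} t * ennreal (t powr (a - 1) * (\<rho> - t) powr (b - 1))"
  have "(\<integral>\<^sup>+t. indicator {..<\<rho>} t * ennreal (t powr (a - 1) * (\<rho> - t) powr (b - 1)) \<partial>half_line) = (\<integral>\<^sup>+t. ?g t \<partial>lborel)"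
    by (subst nn_integral_half_line) (auto intro!: nn_integral_cong simp: indicator_def)
  also have "\<dots> = ennreal \<bar>\<rho>\<bar> * (\<integral>\<^sup>+t. ?g (0 + \<rho> * t) \<partial>lborel)"
    by (rule nn_integral_real_affine) (use \<rho> in auto)
  also have "(\<integral>\<^sup>+t. ?g (0 + \<rho> * t) \<partial>lborel) = (\<integral>\<^sup>+t. ennreal (\<rho> powr (a + b - 2)) * (ennreal (t powr (a - 1) * (1 - t) powr (b - 1)) * indicator {0<..<1} t) \<partial>lborel)"
  proof (rule nn_integral_cong)
    fix t :: real
    have "\<rho> * t < \<rho> \<longleftrightarrow> t < 1" using \<rho> by simp
    moreover have "(\<rho> * t) powr (a - 1) * (\<rho> - \<rho> * t) powr (b - 1) = \<rho> powr (a + b - 2) * (t powr (a - 1) * (1 - t) powr (b - 1))"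
      if "0 < t" "t < 1"
    proof -
      have "\<rho> - \<rho> * t = \<rho> * (1 - t)" by (simp add: algebra_simps)
      moreover have "\<rho> powr (a + b - 2) = \<rho> powr (a - 1) * \<rho> powr (b - 1)" by (simp add: powr_add[symmetric])
      ultimately show ?thesis using that \<rho> by (simp add: powr_mult mult_ac)
    qed
    ultimately show "?g (0 + \<rho> * t) = ennreal (\<rho> powr (a + b - 2)) * (ennreal (t powr (a - 1) * (1 - t) powr (b - 1)) * indicator {0<..<1} t)"
      using \<rho> by (auto simp: indicator_def ennreal_mult[symmetric] zero_less_mult_iff)
  qed
  also have "\<dots> = ennreal (\<rho> powr (a + b - 2)) * ennreal (Beta a b)"
  proof (subst nn_integral_cmult)
    have "((\<lambda>t. t powr (a - 1) * (1 - t) powr (b - 1)) has_integral Beta a b) {0<..<1}"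
      using has_integral_Beta_real[OF a b] by (simp add: has_integral_Icc_iff_Ioo)
    then have "(\<integral>\<^sup>+t. ennreal (t powr (a - 1) * (1 - t) powr (b - 1)) * indicator {0<..<1} t \<partial>lborel) = ennreal (Beta a b)"
      by (intro nn_integral_has_integral_lebesgue') auto
    then show "ennreal (\<rho> powr (a + b - 2)) * (\<integral>\<^sup>+t. ennreal (t powr (a - 1) * (1 - t) powr (b - 1)) * indicator {0<..<1} t \<partial>lborel)
      = ennreal (\<rho> powr (a + b - 2)) * ennreal (Beta a b)" by simp
  qed measurable
  also have "ennreal \<bar>\<rho>\<bar> * \<dots> = ennreal (Beta a b * \<rho> powr (a + b - 1))"
  proof -
    have "\<rho> * \<rho> powr (a + b - 2) = \<rho> powr (a + b - 1)"
      using \<rho> powr_add[of \<rho> 1 "a + b - 2"] by simp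
    then show ?thesis
      using \<rho> a b by (simp add: ennreal_mult[symmetric] Beta_def Gamma_real_pos mult_ac mult.left_commute[of \<rho>])
  qed
  finally show ?thesis .
qed

section \<open>Riesz composition and fractional differences of powers\<close>

lemma nn_integral_half_line_shift:
  assumes [measurable]: "f \<in> borel_measurable borel" and t: "0 \<le> t"
  shows "(\<integral>\<^sup>+r. f r \<partial>half_line) = (\<integral>\<^sup>+r. indicator {t<..} r * f (r - t) \<partial>half_line)"
proof -
  have "(\<integral>\<^sup>+r. f r \<partial>half_line) = ennreal \<bar>1\<bar> * (\<integral>\<^sup>+r. indicator {0<..} (- t + 1 * r) * f (- t + 1 * r) \<partial>lborel)"
    by (subst nn_integral_half_line, simp, rule nn_integral_real_affine) auto
  also have "\<dots> = (\<integral>\<^sup>+r. indicator {t<..} r * f (r - t) \<partial>half_line)"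
    using t by (subst nn_integral_half_line) (auto intro!: nn_integral_cong simp: indicator_def)
  finally show ?thesis .
qed

text \<open>The heat flow acts on a superposition of heat kernels by translating its density: the
  semigroup law turns \<open>heat r\<close> into \<open>heat (t + r)\<close>, and renaming
  \<open>t + r\<close> moves the density \<open>r powr (b - 1)\<close> to the right by
  \<open>t\<close>.\<close>

lemma nn_integral_heat_power:
  fixes x :: "'a::euclidean_space"
  assumes b: "b < real DIM('a) / 2" and t: "0 < t"
  shows "(\<integral>\<^sup>+y. ennreal (heat t (x - y)) * ennreal (heat_const (real DIM('a)) b * norm y powr (2 * b - real DIM('a))) \<partial>lborel) =
    (\<integral>\<^sup>+r. ennreal ((if t < r then (r - t) powr (b - 1) else 0) * heat r x) \<partial>half_line)"
proof -
  interpret P: pair_sigma_finite "lborel :: 'a measure" half_line ..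
  have "(\<integral>\<^sup>+y. ennreal (heat t (x - y)) * ennreal (heat_const (real DIM('a)) b * norm y powr (2 * b - real DIM('a))) \<partial>lborel) =
     (\<integral>\<^sup>+y. \<integral>\<^sup>+r. ennreal (r powr (b - 1)) * (ennreal (heat t (x - y)) * ennreal (heat r y)) \<partial>half_line \<partial>lborel)"
  proof (rule nn_integral_cong_AE)
    show "AE y in lborel. ennreal (heat t (x - y)) * ennreal (heat_const (real DIM('a)) b * norm y powr (2 * b - real DIM('a))) =
      (\<integral>\<^sup>+r. ennreal (r powr (b - 1)) * (ennreal (heat t (x - y)) * ennreal (heat r y)) \<partial>half_line)"
      using AE_lborel_singleton[of 0]
    proof eventually_elim
      case (elim y)
      show ?case
        unfolding nn_integral_power_heat[OF b elim, symmetric]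
        by (subst nn_integral_cmult[symmetric]) (auto intro!: nn_integral_cong simp: ennreal_mult' ennreal_mult'' mult_ac)
    qed
  qed
  also have "\<dots> = (\<integral>\<^sup>+r. \<integral>\<^sup>+y. ennreal (r powr (b - 1)) * (ennreal (heat t (x - y)) * ennreal (heat r y)) \<partial>lborel \<partial>half_line)"
    by (rule P.Fubini'[symmetric]) measurable
  also have "\<dots> = (\<integral>\<^sup>+r. ennreal (r powr (b - 1) * heat (t + r) x) \<partial>half_line)"
    by (rule nn_integral_half_line_cong, subst nn_integral_cmult)
       (auto simp: heat_semigroup[OF t] ennreal_mult' ennreal_mult'')
  also have "\<dots> = (\<integral>\<^sup>+r. indicator {t<..} r * ennreal ((r - t) powr (b - 1) * heat (t + (r - t)) x) \<partial>half_line)"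
    by (rule nn_integral_half_line_shift) (use t in auto)
  also have "\<dots> = (\<integral>\<^sup>+r. ennreal ((if t < r then (r - t) powr (b - 1) else 0) * heat r x) \<partial>half_line)"
    by (intro nn_integral_cong) (auto simp: indicator_def)
  finally show ?thesis .
qed

text \<open>Once both kernels are superpositions of heat kernels, the convolution in space becomes
  the convolution on the half line of the densities \<open>t powr (a - 1)\<close> and
  \<open>t powr (b - 1)\<close>. That is a Beta integral times \<open>r powr (a + b - 1)\<close>,
  again the density of a power.\<close>

lemma riesz_composition:
  fixes x :: "'a::euclidean_space"
  assumes a: "0 < a" and b: "0 < b" and ab: "a + b < real DIM('a) / 2" and x: "x \<noteq> 0"
  shows "(\<integral>\<^sup>+y. ennreal (heat_const (real DIM('a)) a * norm (x - y) powr (2 * a - real DIM('a))) *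
      ennreal (heat_const (real DIM('a)) b * norm y powr (2 * b - real DIM('a))) \<partial>lborel) =
    ennreal (Beta a b * heat_const (real DIM('a)) (a + b) * norm x powr (2 * (a + b) - real DIM('a)))"
proof -
  interpret P: pair_sigma_finite "lborel :: 'a measure" half_line ..
  interpret Q: pair_sigma_finite half_line half_line ..
  let ?B = "\<lambda>y. ennreal (heat_const (real DIM('a)) b * norm (y::'a) powr (2 * b - real DIM('a)))"
  have "(\<integral>\<^sup>+y. ennreal (heat_const (real DIM('a)) a * norm (x - y) powr (2 * a - real DIM('a))) * ?B y \<partial>lborel) =
     (\<integral>\<^sup>+y. \<integral>\<^sup>+t. ennreal (t powr (a - 1)) * (ennreal (heat t (x - y)) * ?B y) \<partial>half_line \<partial>lborel)"
  proof (rule nn_integral_cong_AE)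
    show "AE y in lborel. ennreal (heat_const (real DIM('a)) a * norm (x - y) powr (2 * a - real DIM('a))) * ?B y =
      (\<integral>\<^sup>+t. ennreal (t powr (a - 1)) * (ennreal (heat t (x - y)) * ?B y) \<partial>half_line)"
      using AE_lborel_singleton[of x]
    proof eventually_elim
      case (elim y)
      have "x - y \<noteq> 0" "a < real DIM('a) / 2" using elim ab b by auto
      show ?case
        unfolding nn_integral_power_heat[OF \<open>a < _\<close> \<open>x - y \<noteq> 0\<close>, symmetric]
        by (subst nn_integral_multc[symmetric]) (auto intro!: nn_integral_cong simp: ennreal_mult' ennreal_mult'' mult_ac)
    qed
  qed
  also have "\<dots> = (\<integral>\<^sup>+t. \<integral>\<^sup>+y. ennreal (t powr (a - 1)) * (ennreal (heat t (x - y)) * ?B y) \<partial>lborel \<partial>half_line)"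
    by (rule P.Fubini'[symmetric]) measurable
  also have "\<dots> = (\<integral>\<^sup>+t. \<integral>\<^sup>+r. ennreal (heat r x) * (indicator {..<r} t * ennreal (t powr (a - 1) * (r - t) powr (b - 1))) \<partial>half_line \<partial>half_line)"
  proof (rule nn_integral_half_line_cong, subst nn_integral_cmult)
    fix t :: real assume t: "0 < t"
    have b': "b < real DIM('a) / 2" using ab a by auto
    show "ennreal (t powr (a - 1)) * (\<integral>\<^sup>+y. ennreal (heat t (x - y)) * ?B y \<partial>lborel) =
       (\<integral>\<^sup>+r. ennreal (heat r x) * (indicator {..<r} t * ennreal (t powr (a - 1) * (r - t) powr (b - 1))) \<partial>half_line)"
      unfolding nn_integral_heat_power[OF b' t]
      by (subst nn_integral_cmult[symmetric]) (auto intro!: nn_integral_cong simp: indicator_def ennreal_mult' ennreal_mult'' mult_ac)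
  qed measurable
  also have "\<dots> = (\<integral>\<^sup>+r. \<integral>\<^sup>+t. ennreal (heat r x) * (indicator {..<r} t * ennreal (t powr (a - 1) * (r - t) powr (b - 1))) \<partial>half_line \<partial>half_line)"
  proof (rule Q.Fubini')
    have [measurable]: "Measurable.pred (half_line \<Otimes>\<^sub>M half_line) (\<lambda>x. fst x < (snd x :: real))" by measurable
    have "(\<lambda>(r, t). ennreal (heat r x) * ((if t < r then 1 else 0) * ennreal (t powr (a - 1) * (r - t) powr (b - 1))))
      \<in> borel_measurable (half_line \<Otimes>\<^sub>M half_line)" by measurable
    then show "(\<lambda>(r, t). ennreal (heat r x) * (indicator {..<r} t * ennreal (t powr (a - 1) * (r - t) powr (b - 1))))
      \<in> borel_measurable (half_line \<Otimes>\<^sub>M half_line)" by (simp add: indicator_def)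
  qed
  also have "\<dots> = (\<integral>\<^sup>+r. ennreal (heat r x) * ennreal (Beta a b * r powr (a + b - 1)) \<partial>half_line)"
    by (rule nn_integral_half_line_cong, subst nn_integral_cmult) (use a b in \<open>auto simp: nn_integral_Beta\<close>)
  also have "\<dots> = (\<integral>\<^sup>+r. ennreal (Beta a b) * ennreal (r powr (a + b - 1) * heat r x) \<partial>half_line)"
    by (intro nn_integral_cong) (auto simp: ennreal_mult' ennreal_mult'' mult_ac)
  also have "\<dots> = ennreal (Beta a b) * ennreal (heat_const (real DIM('a)) (a + b) * norm x powr (2 * (a + b) - real DIM('a)))"
    using nn_integral_power_heat[OF ab x] by (subst nn_integral_cmult) auto
  also have "\<dots> = ennreal (Beta a b * heat_const (real DIM('a)) (a + b) * norm x powr (2 * (a + b) - real DIM('a)))"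
    using heat_const_pos[OF ab] by (simp add: ennreal_mult'' mult.assoc)
  finally show ?thesis .
qed

section \<open>The one-dimensional integral of a fractional difference\<close>

lemma half_line_alt: "half_line = density lborel (\<lambda>t. ennreal (indicator {0<..} t))"
  by (simp add: half_line_def ennreal_indicator)

lemma has_bochner_integral_half_line_scale:
  fixes f :: "real \<Rightarrow> real"
  assumes f: "has_bochner_integral half_line f I" and c: "0 < c"
  shows "has_bochner_integral half_line (\<lambda>t. f (t / c)) (c * I)"
proof -
  have [measurable]: "f \<in> borel_measurable borel"
    using f by (auto simp: has_bochner_integral_iff dest: borel_measurable_integrable)
  have "has_bochner_integral lborel (\<lambda>t. indicator {0<..} t *\<^sub>R f t) I"
    using f by (auto simp: half_line_alt has_bochner_integral_iff integrable_density integral_density)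
  then have "has_bochner_integral lborel (\<lambda>t. indicator {0<..} (0 + (1/c) * t) *\<^sub>R f (0 + (1 / c) * t)) (I /\<^sub>R \<bar>1 / c\<bar>)"
    using c by (subst (asm) lborel_has_bochner_integral_real_affine_iff[of "1/c" _ _ 0]) auto
  moreover have "indicator {0<..} (0 + (1/c) * t) = (indicator {0<..} t :: real)" for t
    using c by (auto simp: indicator_def zero_less_divide_iff)
  ultimately have "has_bochner_integral lborel (\<lambda>t. indicator {0<..} t *\<^sub>R f (t / c)) (c * I)"
    using c by simp
  then show ?thesis
    unfolding half_line_alt by (intro has_bochner_integral_density) auto
qed

text \<open>Integration by parts. Raising the exponent from \<open>\<beta> - 1\<close> to
  \<open>\<beta>\<close> makes the antiderivative \<open>?G\<close> continuous up to
  \<open>t = 1\<close> also when \<open>\<beta> < 1\<close>. The price is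
  \<open>t * (1 - t) powr (\<beta> - 1)\<close>, which joins the boundary-free term of
  \<open>?G'\<close> in a single Beta integral with coefficient
  \<open>\<beta> / k - 1\<close>.\<close>

lemma has_integral_power_difference:
  fixes k \<beta> :: real
  assumes k: "0 < k" "k < 1" and \<beta>: "0 < \<beta>"
  shows "((\<lambda>t. t powr (- 1 - k) * (1 - (1 - t) powr (\<beta> - 1))) has_integral
    (- 1 / k + (\<beta> / k - 1) * Beta (1 - k) \<beta>)) {0..1}"
proof -
  let ?G = "\<lambda>t::real. - (t powr (- k) * (1 - (1 - t) powr \<beta>)) / k"
  let ?G' = "\<lambda>t::real. t powr (- 1 - k) * (1 - (1 - t) powr \<beta>) - \<beta> / k * (t powr (- k) * (1 - t) powr (\<beta> - 1))"
  have "(?G' has_integral (?G 1 - ?G 0)) {0..1}"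
  proof (rule fundamental_theorem_of_calculus_interior)
    show "(?G has_vector_derivative ?G' t) (at t)" if "t \<in> {0<..<1}" for t
    proof -
      have e: "- k - 1 = - 1 - k" by simp
      have "((\<lambda>t. t powr (- k)) has_real_derivative (- k) * t powr (- k - 1)) (at t)"
        using that by (intro has_real_derivative_powr) auto
      moreover have "((\<lambda>t. (1 - t) powr \<beta>) has_real_derivative \<beta> * (1 - t) powr (\<beta> - 1) * (- 1)) (at t)"
        using that by (intro DERIV_chain2[OF has_real_derivative_powr]) (auto intro!: derivative_eq_intros)
      ultimately have "(?G has_real_derivative - ((- k) * t powr (- k - 1) * (1 - (1 - t) powr \<beta>) +
          (0 - \<beta> * (1 - t) powr (\<beta> - 1) * (- 1)) * t powr (- k)) / k) (at t)"
        by (intro DERIV_cdivide DERIV_minus DERIV_mult DERIV_diff DERIV_const)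
      moreover have "- ((- k) * t powr (- k - 1) * (1 - (1 - t) powr \<beta>) +
          (0 - \<beta> * (1 - t) powr (\<beta> - 1) * (- 1)) * t powr (- k)) / k = ?G' t"
        unfolding e using k by (simp add: field_simps)
      ultimately show ?thesis
        unfolding has_real_derivative_iff_has_vector_derivative[symmetric] by simp
    qed
    have "continuous (at t within {0..1}) ?G" if "t \<in> {0..1}" for t
    proof (cases "t = 0")
      case False
      have "continuous_on {0..1} (\<lambda>t::real. (1 - t) powr \<beta>)"
        using \<beta> by (intro continuous_on_powr' continuous_intros) auto
      then have "continuous (at t within {0..1}) (\<lambda>t. (1 - t) powr \<beta>)"
        using that by (simp add: continuous_on_eq_continuous_within)
      moreover have "continuous (at t within {0..1}) (\<lambda>t. t powr (- k))"
        using False by (intro continuous_intros) auto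
      ultimately show ?thesis using k
        by (intro continuous_divide continuous_minus continuous_mult continuous_diff continuous_const) auto
    next
      case True
      \<comment> \<open>The default \<open>0 powr (- k) = 0\<close> gives \<open>?G 0 = 0\<close>.
        This is the true one-sided limit: the difference quotient of
        \<open>(1 - t) powr \<beta>\<close> stays bounded and \<open>t powr (1 - k)\<close> tends to
        0 because \<open>k < 1\<close>.\<close>
      have "((\<lambda>t::real. (1 - t) powr \<beta>) has_real_derivative - \<beta>) (at 0)"
        by (auto intro!: derivative_eq_intros)
      then have "((\<lambda>t::real. ((1 - t) powr \<beta> - 1) / t) \<longlongrightarrow> - \<beta>) (at 0)"
        by (simp add: has_field_derivative_iff)
      then have "((\<lambda>t::real. ((1 - t) powr \<beta> - 1) / t) \<longlongrightarrow> - \<beta>) (at_right 0)"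
        by (rule filterlim_mono) (auto simp: at_within_le_at)
      moreover have "((\<lambda>t::real. t powr (1 - k)) \<longlongrightarrow> 0) (at_right 0)"
        using k by real_asymp
      ultimately have "((\<lambda>t::real. t powr (1 - k) * (((1 - t) powr \<beta> - 1) / t) / k) \<longlongrightarrow> 0 * (- \<beta>) / k) (at_right 0)"
        using k by (intro tendsto_intros) auto
      moreover have "eventually (\<lambda>t. t powr (1 - k) * (((1 - t) powr \<beta> - 1) / t) / k = ?G t) (at_right 0)"
      proof -
        have "t powr (1 - k) * (((1 - t) powr \<beta> - 1) / t) / k = ?G t" if "0 < t" for t
        proof -
          have "t powr (1 - k) = t powr (- k) * t"
            using that powr_add[of t "- k" 1] by simp
          then show ?thesis using that k by (simp add: field_simps)
        qed
        then show ?thesis by (auto simp: eventually_at_filter)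
      qed
      ultimately have "(?G \<longlongrightarrow> 0) (at_right 0)"
        by (force dest: tendsto_cong)
      then have "(?G \<longlongrightarrow> 0) (at 0 within {0..1})"
        by (simp add: at_within_Icc_at_right)
      then show ?thesis using True by (simp add: continuous_within)
    qed
    then show "continuous_on {0..1} ?G"
      by (simp add: continuous_on_eq_continuous_within)
  qed auto
  then have G: "(?G' has_integral (- 1 / k)) {0..1}" by simp
  have B: "((\<lambda>t. (\<beta> / k - 1) * (t powr ((1 - k) - 1) * (1 - t) powr (\<beta> - 1))) has_integral (\<beta> / k - 1) * Beta (1 - k) \<beta>) {0..1}"
    by (intro has_integral_mult_right has_integral_Beta_real) (use k \<beta> in auto)
  have "((\<lambda>t. t powr (- 1 - k) * (1 - (1 - t) powr (\<beta> - 1))) has_integral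
      (- 1 / k + (\<beta> / k - 1) * Beta (1 - k) \<beta>)) {0<..<1}"
  proof (rule has_integral_eq)
    show "((\<lambda>t. ?G' t + (\<beta> / k - 1) * (t powr ((1 - k) - 1) * (1 - t) powr (\<beta> - 1))) has_integral
      (- 1 / k + (\<beta> / k - 1) * Beta (1 - k) \<beta>)) {0<..<1}"
      using has_integral_add[OF G B] by (simp add: has_integral_Icc_iff_Ioo)
    fix t :: real assume t: "t \<in> {0<..<1}"
    have "t powr (- k) = t powr (- 1 - k) * t"
      using t by (simp add: powr_diff powr_minus_divide field_simps)
    moreover have "(1 - t) powr \<beta> = (1 - t) powr (\<beta> - 1) * (1 - t)"
      using t by (simp add: powr_diff)
    moreover have "(1 - k) - 1 = - k" by simp
    moreover have alg: "p * (1 - q * (1 - t)) - c * (p * t * q) + (c - 1) * (p * t * q) = p * (1 - q)" for p q c t :: real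
      by (simp add: algebra_simps)
    ultimately show "?G' t + (\<beta> / k - 1) * (t powr ((1 - k) - 1) * (1 - t) powr (\<beta> - 1)) =
       t powr (- 1 - k) * (1 - (1 - t) powr (\<beta> - 1))"
      by (simp only: alg)
  qed
  then show ?thesis by (simp add: has_integral_Icc_iff_Ioo)
qed

text \<open>The tail over \<open>t \<ge> 1\<close> contributes \<open>1 / k\<close> and cancels the
  boundary term of the previous lemma; the functional equation of Gamma reduces the remaining Beta
  value. On the unit interval the integrand is nonnegative for \<open>1 \<le> \<beta>\<close> and
  nonpositive otherwise, so absolute integrability is obtained in two cases.\<close>

lemma has_bochner_integral_power_difference:
  fixes k \<beta> :: real
  assumes k: "0 < k" "k < 1" and \<beta>: "k < \<beta>"
  shows "has_bochner_integral half_line (\<lambda>t. t powr (- 1 - k) * (1 - (if t < 1 then (1 - t) powr (\<beta> - 1) else 0)))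
    (Gamma (1 - k) * Gamma \<beta> / (k * Gamma (\<beta> - k)))"
proof -
  let ?f = "\<lambda>t. t powr (- 1 - k) * (1 - (if t < 1 then (1 - t) powr (\<beta> - 1) else 0))"
  let ?A = "- 1 / k + (\<beta> / k - 1) * Beta (1 - k) \<beta>"
  have 1: "(?f has_integral ?A) {0<..<1}"
    by (rule has_integral_eq[rotated])
       (use has_integral_power_difference[OF k, of \<beta>] k \<beta> in \<open>auto simp: has_integral_Icc_iff_Ioo\<close>)
  have a1: "?f absolutely_integrable_on {0<..<1}"
  proof (cases "1 \<le> \<beta>")
    case True
    then have "0 \<le> ?f t" if "t \<in> {0<..<1}" for t
      using that by (auto intro!: mult_nonneg_nonneg powr_le1)
    then show ?thesis using 1 by (intro nonnegative_absolutely_integrable_1) (auto simp: has_integral_iff)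
  next
    case False
    then have "0 \<le> - ?f t" if "t \<in> {0<..<1}" for t
      using that powr_mono'[of "\<beta> - 1" 0 "1 - t"] by (auto intro!: mult_nonneg_nonpos)
    moreover have "(\<lambda>t. - ?f t) integrable_on {0<..<1}"
      using 1 by (intro integrable_neg) (auto simp: has_integral_iff)
    ultimately have "(\<lambda>t. - ?f t) absolutely_integrable_on {0<..<1}"
      by (intro nonnegative_absolutely_integrable_1) auto
    then show ?thesis
      using integrable_minus[of lebesgue "\<lambda>t. indicator {0<..<1} t *\<^sub>R - ?f t"] by (simp add: set_integrable_def)
  qed
  have "((\<lambda>t. t powr (- 1 - k)) has_integral 1 / k) {1..}"
    using has_integral_powr_to_inf[of "- 1 - k" 1] k by simp
  then have 2: "(?f has_integral 1 / k) {1..}"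
    by (rule has_integral_eq[rotated]) auto
  then have a2: "?f absolutely_integrable_on {1..}"
    by (intro nonnegative_absolutely_integrable_1) (auto simp: has_integral_iff)
  have U: "{0<..<1} \<union> {1..} = {0::real<..}" by auto
  have I0: "{0<..<1} \<inter> {1::real..} = {}" by auto
  have "(?f has_integral (?A + 1 / k)) {0<..}"
    using has_integral_Un[OF 1 2] I0 unfolding U by simp
  moreover have a: "?f absolutely_integrable_on {0<..}"
    using absolutely_integrable_Un[OF a1 a2] by (simp add: U)
  ultimately have "integral {0<..} ?f = ?A + 1 / k" by (simp add: has_integral_iff)
  moreover have "?A + 1 / k = Gamma (1 - k) * Gamma \<beta> / (k * Gamma (\<beta> - k))"
  proof -
    have "Gamma (1 - k + \<beta>) = (\<beta> - k) * Gamma (\<beta> - k)"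
      using Gamma_plus1[of "\<beta> - k"] \<beta> by (simp add: algebra_simps nonpos_Ints_def)
    moreover have "Gamma (\<beta> - k) > 0" using \<beta> by simp
    moreover have "\<beta> / k - 1 = (\<beta> - k) / k" using k by (simp add: diff_divide_distrib)
    ultimately show ?thesis using k \<beta> unfolding Beta_def by simp
  qed
  ultimately have I: "integral {0<..} ?f = Gamma (1 - k) * Gamma \<beta> / (k * Gamma (\<beta> - k))" by simp
  have "integrable lebesgue (\<lambda>t. indicator {0<..} t *\<^sub>R ?f t)"
    using a by (simp add: set_integrable_def)
  then have 3: "integrable lborel (\<lambda>t. indicator {0<..} t *\<^sub>R ?f t)"
    by (subst (asm) integrable_completion) auto
  have "integral\<^sup>L lborel (\<lambda>t. indicator {0<..} t *\<^sub>R ?f t) = integral\<^sup>L lebesgue (\<lambda>t. indicator {0<..} t *\<^sub>R ?f t)"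
    by (subst integral_completion) auto
  also have "\<dots> = integral {0<..} ?f"
    using set_lebesgue_integral_eq_integral(2)[OF a] by (simp add: set_lebesgue_integral_def)
  finally have 4: "integral\<^sup>L lborel (\<lambda>t. indicator {0<..} t *\<^sub>R ?f t) = Gamma (1 - k) * Gamma \<beta> / (k * Gamma (\<beta> - k))"
    by (simp only: I)
  show ?thesis
    unfolding half_line_alt using 3 4 by (intro has_bochner_integral_density) (auto simp: has_bochner_integral_iff)
qed

text \<open>As a function of \<open>r\<close>, this is the heat kernel density of a power of
  \<open>norm x\<close> minus its heat evolution at time \<open>t\<close>. The two parts are kept
  together because neither is integrable by itself against \<open>t powr (- 1 - k)\<close> near
  \<open>t = 0\<close>.\<close>

definition power_diff :: "real \<Rightarrow> real \<Rightarrow> real \<Rightarrow> real" where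
  "power_diff \<beta> r t = r powr (\<beta> - 1) - (if t < r then (r - t) powr (\<beta> - 1) else 0)"

lemma power_diff_measurable [measurable]:
  "(\<lambda>z. power_diff \<beta> (f z) (g z)) \<in> borel_measurable M"
  if [measurable]: "f \<in> borel_measurable M" "g \<in> borel_measurable M"
  unfolding power_diff_def by measurable

lemma power_diff_scale:
  assumes "0 < r" "0 < t"
  shows "t powr (- 1 - k) * power_diff \<beta> r t = r powr (\<beta> - k - 2) * ((t / r) powr (- 1 - k) * power_diff \<beta> 1 (t / r))"
proof -
  have "(r - t) powr (\<beta> - 1) = r powr (\<beta> - 1) * (1 - t / r) powr (\<beta> - 1)" if "t < r"
  proof -
    have "r - t = r * (1 - t / r)" using assms by (simp add: field_simps)
    then show ?thesis using that assms by (simp add: powr_mult)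
  qed
  then have "power_diff \<beta> r t = r powr (\<beta> - 1) * power_diff \<beta> 1 (t / r)"
    using assms by (auto simp: power_diff_def algebra_simps)
  moreover have "t powr (- 1 - k) * r powr (\<beta> - 1) = r powr (\<beta> - k - 2) * (t / r) powr (- 1 - k)"
  proof -
    have "(t / r) powr (- 1 - k) = t powr (- 1 - k) * r powr (1 + k)"
      using assms powr_minus_divide[of r "1 + k"] by (simp add: powr_divide)
    moreover have "r powr (\<beta> - k - 2) * r powr (1 + k) = r powr (\<beta> - 1)"
      unfolding powr_add[symmetric] by simp
    ultimately show ?thesis by (simp add: mult_ac)
  qed
  ultimately show ?thesis by (simp add: mult_ac)
qed

text \<open>Homogeneity reduces both claims to \<open>r = 1\<close>. The first says in effect that
  the fractional Laplacian of order \<open>k\<close> sends the power with index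
  \<open>\<beta>\<close> to a multiple of the power with index \<open>\<beta> - k\<close>. The
  second bounds the absolute value, as Fubini demands for an integrand without a sign; only the
  finiteness of \<open>C\<close> is used.\<close>

lemma power_diff_integral:
  fixes k \<beta> :: real
  assumes k: "0 < k" "k < 1" and \<beta>: "k < \<beta>"
  shows "\<And>r. 0 < r \<Longrightarrow> has_bochner_integral half_line (\<lambda>t. t powr (- 1 - k) * power_diff \<beta> r t)
      (Gamma (1 - k) * Gamma \<beta> / (k * Gamma (\<beta> - k)) * r powr (\<beta> - k - 1))"
    and "\<exists>C\<ge>0. \<forall>r>0. (\<integral>\<^sup>+t. ennreal \<bar>t powr (- 1 - k) * power_diff \<beta> r t\<bar> \<partial>half_line) = ennreal (C * r powr (\<beta> - k - 1))"
proof -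
  let ?f = "\<lambda>t. t powr (- 1 - k) * power_diff \<beta> 1 t"
  let ?I = "Gamma (1 - k) * Gamma \<beta> / (k * Gamma (\<beta> - k))"
  have f: "has_bochner_integral half_line ?f ?I"
    using has_bochner_integral_power_difference[OF assms] by (simp add: power_diff_def)
  define C where "C = (\<integral>t. \<bar>?f t\<bar> \<partial>half_line)"
  have C: "has_bochner_integral half_line (\<lambda>t. \<bar>?f t\<bar>) C"
    using f unfolding C_def by (auto simp: has_bochner_integral_iff)
  have r: "r powr (\<beta> - k - 1) = r powr (\<beta> - k - 2) * r" if "0 < r" for r :: real
    using that powr_add[of r "\<beta> - k - 2" 1] by simp
  show "has_bochner_integral half_line (\<lambda>t. t powr (- 1 - k) * power_diff \<beta> r t) (?I * r powr (\<beta> - k - 1))" if "0 < r" for r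
  proof -
    have "has_bochner_integral half_line (\<lambda>t. r powr (\<beta> - k - 2) * ?f (t / r)) (r powr (\<beta> - k - 2) * (r * ?I))"
      by (intro has_bochner_integral_mult_right has_bochner_integral_half_line_scale[OF f] that)
    then show ?thesis
      unfolding r[OF that]
      by (subst has_bochner_integral_cong_AE[of _ _ "\<lambda>t. r powr (\<beta> - k - 2) * ?f (t / r)"])
         (measurable, rule eventually_mono[OF AE_half_line], rule power_diff_scale[OF that], simp_all add: mult_ac)
  qed
  have "(\<integral>\<^sup>+t. ennreal \<bar>t powr (- 1 - k) * power_diff \<beta> r t\<bar> \<partial>half_line) = ennreal (C * r powr (\<beta> - k - 1))" if "0 < r" for r
  proof -
    have "has_bochner_integral half_line (\<lambda>t. r powr (\<beta> - k - 2) * \<bar>?f (t / r)\<bar>) (r powr (\<beta> - k - 2) * (r * C))"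
      by (intro has_bochner_integral_mult_right has_bochner_integral_half_line_scale[OF C] that)
    then have "(\<integral>\<^sup>+t. ennreal (r powr (\<beta> - k - 2) * \<bar>?f (t / r)\<bar>) \<partial>half_line) = ennreal (r powr (\<beta> - k - 2) * (r * C))"
      by (subst nn_integral_eq_integral) (auto simp: has_bochner_integral_iff)
    moreover have "(\<integral>\<^sup>+t. ennreal \<bar>t powr (- 1 - k) * power_diff \<beta> r t\<bar> \<partial>half_line) = (\<integral>\<^sup>+t. ennreal (r powr (\<beta> - k - 2) * \<bar>?f (t / r)\<bar>) \<partial>half_line)"
      by (rule nn_integral_half_line_cong) (simp only: power_diff_scale[OF that] abs_mult, simp)
    ultimately show ?thesis by (simp add: r[OF that] mult_ac)
  qed
  moreover have "0 \<le> C" by (simp add: C_def)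
  ultimately show "\<exists>C\<ge>0. \<forall>r>0. (\<integral>\<^sup>+t. ennreal \<bar>t powr (- 1 - k) * power_diff \<beta> r t\<bar> \<partial>half_line) = ennreal (C * r powr (\<beta> - k - 1))"
    by blast
qed

section \<open>The ground state identity for the heat kernel\<close>

text \<open>The superposition formula at the negative index \<open>- k\<close>, inserted under a
  nonnegative double integral. It is valid off the diagonal, where the kernel takes a default value,
  and the diagonal is null for each fixed \<open>x\<close>.\<close>

lemma subordination:
  fixes F :: "'a::euclidean_space \<Rightarrow> 'a \<Rightarrow> ennreal"
  assumes [measurable]: "case_prod F \<in> borel_measurable (borel \<Otimes>\<^sub>M borel)" and k: "0 < k"
  shows "(\<integral>\<^sup>+x. \<integral>\<^sup>+y. F x y * ennreal (heat_const (real DIM('a)) (- k) * norm (x - y) powr (- (real DIM('a) + 2 * k))) \<partial>lborel \<partial>lborel) =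
    (\<integral>\<^sup>+t. ennreal (t powr (- 1 - k)) * (\<integral>\<^sup>+x. \<integral>\<^sup>+y. F x y * ennreal (heat t (x - y)) \<partial>lborel \<partial>lborel) \<partial>half_line)"
proof -
  interpret P: pair_sigma_finite "lborel :: 'a measure" half_line ..
  have b: "- k < real DIM('a) / 2" using k by (smt (verit) divide_nonneg_nonneg of_nat_0_le_iff)
  have e: "2 * (- k) - real DIM('a) = - (real DIM('a) + 2 * k)" by simp
  have e': "- k - 1 = - 1 - k" by simp
  have F[measurable]: "F x \<in> borel_measurable borel" for x
    by measurable
  have "(\<integral>\<^sup>+x. \<integral>\<^sup>+y. F x y * ennreal (heat_const (real DIM('a)) (- k) * norm (x - y) powr (- (real DIM('a) + 2 * k))) \<partial>lborel \<partial>lborel) =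
    (\<integral>\<^sup>+x. \<integral>\<^sup>+y. \<integral>\<^sup>+t. F x y * ennreal (t powr (- 1 - k) * heat t (x - y)) \<partial>half_line \<partial>lborel \<partial>lborel)"
  proof (rule nn_integral_cong, rule nn_integral_cong_AE)
    fix x :: 'a
    show "AE y in lborel. F x y * ennreal (heat_const (real DIM('a)) (- k) * norm (x - y) powr (- (real DIM('a) + 2 * k))) =
        (\<integral>\<^sup>+t. F x y * ennreal (t powr (- 1 - k) * heat t (x - y)) \<partial>half_line)"
      using AE_lborel_singleton[of x]
    proof eventually_elim
      case (elim y)
      have "x - y \<noteq> 0" using elim by simp
      from nn_integral_power_heat[OF b this, unfolded e e'] show ?case
        by (subst nn_integral_cmult) (simp_all add: add.commute)
    qed
  qed
  also have "\<dots> = (\<integral>\<^sup>+x. \<integral>\<^sup>+t. \<integral>\<^sup>+y. F x y * ennreal (t powr (- 1 - k) * heat t (x - y)) \<partial>lborel \<partial>half_line \<partial>lborel)"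
    by (intro nn_integral_cong P.Fubini'[symmetric]) measurable
  also have "\<dots> = (\<integral>\<^sup>+t. \<integral>\<^sup>+x. \<integral>\<^sup>+y. F x y * ennreal (t powr (- 1 - k) * heat t (x - y)) \<partial>lborel \<partial>lborel \<partial>half_line)"
    by (intro P.Fubini'[symmetric]) measurable
  also have "\<dots> = (\<integral>\<^sup>+t. ennreal (t powr (- 1 - k)) * (\<integral>\<^sup>+x. \<integral>\<^sup>+y. F x y * ennreal (heat t (x - y)) \<partial>lborel \<partial>lborel) \<partial>half_line)"
    by (subst nn_integral_cmult[symmetric], measurable, intro nn_integral_cong)
       (subst nn_integral_cmult[symmetric], measurable, intro nn_integral_cong, simp add: ennreal_mult mult_ac)
  finally show ?thesis .
qed

lemma heat_form_swap:
  fixes F :: "'a::euclidean_space \<Rightarrow> 'a \<Rightarrow> ennreal"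
  assumes [measurable]: "case_prod F \<in> borel_measurable (borel \<Otimes>\<^sub>M borel)"
  shows "(\<integral>\<^sup>+x. \<integral>\<^sup>+y. F y x * ennreal (heat t (x - y)) \<partial>lborel \<partial>lborel) =
    (\<integral>\<^sup>+x. \<integral>\<^sup>+y. F x y * ennreal (heat t (x - y)) \<partial>lborel \<partial>lborel)"
proof -
  have "(\<integral>\<^sup>+x. \<integral>\<^sup>+y. F y x * ennreal (heat t (x - y)) \<partial>lborel \<partial>lborel) =
    (\<integral>\<^sup>+y. \<integral>\<^sup>+x. F y x * ennreal (heat t (x - y)) \<partial>lborel \<partial>lborel)"
    by (rule lborel_pair.Fubini'[symmetric]) measurable
  then show ?thesis by (simp add: heat_minus_commute)
qed

lemma heat_form_fst:
  fixes f :: "'a::euclidean_space \<Rightarrow> ennreal"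
  assumes [measurable]: "f \<in> borel_measurable borel" and t: "0 < t"
  shows "(\<integral>\<^sup>+x. \<integral>\<^sup>+y. f x * ennreal (heat t (x - y)) \<partial>lborel \<partial>lborel) = (\<integral>\<^sup>+x. f x \<partial>lborel)"
  by (intro nn_integral_cong, subst nn_integral_cmult) (auto simp: nn_integral_heat[OF t])

text \<open>With the ground state \<open>w x = norm x powr (- a)\<close>, this is
  \<open>w x * w y\<close> times the square of the difference of \<open>\<phi> / w\<close> at the
  two points.\<close>

definition hardy_quotient :: "real \<Rightarrow> ('a::euclidean_space \<Rightarrow> real) \<Rightarrow> 'a \<Rightarrow> 'a \<Rightarrow> real" where
  "hardy_quotient a \<phi> x y = (norm x powr a * \<phi> x - norm y powr a * \<phi> y)\<^sup>2 / (norm x powr a * norm y powr a)"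

lemma hardy_quotient_nonneg [simp]: "0 \<le> hardy_quotient a \<phi> x y"
  by (simp add: hardy_quotient_def)

lemma hardy_quotient_measurable [measurable]:
  fixes f g :: "'b \<Rightarrow> 'a::euclidean_space"
  assumes [measurable]: "f \<in> borel_measurable M" "g \<in> borel_measurable M" "\<phi> \<in> borel_measurable borel"
  shows "(\<lambda>z. hardy_quotient a \<phi> (f z) (g z)) \<in> borel_measurable M"
  unfolding hardy_quotient_def by measurable

text \<open>Both squares have the cross term \<open>- 2 * p * q\<close>. Exchanging their diagonal
  terms, rather than subtracting them, keeps every summand nonnegative, so that the identity can be
  integrated in \<open>ennreal\<close> without any finiteness assumption.\<close>

lemma ground_state_pointwise:
  fixes X Y p q :: real
  assumes "0 < X" "0 < Y"
  shows "(p - q)\<^sup>2 + (p\<^sup>2 * X / Y + q\<^sup>2 * Y / X) = (X * p - Y * q)\<^sup>2 / (X * Y) + (p\<^sup>2 + q\<^sup>2)"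
  using assms by (simp add: field_simps) (simp add: power2_eq_square algebra_simps)

text \<open>The pointwise identity with \<open>X\<close> and \<open>Y\<close> the reciprocals of the
  ground state, integrated against the heat kernel. The plain squares integrate to the mass since
  the kernel has mass 1; the weighted squares produce the heat evolution of the ground state, known
  from \<open>nn_integral_heat_power\<close>. Symmetry in \<open>x\<close> and \<open>y\<close>
  accounts for the factors 2.\<close>

lemma ground_state_heat:
  fixes \<phi> :: "'a::euclidean_space \<Rightarrow> real"
  assumes [measurable]: "\<phi> \<in> borel_measurable borel" and t: "0 < t" and b: "b < real DIM('a) / 2"
    and a: "a = real DIM('a) - 2 * b"
  shows "(\<integral>\<^sup>+x. \<integral>\<^sup>+y. ennreal ((\<phi> x - \<phi> y)\<^sup>2) * ennreal (heat t (x - y)) \<partial>lborel \<partial>lborel) +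
      2 * (\<integral>\<^sup>+x. ennreal ((\<phi> x)\<^sup>2 * norm x powr a / heat_const (real DIM('a)) b) *
         (\<integral>\<^sup>+r. ennreal ((if t < r then (r - t) powr (b - 1) else 0) * heat r x) \<partial>half_line) \<partial>lborel) =
    (\<integral>\<^sup>+x. \<integral>\<^sup>+y. ennreal (hardy_quotient a \<phi> x y) * ennreal (heat t (x - y)) \<partial>lborel \<partial>lborel) +
      2 * (\<integral>\<^sup>+x. ennreal ((\<phi> x)\<^sup>2) \<partial>lborel)"
    (is "?E + 2 * ?Q = ?H + 2 * ?m")
proof -
  have c: "0 < heat_const (real DIM('a)) b" by (rule heat_const_pos[OF b])
  let ?F = "\<lambda>x y. ennreal ((\<phi> x)\<^sup>2 * norm x powr a / norm y powr a)"
  have Q: "(\<integral>\<^sup>+x. \<integral>\<^sup>+y. ?F x y * ennreal (heat t (x - y)) \<partial>lborel \<partial>lborel) = ?Q"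
  proof (rule nn_integral_cong)
    fix x :: 'a
    let ?c = "heat_const (real DIM('a)) b"
    have "(\<integral>\<^sup>+y. ?F x y * ennreal (heat t (x - y)) \<partial>lborel) =
      (\<integral>\<^sup>+y. ennreal ((\<phi> x)\<^sup>2 * norm x powr a / ?c) * (ennreal (heat t (x - y)) * ennreal (?c * norm y powr (2 * b - real DIM('a)))) \<partial>lborel)"
    proof (rule nn_integral_cong)
      fix y :: 'a
      have "1 / norm y powr a = norm y powr (2 * b - real DIM('a))"
        unfolding a by (simp add: powr_minus_divide[symmetric])
      then have "(\<phi> x)\<^sup>2 * norm x powr a / norm y powr a = ((\<phi> x)\<^sup>2 * norm x powr a / ?c) * (?c * norm y powr (2 * b - real DIM('a)))"
        using c by (simp flip: \<open>1 / norm y powr a = _\<close>)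
      note eq = this
      show "?F x y * ennreal (heat t (x - y)) =
         ennreal ((\<phi> x)\<^sup>2 * norm x powr a / ?c) * (ennreal (heat t (x - y)) * ennreal (?c * norm y powr (2 * b - real DIM('a))))"
        unfolding eq using c by (subst ennreal_mult) (auto simp only: mult_ac, auto)
    qed
    also have "\<dots> = ennreal ((\<phi> x)\<^sup>2 * norm x powr a / ?c) * (\<integral>\<^sup>+r. ennreal ((if t < r then (r - t) powr (b - 1) else 0) * heat r x) \<partial>half_line)"
      by (subst nn_integral_cmult) (simp_all add: nn_integral_heat_power[OF b t])
    finally show "(\<integral>\<^sup>+y. ?F x y * ennreal (heat t (x - y)) \<partial>lborel) = \<dots>" .
  qed
  have Q': "(\<integral>\<^sup>+x. \<integral>\<^sup>+y. ?F y x * ennreal (heat t (x - y)) \<partial>lborel \<partial>lborel) = ?Q"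
    by (subst heat_form_swap) (measurable, rule Q)
  have m: "(\<integral>\<^sup>+x. \<integral>\<^sup>+y. ennreal ((\<phi> x)\<^sup>2) * ennreal (heat t (x - y)) \<partial>lborel \<partial>lborel) = ?m"
    by (rule heat_form_fst) (use t in auto)
  have m': "(\<integral>\<^sup>+x. \<integral>\<^sup>+y. ennreal ((\<phi> y)\<^sup>2) * ennreal (heat t (x - y)) \<partial>lborel \<partial>lborel) = ?m"
    by (subst heat_form_swap[of "\<lambda>x y. ennreal ((\<phi> x)\<^sup>2)"]) (measurable, rule m)
  have "?E + 2 * ?Q = ?E + ((\<integral>\<^sup>+x. \<integral>\<^sup>+y. ?F x y * ennreal (heat t (x - y)) \<partial>lborel \<partial>lborel) +
      (\<integral>\<^sup>+x. \<integral>\<^sup>+y. ?F y x * ennreal (heat t (x - y)) \<partial>lborel \<partial>lborel))"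
    unfolding Q Q' by (simp add: mult_2)
  also have "\<dots> = (\<integral>\<^sup>+x. \<integral>\<^sup>+y. (ennreal ((\<phi> x - \<phi> y)\<^sup>2) + (?F x y + ?F y x)) * ennreal (heat t (x - y)) \<partial>lborel \<partial>lborel)"
    by (simp add: nn_integral_add distrib_right)
  also have "\<dots> = (\<integral>\<^sup>+x. \<integral>\<^sup>+y. (ennreal (hardy_quotient a \<phi> x y) + (ennreal ((\<phi> x)\<^sup>2) + ennreal ((\<phi> y)\<^sup>2))) * ennreal (heat t (x - y)) \<partial>lborel \<partial>lborel)"
  proof (rule nn_integral_cong_AE)
    show "AE x in lborel. (\<integral>\<^sup>+y. (ennreal ((\<phi> x - \<phi> y)\<^sup>2) + (?F x y + ?F y x)) * ennreal (heat t (x - y)) \<partial>lborel) =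
      (\<integral>\<^sup>+y. (ennreal (hardy_quotient a \<phi> x y) + (ennreal ((\<phi> x)\<^sup>2) + ennreal ((\<phi> y)\<^sup>2))) * ennreal (heat t (x - y)) \<partial>lborel)"
      using AE_lborel_singleton[of 0]
    proof eventually_elim
      case (elim x)
      show ?case
      proof (rule nn_integral_cong_AE)
        show "AE y in lborel. (ennreal ((\<phi> x - \<phi> y)\<^sup>2) + (?F x y + ?F y x)) * ennreal (heat t (x - y)) =
           (ennreal (hardy_quotient a \<phi> x y) + (ennreal ((\<phi> x)\<^sup>2) + ennreal ((\<phi> y)\<^sup>2))) * ennreal (heat t (x - y))"
          using AE_lborel_singleton[of 0]
        proof eventually_elim
          case (elim y)
          have "0 < norm x powr a" "0 < norm y powr a" using \<open>x \<noteq> 0\<close> elim by auto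
          from ground_state_pointwise[OF this, of "\<phi> x" "\<phi> y"] show ?case
            by (simp add: hardy_quotient_def flip: ennreal_plus)
        qed
      qed
    qed
  qed
  also have "\<dots> = ?H + ((\<integral>\<^sup>+x. \<integral>\<^sup>+y. ennreal ((\<phi> x)\<^sup>2) * ennreal (heat t (x - y)) \<partial>lborel \<partial>lborel) +
     (\<integral>\<^sup>+x. \<integral>\<^sup>+y. ennreal ((\<phi> y)\<^sup>2) * ennreal (heat t (x - y)) \<partial>lborel \<partial>lborel))"
    by (simp add: nn_integral_add distrib_right)
  also have "\<dots> = ?H + 2 * ?m"
    unfolding m m' by (simp add: mult_2)
  finally show ?thesis .
qed

text \<open>A bound uniform in \<open>t\<close>. It makes the form finite where terms have to be
  cancelled, and it controls large times in the Gagliardo energy.\<close>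

lemma heat_form_difference_le:
  fixes \<phi> :: "'a::euclidean_space \<Rightarrow> real"
  assumes [measurable]: "\<phi> \<in> borel_measurable borel" and t: "0 < t"
  shows "(\<integral>\<^sup>+x. \<integral>\<^sup>+y. ennreal ((\<phi> x - \<phi> y)\<^sup>2) * ennreal (heat t (x - y)) \<partial>lborel \<partial>lborel) \<le>
    4 * (\<integral>\<^sup>+x. ennreal ((\<phi> x)\<^sup>2) \<partial>lborel)"
proof -
  let ?m = "\<integral>\<^sup>+x. ennreal ((\<phi> x)\<^sup>2) \<partial>lborel"
  have m: "(\<integral>\<^sup>+x. \<integral>\<^sup>+y. ennreal ((\<phi> x)\<^sup>2) * ennreal (heat t (x - y)) \<partial>lborel \<partial>lborel) = ?m"
    by (rule heat_form_fst) (use t in auto)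
  have m': "(\<integral>\<^sup>+x. \<integral>\<^sup>+y. ennreal ((\<phi> y)\<^sup>2) * ennreal (heat t (x - y)) \<partial>lborel \<partial>lborel) = ?m"
    by (subst heat_form_swap[of "\<lambda>x y. ennreal ((\<phi> x)\<^sup>2)"]) (measurable, rule m)
  have "(\<integral>\<^sup>+x. \<integral>\<^sup>+y. ennreal ((\<phi> x - \<phi> y)\<^sup>2) * ennreal (heat t (x - y)) \<partial>lborel \<partial>lborel) \<le>
    (\<integral>\<^sup>+x. \<integral>\<^sup>+y. 2 * (ennreal ((\<phi> x)\<^sup>2) * ennreal (heat t (x - y)) + ennreal ((\<phi> y)\<^sup>2) * ennreal (heat t (x - y))) \<partial>lborel \<partial>lborel)"
  proof (intro nn_integral_mono)
    fix x y :: 'a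
    have "(\<phi> x - \<phi> y)\<^sup>2 \<le> 2 * ((\<phi> x)\<^sup>2 + (\<phi> y)\<^sup>2)"
      using zero_le_power2[of "\<phi> x + \<phi> y"] by (simp add: power2_eq_square algebra_simps)
    then have "ennreal ((\<phi> x - \<phi> y)\<^sup>2) \<le> ennreal (2 * ((\<phi> x)\<^sup>2 + (\<phi> y)\<^sup>2))"
      by (rule ennreal_leI)
    also have "\<dots> = 2 * (ennreal ((\<phi> x)\<^sup>2) + ennreal ((\<phi> y)\<^sup>2))"
      by (simp add: ennreal_mult)
    finally show "ennreal ((\<phi> x - \<phi> y)\<^sup>2) * ennreal (heat t (x - y)) \<le>
       2 * (ennreal ((\<phi> x)\<^sup>2) * ennreal (heat t (x - y)) + ennreal ((\<phi> y)\<^sup>2) * ennreal (heat t (x - y)))"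
      unfolding distrib_right[symmetric] mult.assoc[symmetric] by (rule mult_right_mono) simp
  qed
  also have "\<dots> = 2 * (?m + ?m)"
    by (simp add: nn_integral_add nn_integral_cmult m' nn_integral_heat[OF t])
  also have "\<dots> = 4 * ?m"
    by (simp add: mult_2[symmetric] mult.assoc[symmetric])
  finally show ?thesis .
qed

section \<open>The ground state representation\<close>

lemma subordination_real:
  fixes f :: "'a::euclidean_space \<Rightarrow> 'a \<Rightarrow> real"
  assumes [measurable]: "case_prod f \<in> borel_measurable (borel \<Otimes>\<^sub>M borel)" and f: "\<And>x y. 0 \<le> f x y" and k: "0 < k"
  shows "ennreal (heat_const (real DIM('a)) (- k)) * (\<integral>\<^sup>+x. \<integral>\<^sup>+y. ennreal (f x y / norm (x - y) powr (real DIM('a) + 2 * k)) \<partial>lborel \<partial>lborel) =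
    (\<integral>\<^sup>+t. ennreal (t powr (- 1 - k)) * (\<integral>\<^sup>+x. \<integral>\<^sup>+y. ennreal (f x y) * ennreal (heat t (x - y)) \<partial>lborel \<partial>lborel) \<partial>half_line)"
proof -
  have "- k < real DIM('a) / 2" using k by (smt (verit) divide_nonneg_nonneg of_nat_0_le_iff)
  then have c: "0 < heat_const (real DIM('a)) (- k)" by (rule heat_const_pos)
  have "ennreal (heat_const (real DIM('a)) (- k)) * (\<integral>\<^sup>+x. \<integral>\<^sup>+y. ennreal (f x y / norm (x - y) powr (real DIM('a) + 2 * k)) \<partial>lborel \<partial>lborel) =
    (\<integral>\<^sup>+x. \<integral>\<^sup>+y. ennreal (f x y) * ennreal (heat_const (real DIM('a)) (- k) * norm (x - y) powr (- (real DIM('a) + 2 * k))) \<partial>lborel \<partial>lborel)"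
    apply (subst nn_integral_cmult[symmetric], measurable)
    apply (rule nn_integral_cong)
    apply (subst nn_integral_cmult[symmetric], measurable)
    apply (rule nn_integral_cong)
    using f c by (simp only: powr_minus_divide) (simp add: ennreal_mult[symmetric] mult_ac)
  then show ?thesis using subordination[of "\<lambda>x y. ennreal (f x y)" k] k by simp
qed

lemma nn_integral_power_heat_weighted:
  fixes q :: "'a::euclidean_space \<Rightarrow> real"
  assumes [measurable]: "q \<in> borel_measurable borel" and q: "\<And>x. 0 \<le> q x" and b: "b < real DIM('a) / 2"
  shows "(\<integral>\<^sup>+x. \<integral>\<^sup>+r. ennreal (q x * heat r x * r powr (b - 1)) \<partial>half_line \<partial>lborel) =
    ennreal (heat_const (real DIM('a)) b) * (\<integral>\<^sup>+x. ennreal (q x * norm x powr (2 * b - real DIM('a))) \<partial>lborel)"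
proof -
  have c: "0 < heat_const (real DIM('a)) b" by (rule heat_const_pos[OF b])
  have "(\<integral>\<^sup>+x. \<integral>\<^sup>+r. ennreal (q x * heat r x * r powr (b - 1)) \<partial>half_line \<partial>lborel) =
    (\<integral>\<^sup>+x. ennreal (heat_const (real DIM('a)) b) * ennreal (q x * norm x powr (2 * b - real DIM('a))) \<partial>lborel)"
  proof (rule nn_integral_cong_AE)
    show "AE x in lborel. (\<integral>\<^sup>+r. ennreal (q x * heat r x * r powr (b - 1)) \<partial>half_line) =
        ennreal (heat_const (real DIM('a)) b) * ennreal (q x * norm x powr (2 * b - real DIM('a)))"
      using AE_lborel_singleton[of 0]
    proof eventually_elim
      case (elim x)
      have "(\<integral>\<^sup>+r. ennreal (q x * heat r x * r powr (b - 1)) \<partial>half_line) = (\<integral>\<^sup>+r. ennreal (q x) * ennreal (r powr (b - 1) * heat r x) \<partial>half_line)"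
        using q by (intro nn_integral_cong) (simp add: ennreal_mult[symmetric] mult_ac)
      also have "\<dots> = ennreal (q x) * ennreal (heat_const (real DIM('a)) b * norm x powr (2 * b - real DIM('a)))"
        by (subst nn_integral_cmult) (simp_all add: nn_integral_power_heat[OF b elim])
      also have "\<dots> = ennreal (heat_const (real DIM('a)) b) * ennreal (q x * norm x powr (2 * b - real DIM('a)))"
        using q c by (simp add: ennreal_mult[symmetric] mult_ac)
      finally show ?case .
    qed
  qed
  then show ?thesis by (simp add: nn_integral_cmult)
qed

lemma has_bochner_integral_nonneg_real:
  fixes f :: "'a \<Rightarrow> real"
  assumes "f \<in> borel_measurable M" "\<And>x. 0 \<le> f x" "0 \<le> I" "(\<integral>\<^sup>+x. ennreal (f x) \<partial>M) = ennreal I"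
  shows "has_bochner_integral M f I"
  using assms by (intro has_bochner_integral_nn_integral) auto

text \<open>The sharp constant of the fractional Hardy inequality found by Herbst, for the quadratic
  form normalised with \<open>gagliardo_const\<close>.\<close>

definition herbst_const :: "real \<Rightarrow> real \<Rightarrow> real" where
  "herbst_const N s = 2 powr s * (Gamma ((N + s) / 4) / Gamma ((N - s) / 4))\<^sup>2"

text \<open>The common factor has two origins: \<open>k / Gamma (1 - k)\<close> normalises a
  \<open>k\<close>-th power as an integral of \<open>1 - exp (- \<lambda> * t)\<close> against
  \<open>t powr (- 1 - k)\<close>, and the half comes from writing the quadratic form of
  \<open>1 - p_t\<close>, for the heat semigroup \<open>p_t\<close>, as a symmetric double integral
  of squared differences.\<close>

lemma ground_state_constants:
  fixes s :: real
  assumes s: "0 < s" "s < 2" "s < real n"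
  defines "k \<equiv> s / 2" and "\<beta> \<equiv> (real n + s) / 4"
  defines "\<kappa> \<equiv> Gamma (1 - k) * Gamma \<beta> / (k * Gamma (\<beta> - k))"
  shows "gagliardo_const n s = k / (2 * Gamma (1 - k)) * heat_const (real n) (- k)"
    and "herbst_const (real n) s = k / (2 * Gamma (1 - k)) * (2 * \<kappa> * heat_const (real n) (\<beta> - k) / heat_const (real n) \<beta>)"
proof -
  have "(4::real) = 2 powr 2" by (simp add: powr_numeral)
  then have four: "(4::real) powr x = 2 powr (2 * x)" for x by (simp only: powr_powr)
  have g: "Gamma (1 - k) > 0" "Gamma \<beta> > 0" "Gamma (\<beta> - k) > 0"
    using s by (auto simp: k_def \<beta>_def field_simps intro!: Gamma_real_pos)
  have e1: "4 powr (- k) = 1 / (2::real) powr s"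
    unfolding four by (simp add: k_def powr_minus_divide)
  have e2: "2 powr (2 - s) = 4 / (2::real) powr s" by (simp add: powr_diff powr_numeral)
  have e3: "real n / 2 - - k = (real n + s) / 2" "1 - s / 2 = 1 - k" by (auto simp: k_def field_simps)
  have "gagliardo_const n s = Gamma ((real n + s) / 2) * (2 * k) / (4 / 2 powr s * pi powr (real n / 2) * Gamma (1 - k))"
    unfolding gagliardo_const_def e2 e3 by (simp add: k_def)
  also have "\<dots> = k / (2 * Gamma (1 - k)) * (Gamma ((real n + s) / 2) / (1 / 2 powr s * pi powr (real n / 2)))"
    using g by (simp add: field_simps)
  finally show "gagliardo_const n s = k / (2 * Gamma (1 - k)) * heat_const (real n) (- k)"
    unfolding heat_const_def e1 e3 .
  have e: "(real n + s) / 4 = \<beta>" "(real n - s) / 4 = \<beta> - k" "real n / 2 - (\<beta> - k) = \<beta>" "real n / 2 - \<beta> = \<beta> - k"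
    by (auto simp: k_def \<beta>_def field_simps)
  have "4 powr \<beta> = 4 powr (\<beta> - k) * (2::real) powr s"
    unfolding four powr_add[symmetric] by (simp add: k_def)
  moreover have k0: "0 < k" using s by (simp add: k_def)
  ultimately show "herbst_const (real n) s = k / (2 * Gamma (1 - k)) * (2 * \<kappa> * heat_const (real n) (\<beta> - k) / heat_const (real n) \<beta>)"
    using g k0 unfolding herbst_const_def heat_const_def e \<kappa>_def by (simp add: field_simps power2_eq_square)
qed

text \<open>The identity of \<open>ground_state_heat\<close> is integrated against
  \<open>t powr (- 1 - k)\<close>. As the mass terms diverge separately, the mass is cancelled at
  almost every fixed \<open>t\<close>, in the reals; what is left is the signed function
  \<open>G\<close>, whose time integral is computed by exchanging it with the integrals over
  \<open>x\<close> and \<open>r\<close>. Finiteness of \<open>J\<close> makes that exchange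
  legitimate, finiteness of \<open>E\<close> then gives that of the transformed form.\<close>

lemma ground_state_representation:
  fixes \<phi> :: "'a::euclidean_space \<Rightarrow> real" and s :: real
  defines "n \<equiv> real DIM('a)"
  defines "E \<equiv> \<integral>\<^sup>+x. \<integral>\<^sup>+y. ennreal ((\<phi> x - \<phi> y)\<^sup>2 / norm (x - y) powr (n + s)) \<partial>lborel \<partial>lborel"
  defines "H \<equiv> \<integral>\<^sup>+x. \<integral>\<^sup>+y. ennreal (hardy_quotient ((n - s) / 2) \<phi> x y / norm (x - y) powr (n + s)) \<partial>lborel \<partial>lborel"
  defines "J \<equiv> \<integral>\<^sup>+x. ennreal ((\<phi> x)\<^sup>2 / norm x powr s) \<partial>lborel"
  assumes \<phi>[measurable]: "\<phi> \<in> borel_measurable borel" and s: "0 < s" "s < 2" "s < n"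
    and L2: "(\<integral>\<^sup>+x. ennreal ((\<phi> x)\<^sup>2) \<partial>lborel) < \<infinity>" and J: "J < \<infinity>" and E: "E < \<infinity>"
  shows "ennreal (gagliardo_const DIM('a) s) * E =
    ennreal (gagliardo_const DIM('a) s) * H + ennreal (herbst_const n s) * J"
proof -
  \<comment> \<open>\<open>\<beta>\<close> solves \<open>a = n - 2 * \<beta>\<close>, which makes
    \<open>norm x powr (- a)\<close> the power with index \<open>\<beta>\<close>. Lowering the index
    to \<open>\<beta> - k\<close> and multiplying by \<open>norm x powr a\<close> leaves exactly the
    Hardy weight \<open>norm x powr (- s)\<close>.\<close>
  define k \<beta> a where "k = s / 2" and "\<beta> = (n + s) / 4" and "a = (n - s) / 2"
  define \<kappa> where "\<kappa> = Gamma (1 - k) * Gamma \<beta> / (k * Gamma (\<beta> - k))"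
  define c where "c = heat_const n \<beta>"
  \<comment> \<open>Dividing by \<open>c\<close> is the normalisation for which \<open>q x\<close>
    times the superposition of \<open>heat r x\<close> with density
    \<open>r powr (\<beta> - 1)\<close> returns the square of \<open>\<phi> x\<close> for
    \<open>x \<noteq> 0\<close>.\<close>
  define q where "q x = (\<phi> x)\<^sup>2 * norm x powr a / c" for x
  have k: "0 < k" "k < 1" "k < \<beta>" "\<beta> < n / 2" "\<beta> - k < n / 2" "0 < \<beta>"
    unfolding k_def \<beta>_def add_divide_distrib by (insert s, simp_all)
  have n: "n = real DIM('a)" by (simp add: n_def)
  have a: "a = n - 2 * \<beta>" by (simp add: a_def \<beta>_def field_simps)
  have c: "0 < c" unfolding c_def using k by (intro heat_const_pos)
  have ck: "0 < heat_const n (\<beta> - k)" using k by (intro heat_const_pos)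
  have c0: "0 < heat_const n (- k)" using k by (intro heat_const_pos) linarith
  have \<kappa>: "0 < \<kappa>" unfolding \<kappa>_def using k by (auto intro!: divide_pos_pos mult_pos_pos Gamma_real_pos)
  have q[measurable]: "q \<in> borel_measurable borel" unfolding q_def by measurable
  have q0[simp]: "0 \<le> q x" for x using c by (simp add: q_def)
  interpret Q: pair_sigma_finite "lborel :: 'a measure" half_line ..
  interpret P: pair_sigma_finite half_line "(lborel :: 'a measure) \<Otimes>\<^sub>M half_line" ..
  define m where "m = (\<integral>x. (\<phi> x)\<^sup>2 \<partial>lborel)"
  have m0: "0 \<le> m" by (simp add: m_def)
  have m: "(\<integral>\<^sup>+x. ennreal ((\<phi> x)\<^sup>2) \<partial>lborel) = ennreal m"
    unfolding m_def using L2 by (intro nn_integral_eq_integral integrableI_nonneg) auto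
  define j where "j = (\<integral>x. (\<phi> x)\<^sup>2 / norm x powr s \<partial>lborel)"
  have j0: "0 \<le> j" by (simp add: j_def)
  have j: "J = ennreal j"
    unfolding j_def J_def using J[unfolded J_def] by (intro nn_integral_eq_integral integrableI_nonneg) auto
  have qJ: "(\<integral>\<^sup>+x. ennreal (q x * norm x powr (2 * (\<beta> - k) - n)) \<partial>lborel) = ennreal (j / c)"
  proof -
    have "(\<integral>\<^sup>+x. ennreal (q x * norm x powr (2 * (\<beta> - k) - n)) \<partial>lborel) = (\<integral>\<^sup>+x. ennreal (1 / c) * ennreal ((\<phi> x)\<^sup>2 / norm x powr s) \<partial>lborel)"
    proof (rule nn_integral_cong)
      fix x :: 'a
      have "norm x powr a * norm x powr (2 * (\<beta> - k) - n) = 1 / norm x powr s"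
        unfolding powr_add[symmetric] by (simp add: a k_def powr_minus_divide)
      then show "ennreal (q x * norm x powr (2 * (\<beta> - k) - n)) = ennreal (1 / c) * ennreal ((\<phi> x)\<^sup>2 / norm x powr s)"
        using c by (simp add: q_def ennreal_mult[symmetric] mult.assoc)
    qed
    also have "\<dots> = ennreal (1 / c) * J" unfolding J_def by (rule nn_integral_cmult) measurable
    finally show ?thesis using c j0 by (simp add: j ennreal_mult[symmetric])
  qed
  have qm: "(\<integral>\<^sup>+x. ennreal (q x * norm x powr (2 * \<beta> - n)) \<partial>lborel) = ennreal (m / c)"
  proof -
    have "(\<integral>\<^sup>+x. ennreal (q x * norm x powr (2 * \<beta> - n)) \<partial>lborel) = (\<integral>\<^sup>+x. ennreal (1 / c) * ennreal ((\<phi> x)\<^sup>2) \<partial>lborel)"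
    proof (rule nn_integral_cong_AE)
      show "AE x in lborel. ennreal (q x * norm x powr (2 * \<beta> - n)) = ennreal (1 / c) * ennreal ((\<phi> x)\<^sup>2)"
        using AE_lborel_singleton[of 0]
      proof eventually_elim
        case (elim x)
        then have "norm x powr a * norm x powr (2 * \<beta> - n) = 1"
          unfolding powr_add[symmetric] by (simp add: a)
        then show ?case
          using c by (simp add: q_def ennreal_mult[symmetric] mult.assoc)
      qed
    qed
    also have "\<dots> = ennreal (1 / c) * ennreal m" by (simp add: nn_integral_cmult m)
    finally show ?thesis using c m0 by (simp add: ennreal_mult[symmetric])
  qed
  \<comment> \<open>The signed integrand in the three variables \<open>t\<close>, \<open>x\<close>
    and \<open>r\<close>, with \<open>z\<close> standing for the pair of \<open>x\<close> and
    \<open>r\<close>. Its absolute integral is a multiple of the Hardy weight by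
    \<open>power_diff_integral\<close>.\<close>
  define T where "T t z = t powr (- 1 - k) * power_diff \<beta> (snd z) t * (q (fst z) * heat (snd z) (fst z))" for t and z :: "'a \<times> real"
  have [measurable]: "(\<lambda>(t, z). T t z) \<in> borel_measurable (half_line \<Otimes>\<^sub>M (lborel \<Otimes>\<^sub>M half_line))"
    unfolding T_def by measurable
  \<comment> \<open>Used at two indices: \<open>b = \<beta> - k\<close>, where the result is
    governed by the Hardy weight \<open>j\<close>, and \<open>b = \<beta>\<close>, where it is the
    mass \<open>m\<close>.\<close>
  have W: "has_bochner_integral (lborel \<Otimes>\<^sub>M half_line) (\<lambda>z. q (fst z) * heat (snd z) (fst z) * snd z powr (b - 1)) (heat_const n b * I)"
    if "b < n / 2" "(\<integral>\<^sup>+x. ennreal (q x * norm x powr (2 * b - n)) \<partial>lborel) = ennreal I" "0 \<le> I" for b I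
  proof (rule has_bochner_integral_nonneg_real)
    have "0 < heat_const n b" using that by (intro heat_const_pos)
    then show "0 \<le> heat_const n b * I" using that by simp
    have "(\<integral>\<^sup>+z. ennreal (q (fst z) * heat (snd z) (fst z) * snd z powr (b - 1)) \<partial>(lborel \<Otimes>\<^sub>M half_line)) =
      (\<integral>\<^sup>+x. \<integral>\<^sup>+r. ennreal (q x * heat r x * r powr (b - 1)) \<partial>half_line \<partial>lborel)"
      by (subst half_line.nn_integral_fst[symmetric]) auto
    also have "\<dots> = ennreal (heat_const n b) * ennreal I"
      unfolding n using that by (subst nn_integral_power_heat_weighted) (auto simp: n)
    also have "\<dots> = ennreal (heat_const n b * I)"
      using that \<open>0 < heat_const n b\<close> by (simp add: ennreal_mult)
    finally show "(\<integral>\<^sup>+z. ennreal (q (fst z) * heat (snd z) (fst z) * snd z powr (b - 1)) \<partial>(lborel \<Otimes>\<^sub>M half_line)) =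
       ennreal (heat_const n b * I)" .
  qed auto
  have pos_snd: "AE z in (lborel :: 'a measure) \<Otimes>\<^sub>M half_line. 0 < snd z"
  proof (rule Q.AE_pair_measure)
    show "{z \<in> space ((lborel :: 'a measure) \<Otimes>\<^sub>M half_line). 0 < snd z} \<in> sets (lborel \<Otimes>\<^sub>M half_line)"
      by measurable
  qed (use AE_half_line in auto)
  obtain C where C: "0 \<le> C" "\<And>r. 0 < r \<Longrightarrow> (\<integral>\<^sup>+t. ennreal \<bar>t powr (- 1 - k) * power_diff \<beta> r t\<bar> \<partial>half_line) = ennreal (C * r powr (\<beta> - k - 1))"
    using power_diff_integral(2)[of k \<beta>] k by blast
  have T: "integrable (half_line \<Otimes>\<^sub>M (lborel \<Otimes>\<^sub>M half_line)) (\<lambda>(t, z). T t z)"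
  proof (rule integrableI_bounded)
    have "(\<integral>\<^sup>+w. ennreal (norm (case w of (t, z) \<Rightarrow> T t z)) \<partial>(half_line \<Otimes>\<^sub>M (lborel \<Otimes>\<^sub>M half_line))) =
       (\<integral>\<^sup>+z. \<integral>\<^sup>+t. ennreal \<bar>T t z\<bar> \<partial>half_line \<partial>(lborel \<Otimes>\<^sub>M half_line))"
      by (subst P.nn_integral_snd[symmetric]) auto
    also have "\<dots> = (\<integral>\<^sup>+z. ennreal C * ennreal (q (fst z) * heat (snd z) (fst z) * snd z powr (\<beta> - k - 1)) \<partial>(lborel \<Otimes>\<^sub>M half_line))"
    proof (rule nn_integral_cong_AE)
      show "AE z in lborel \<Otimes>\<^sub>M half_line. (\<integral>\<^sup>+t. ennreal \<bar>T t z\<bar> \<partial>half_line) =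
         ennreal C * ennreal (q (fst z) * heat (snd z) (fst z) * snd z powr (\<beta> - k - 1))"
        using pos_snd
      proof eventually_elim
        case (elim z)
        have "(\<integral>\<^sup>+t. ennreal \<bar>T t z\<bar> \<partial>half_line) =
          (\<integral>\<^sup>+t. ennreal (q (fst z) * heat (snd z) (fst z)) * ennreal \<bar>t powr (- 1 - k) * power_diff \<beta> (snd z) t\<bar> \<partial>half_line)"
          by (intro nn_integral_cong) (simp add: T_def abs_mult ennreal_mult[symmetric] mult_ac)
        also have "\<dots> = ennreal (q (fst z) * heat (snd z) (fst z)) * ennreal (C * snd z powr (\<beta> - k - 1))"
          by (subst nn_integral_cmult) (simp_all add: C(2)[OF elim])
        finally show ?case using C(1) by (simp add: ennreal_mult[symmetric] mult_ac)
      qed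
    qed
    also have "\<dots> = ennreal C * ennreal (heat_const n (\<beta> - k) * (j / c))"
      using W[OF k(5) qJ] j0 c
      by (subst nn_integral_cmult) (auto simp: has_bochner_integral_iff nn_integral_eq_integral)
    also have "\<dots> < \<infinity>" by (simp add: ennreal_mult_less_top)
    finally show "(\<integral>\<^sup>+w. ennreal (norm (case w of (t, z) \<Rightarrow> T t z)) \<partial>(half_line \<Otimes>\<^sub>M (lborel \<Otimes>\<^sub>M half_line))) < \<infinity>" .
  qed measurable
  \<comment> \<open>For almost every positive \<open>t\<close>, \<open>G t\<close> is the mass
    \<open>m\<close> minus the integral weighted by the evolved ground state in
    \<open>ground_state_heat\<close>; this is the meaning of \<open>Qt\<close> below.\<close>
  define G where "G t = (\<integral>z. power_diff \<beta> (snd z) t * (q (fst z) * heat (snd z) (fst z)) \<partial>(lborel \<Otimes>\<^sub>M half_line))" for t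
  have TG: "(\<integral>z. T t z \<partial>(lborel \<Otimes>\<^sub>M half_line)) = t powr (- 1 - k) * G t" for t
    unfolding T_def G_def mult.assoc by (rule integral_mult_right_zero)
  have "(\<integral>t. t powr (- 1 - k) * G t \<partial>half_line) = (\<integral>z. \<integral>t. T t z \<partial>half_line \<partial>(lborel \<Otimes>\<^sub>M half_line))"
    using P.integral_fst[OF T] P.integral_snd[OF T] by (simp add: TG)
  also have "\<dots> = (\<integral>z. \<kappa> * (q (fst z) * heat (snd z) (fst z) * snd z powr (\<beta> - k - 1)) \<partial>(lborel \<Otimes>\<^sub>M half_line))"
  proof (rule integral_cong_AE)
    show "AE z in lborel \<Otimes>\<^sub>M half_line. (\<integral>t. T t z \<partial>half_line) = \<kappa> * (q (fst z) * heat (snd z) (fst z) * snd z powr (\<beta> - k - 1))"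
      using pos_snd
    proof eventually_elim
      case (elim z)
      have "(\<integral>t. T t z \<partial>half_line) = (\<integral>t. t powr (- 1 - k) * power_diff \<beta> (snd z) t \<partial>half_line) * (q (fst z) * heat (snd z) (fst z))"
        unfolding T_def by (rule integral_mult_left_zero)
      also have "(\<integral>t. t powr (- 1 - k) * power_diff \<beta> (snd z) t \<partial>half_line) = \<kappa> * snd z powr (\<beta> - k - 1)"
        using power_diff_integral(1)[OF k(1-3) elim] by (simp add: has_bochner_integral_iff \<kappa>_def)
      finally show ?case by (simp add: mult_ac)
    qed
  qed measurable
  also have "\<dots> = \<kappa> * (heat_const n (\<beta> - k) * (j / c))"
    using W[OF k(5) qJ] j0 c by (simp add: has_bochner_integral_iff)
  finally have G_int: "(\<integral>t. t powr (- 1 - k) * G t \<partial>half_line) = \<kappa> * (heat_const n (\<beta> - k) * (j / c))" .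
  have G_integrable: "integrable half_line (\<lambda>t. t powr (- 1 - k) * G t)"
    using P.integrable_fst[OF T] by (simp add: TG)
  define e where "e t = (\<integral>\<^sup>+x. \<integral>\<^sup>+y. ennreal ((\<phi> x - \<phi> y)\<^sup>2) * ennreal (heat t (x - y)) \<partial>lborel \<partial>lborel)" for t
  define h where "h t = (\<integral>\<^sup>+x. \<integral>\<^sup>+y. ennreal (hardy_quotient a \<phi> x y) * ennreal (heat t (x - y)) \<partial>lborel \<partial>lborel)" for t
  have [measurable]: "e \<in> borel_measurable borel" "h \<in> borel_measurable borel"
    unfolding e_def h_def by measurable
  have eh: "AE t in half_line. enn2real (h t) = enn2real (e t) - 2 * G t \<and> e t < \<infinity> \<and> h t < \<infinity>"
    using AE_half_line P.AE_integrable_fst[OF T]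
  proof eventually_elim
    case (elim t)
    have "integrable (lborel \<Otimes>\<^sub>M half_line) (\<lambda>z. t powr (1 + k) * T t z)"
      by (rule integrable_mult_right[OF elim(2)])
    moreover have "t powr (1 + k) * T t z = power_diff \<beta> (snd z) t * (q (fst z) * heat (snd z) (fst z))" for z
    proof -
      have "t powr (1 + k) * t powr (- 1 - k) = 1"
        unfolding powr_add[symmetric] using elim by simp
      then show ?thesis by (simp add: T_def mult.assoc[symmetric])
    qed
    ultimately have pd: "integrable (lborel \<Otimes>\<^sub>M half_line) (\<lambda>z. power_diff \<beta> (snd z) t * (q (fst z) * heat (snd z) (fst z)))"
      by simp
    have mm: "has_bochner_integral (lborel \<Otimes>\<^sub>M half_line) (\<lambda>z. q (fst z) * heat (snd z) (fst z) * snd z powr (\<beta> - 1)) m"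
      using W[OF k(4) qm] m0 c by (simp add: c_def)
    let ?p = "\<lambda>z. (if t < snd z then (snd z - t) powr (\<beta> - 1) else 0) * (q (fst z) * heat (snd z) (fst z))"
    have "has_bochner_integral (lborel \<Otimes>\<^sub>M half_line) (\<lambda>z. q (fst z) * heat (snd z) (fst z) * snd z powr (\<beta> - 1) -
        power_diff \<beta> (snd z) t * (q (fst z) * heat (snd z) (fst z))) (m - G t)"
      by (intro has_bochner_integral_diff mm) (use pd in \<open>simp add: has_bochner_integral_iff G_def\<close>)
    then have p: "has_bochner_integral (lborel \<Otimes>\<^sub>M half_line) ?p (m - G t)"
      by (rule has_bochner_integral_cong[THEN iffD1, rotated 3]) (auto simp: power_diff_def algebra_simps)
    have mG: "0 \<le> m - G t"
      unfolding has_bochner_integral_integral_eq[OF p, symmetric] by (intro integral_nonneg_AE) auto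
    have "ennreal (m - G t) = (\<integral>\<^sup>+z. ennreal (?p z) \<partial>(lborel \<Otimes>\<^sub>M half_line))"
      using p by (subst nn_integral_eq_integral) (auto simp: has_bochner_integral_iff)
    also have "\<dots> = (\<integral>\<^sup>+x. \<integral>\<^sup>+r. ennreal ((if t < r then (r - t) powr (\<beta> - 1) else 0) * (q x * heat r x)) \<partial>half_line \<partial>lborel)"
      by (subst half_line.nn_integral_fst[symmetric]) (measurable, simp cong: if_cong)
    also have "\<dots> = (\<integral>\<^sup>+x. ennreal (q x) * (\<integral>\<^sup>+r. ennreal ((if t < r then (r - t) powr (\<beta> - 1) else 0) * heat r x) \<partial>half_line) \<partial>lborel)"
      by (rule nn_integral_cong, subst nn_integral_cmult[symmetric], measurable)
         (auto intro!: nn_integral_cong simp: ennreal_mult[symmetric] mult_ac)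
    finally have Qt: "(\<integral>\<^sup>+x. ennreal (q x) * (\<integral>\<^sup>+r. ennreal ((if t < r then (r - t) powr (\<beta> - 1) else 0) * heat r x) \<partial>half_line) \<partial>lborel)
       = ennreal (m - G t)" by simp
    have gs: "e t + 2 * ennreal (m - G t) = h t + 2 * ennreal m"
      using ground_state_heat[OF \<phi> elim(1) k(4)[unfolded n] a[unfolded n]]
      unfolding n[symmetric] c_def[symmetric] q_def[symmetric] Qt m e_def h_def .
    have "e t \<le> 4 * ennreal m"
      using heat_form_difference_le[OF \<phi> elim(1)] by (simp add: e_def m)
    also have "\<dots> < \<infinity>" by (simp add: ennreal_mult_less_top)
    finally have et: "e t < \<infinity>" .
    have "h t \<le> e t + 2 * ennreal (m - G t)" unfolding gs by simp
    also have "\<dots> < \<infinity>" using et by (simp add: ennreal_mult_less_top)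
    finally have ht: "h t < \<infinity>" .
    \<comment> \<open>All four terms are finite by now, so the identity can be read in the reals and
      \<open>2 * m\<close> cancels. This is the cancellation that has to precede the integration in
      \<open>t\<close>.\<close>
    have "enn2real (e t + 2 * ennreal (m - G t)) = enn2real (h t + 2 * ennreal m)" by (simp only: gs)
    then have "enn2real (e t) + 2 * (m - G t) = enn2real (h t) + 2 * m"
      using et ht mG m0 by (simp add: enn2real_plus ennreal_mult_less_top enn2real_mult)
    then show ?case using et ht by simp
  qed
  have Ee: "ennreal (heat_const n (- k)) * E = (\<integral>\<^sup>+t. ennreal (t powr (- 1 - k)) * e t \<partial>half_line)"
    using subordination_real[of "\<lambda>x y. (\<phi> x - \<phi> y)\<^sup>2" k] k unfolding E_def e_def n by (simp add: k_def)
  have Hh: "ennreal (heat_const n (- k)) * H = (\<integral>\<^sup>+t. ennreal (t powr (- 1 - k)) * h t \<partial>half_line)"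
    using subordination_real[of "\<lambda>x y. hardy_quotient a \<phi> x y" k] k unfolding H_def h_def n a_def by (simp add: k_def)
  have conv: "(\<integral>\<^sup>+t. ennreal (t powr (- 1 - k)) * f t \<partial>half_line) = (\<integral>\<^sup>+t. ennreal (t powr (- 1 - k) * enn2real (f t)) \<partial>half_line)"
    if "AE t in half_line. f t < \<infinity>" for f
    using that by (intro nn_integral_cong_AE) (auto simp: ennreal_mult elim!: eventually_mono)
  have Ee': "ennreal (heat_const n (- k)) * E = (\<integral>\<^sup>+t. ennreal (t powr (- 1 - k) * enn2real (e t)) \<partial>half_line)"
    unfolding Ee by (rule conv) (use eh in \<open>auto elim!: eventually_mono\<close>)
  have Hh': "ennreal (heat_const n (- k)) * H = (\<integral>\<^sup>+t. ennreal (t powr (- 1 - k) * enn2real (h t)) \<partial>half_line)"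
    unfolding Hh by (rule conv) (use eh in \<open>auto elim!: eventually_mono\<close>)
  have "ennreal (heat_const n (- k)) * E < \<infinity>" using E by (simp add: ennreal_mult_less_top)
  then have ie: "integrable half_line (\<lambda>t. t powr (- 1 - k) * enn2real (e t))"
    unfolding Ee' by (intro integrableI_nonneg) auto
  have AEh: "AE t in half_line. t powr (- 1 - k) * enn2real (e t) - 2 * (t powr (- 1 - k) * G t) = t powr (- 1 - k) * enn2real (h t)"
    using eh
  proof eventually_elim
    case (elim t)
    then have "enn2real (h t) = enn2real (e t) - 2 * G t" by blast
    then show ?case by (simp only:) (simp add: algebra_simps)
  qed
  have ieg: "integrable half_line (\<lambda>t. t powr (- 1 - k) * enn2real (e t) - 2 * (t powr (- 1 - k) * G t))"
    by (intro Bochner_Integration.integrable_diff ie integrable_mult_right G_integrable)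
  have ih: "integrable half_line (\<lambda>t. t powr (- 1 - k) * enn2real (h t))"
    by (rule integrable_cong_AE_imp[OF ieg _ AEh]) measurable
  have "(\<integral>t. t powr (- 1 - k) * enn2real (h t) \<partial>half_line) =
     (\<integral>t. t powr (- 1 - k) * enn2real (e t) - 2 * (t powr (- 1 - k) * G t) \<partial>half_line)"
    by (rule integral_cong_AE) (use AEh ieg in \<open>auto elim!: eventually_mono dest: borel_measurable_integrable\<close>)
  also have "\<dots> = (\<integral>t. t powr (- 1 - k) * enn2real (e t) \<partial>half_line) - 2 * (\<kappa> * (heat_const n (\<beta> - k) * (j / c)))"
    using ie G_integrable by (simp add: G_int)
  finally have I: "(\<integral>t. t powr (- 1 - k) * enn2real (e t) \<partial>half_line) =
     (\<integral>t. t powr (- 1 - k) * enn2real (h t) \<partial>half_line) + 2 * (\<kappa> * (heat_const n (\<beta> - k) * (j / c)))" by simp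
  define A where "A = k / (2 * Gamma (1 - k))"
  have A: "0 < A" unfolding A_def using k by (auto intro!: Gamma_real_pos)
  have D: "gagliardo_const DIM('a) s = A * heat_const n (- k)"
    and K: "herbst_const n s = A * (2 * \<kappa> * heat_const n (\<beta> - k) / c)"
    using ground_state_constants[OF s(1,2) s(3)[unfolded n]] by (simp_all add: A_def k_def \<beta>_def \<kappa>_def c_def n)
  have "ennreal (gagliardo_const DIM('a) s) * E = ennreal A * (ennreal (heat_const n (- k)) * E)"
    unfolding D using A c0 by (simp add: ennreal_mult mult.assoc)
  also have "\<dots> = ennreal A * ennreal (\<integral>t. t powr (- 1 - k) * enn2real (e t) \<partial>half_line)"
    unfolding Ee' by (subst nn_integral_eq_integral[OF ie]) auto
  also have "\<dots> = ennreal A * (ennreal (\<integral>t. t powr (- 1 - k) * enn2real (h t) \<partial>half_line) + ennreal (2 * (\<kappa> * (heat_const n (\<beta> - k) * (j / c)))))"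
    unfolding I using \<kappa> ck j0 c by (subst ennreal_plus) (auto intro!: integral_nonneg_AE)
  also have "ennreal (\<integral>t. t powr (- 1 - k) * enn2real (h t) \<partial>half_line) = ennreal (heat_const n (- k)) * H"
    unfolding Hh' by (subst nn_integral_eq_integral[OF ih]) auto
  also have "ennreal A * (ennreal (heat_const n (- k)) * H + ennreal (2 * (\<kappa> * (heat_const n (\<beta> - k) * (j / c))))) =
     ennreal (gagliardo_const DIM('a) s) * H + ennreal A * ennreal (2 * (\<kappa> * (heat_const n (\<beta> - k) * (j / c))))"
    unfolding D distrib_left using A c0 by (simp add: ennreal_mult mult.assoc)
  also have "ennreal A * ennreal (2 * (\<kappa> * (heat_const n (\<beta> - k) * (j / c)))) = ennreal (herbst_const n s) * J"
    unfolding K j using A \<kappa> ck j0 c by (simp add: ennreal_mult[symmetric] mult_ac)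
  finally show ?thesis .
qed

section \<open>Lipschitz functions with compact support\<close>

text \<open>The properties of a test function from which finiteness of mass, Hardy weight and
  Gagliardo energy is derived. The class is closed under differences, so the representation also
  applies to the differences of a Cauchy sequence.\<close>

definition lipschitz_compact_support :: "('a::euclidean_space \<Rightarrow> real) \<Rightarrow> bool" where
  "lipschitz_compact_support \<phi> \<longleftrightarrow>
    (\<exists>L\<ge>0. \<forall>x y. \<bar>\<phi> x - \<phi> y\<bar> \<le> L * norm (x - y)) \<and> (\<exists>R>0. \<forall>x. R < norm x \<longrightarrow> \<phi> x = 0)"

lemma lipschitz_compact_support_diff:
  assumes "lipschitz_compact_support \<phi>" "lipschitz_compact_support \<psi>"
  shows "lipschitz_compact_support (\<lambda>x. \<phi> x - \<psi> x)"
proof -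
  obtain L L' R R' where L: "L \<ge> 0" "\<And>x y. \<bar>\<phi> x - \<phi> y\<bar> \<le> L * norm (x - y)" "L' \<ge> 0" "\<And>x y. \<bar>\<psi> x - \<psi> y\<bar> \<le> L' * norm (x - y)"
    and R: "0 < R" "\<And>x. R < norm x \<Longrightarrow> \<phi> x = 0" "0 < R'" "\<And>x. R' < norm x \<Longrightarrow> \<psi> x = 0"
    using assms unfolding lipschitz_compact_support_def by blast
  have "\<bar>(\<phi> x - \<psi> x) - (\<phi> y - \<psi> y)\<bar> \<le> (L + L') * norm (x - y)" for x y
    using L(2)[of x y] L(4)[of x y] by (simp add: distrib_right)
  moreover have "\<phi> x - \<psi> x = 0" if "max R R' < norm x" for x using R that by simp
  ultimately show ?thesis
    unfolding lipschitz_compact_support_def using L R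
    by (intro conjI exI[of _ "L + L'"] exI[of _ "max R R'"]) auto
qed

lemma lipschitz_compact_support_measurable:
  assumes "lipschitz_compact_support \<phi>"
  shows "\<phi> \<in> borel_measurable borel"
proof -
  obtain L where "L \<ge> 0" "\<And>x y. \<bar>\<phi> x - \<phi> y\<bar> \<le> L * norm (x - y)"
    using assms unfolding lipschitz_compact_support_def by blast
  then have "L-lipschitz_on UNIV \<phi>" by (auto simp: lipschitz_on_def dist_norm)
  then show ?thesis by (intro borel_measurable_continuous_onI lipschitz_on_continuous_on)
qed

lemma lipschitz_compact_support_bounded:
  fixes \<phi> :: "'a::euclidean_space \<Rightarrow> real"
  assumes "lipschitz_compact_support \<phi>"
  obtains C R where "0 < C" "0 < R" "\<And>x. (\<phi> x)\<^sup>2 \<le> C * indicator (cball 0 R) x"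
proof -
  obtain L R where L: "L \<ge> 0" "\<And>x y. \<bar>\<phi> x - \<phi> y\<bar> \<le> L * norm (x - y)"
    and R: "0 < R" "\<And>x. R < norm x \<Longrightarrow> \<phi> x = 0"
    using assms unfolding lipschitz_compact_support_def by blast
  define C where "C = (\<bar>\<phi> 0\<bar> + L * R + 1)\<^sup>2"
  have 0: "0 \<le> L * R" using L R by simp
  have "0 < C" unfolding C_def using 0 by (intro zero_less_power) linarith
  moreover have "(\<phi> x)\<^sup>2 \<le> C * indicator (cball 0 R) x" for x
  proof (cases "norm x \<le> R")
    case True
    have "L * norm x \<le> L * R" using True L by (intro mult_left_mono) auto
    then have "\<bar>\<phi> x\<bar> \<le> \<bar>\<phi> 0\<bar> + L * R + 1" using L(2)[of x 0] by simp
    then have "\<bar>\<phi> x\<bar>\<^sup>2 \<le> C" unfolding C_def by (intro power_mono) auto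
    then show ?thesis using True by simp
  next
    case False
    then show ?thesis using R by simp
  qed
  ultimately show ?thesis using R that by blast
qed

lemma lipschitz_compact_support_L2:
  fixes \<phi> :: "'a::euclidean_space \<Rightarrow> real"
  assumes "lipschitz_compact_support \<phi>"
  shows "(\<integral>\<^sup>+x. ennreal ((\<phi> x)\<^sup>2) \<partial>lborel) < \<infinity>"
proof -
  obtain C R where C: "0 < C" "0 < R" "\<And>x. (\<phi> x)\<^sup>2 \<le> C * indicator (cball 0 R) x"
    using lipschitz_compact_support_bounded[OF assms] by metis
  have "(\<integral>\<^sup>+x. ennreal ((\<phi> x)\<^sup>2) \<partial>lborel) \<le> (\<integral>\<^sup>+x. ennreal C * indicator (cball (0::'a) R) x \<partial>lborel)"
    using C by (intro nn_integral_mono order_trans[OF ennreal_leI[OF C(3)]]) (auto simp: indicator_def)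
  also have "\<dots> = ennreal C * emeasure lborel (cball (0::'a) R)" by (simp add: nn_integral_cmult_indicator)
  also have "\<dots> < \<infinity>" using emeasure_lborel_cball_finite[of "0::'a" R] by (simp add: ennreal_mult_less_top)
  finally show ?thesis .
qed

text \<open>Local integrability of the weight is read off from the composition formula at a single point.\<close>

lemma lipschitz_compact_support_hardy:
  fixes \<phi> :: "'a::euclidean_space \<Rightarrow> real"
  assumes "lipschitz_compact_support \<phi>" and s: "0 < s" "s < real DIM('a)"
  shows "(\<integral>\<^sup>+x. ennreal ((\<phi> x)\<^sup>2 / norm x powr s) \<partial>lborel) < \<infinity>"
proof -
  obtain C R where C: "0 < C" "0 < R" "\<And>x. (\<phi> x)\<^sup>2 \<le> C * indicator (cball 0 R) x"
    using lipschitz_compact_support_bounded[OF assms(1)] by metis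
  define n where "n = real DIM('a)"
  \<comment> \<open>\<open>b\<close> reproduces the weight, since \<open>2 * b - n = - s\<close>,
    and \<open>a\<close> is any positive number below \<open>s / 2\<close>, which keeps
    \<open>a + b < n / 2\<close>. On the ball of radius \<open>R\<close> the other kernel, centred
    at the unit vector \<open>e\<close>, is bounded below by its value at distance
    \<open>1 + R\<close>, so the composed integrand dominates the weight there.\<close>
  define a b where "a = s / 4" and "b = (n - s) / 2"
  obtain e :: 'a where e: "norm e = 1" using vector_choose_size[of 1] by auto
  have ab: "0 < a" "0 < b" "a + b < n / 2" and b': "2 * b - n = - s" "2 * a - n < 0"
    using s unfolding a_def b_def n_def by (simp_all add: field_simps)
  have ca: "0 < heat_const n a" "0 < heat_const n b" using ab by (auto intro!: heat_const_pos)
  define c where "c = heat_const n a * (1 + R) powr (2 * a - n) * heat_const n b"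
  have c: "0 < c" unfolding c_def using ca C by auto
  let ?g = "\<lambda>y. ennreal (heat_const n a * norm (e - y) powr (2 * a - n)) * ennreal (heat_const n b * norm y powr (2 * b - n))"
  have "(\<integral>\<^sup>+x. ennreal ((\<phi> x)\<^sup>2 / norm x powr s) \<partial>lborel) \<le> (\<integral>\<^sup>+x. ennreal (C / c) * ?g x \<partial>lborel)"
  proof (rule nn_integral_mono_AE)
    show "AE x in lborel. ennreal ((\<phi> x)\<^sup>2 / norm x powr s) \<le> ennreal (C / c) * ?g x"
      using AE_lborel_singleton[of e]
    proof eventually_elim
      case (elim x)
      have p: "1 / norm x powr s = norm x powr (2 * b - n)" unfolding b' by (simp add: powr_minus_divide)
      have "(\<phi> x)\<^sup>2 / norm x powr s \<le> C / c * (heat_const n a * norm (e - x) powr (2 * a - n) * (heat_const n b * norm x powr (2 * b - n)))"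
      proof (cases "norm x \<le> R")
        case True
        then have le: "norm (e - x) \<le> 1 + R" using norm_triangle_ineq4[of e x] e by simp
        have "(1 + R) powr (2 * a - n) \<le> norm (e - x) powr (2 * a - n)"
          using le b' elim C by (intro powr_mono2') auto
        then have "c * norm x powr (2 * b - n) \<le> heat_const n a * norm (e - x) powr (2 * a - n) * (heat_const n b * norm x powr (2 * b - n))"
          unfolding c_def mult.assoc using ca by (intro mult_left_mono mult_right_mono) auto
        then have "C / c * (c * norm x powr (2 * b - n)) \<le> C / c * (heat_const n a * norm (e - x) powr (2 * a - n) * (heat_const n b * norm x powr (2 * b - n)))"
          using C c by (intro mult_left_mono) auto
        moreover have "(\<phi> x)\<^sup>2 / norm x powr s \<le> C * norm x powr (2 * b - n)"
          using C(3)[of x] True unfolding p[symmetric] by (simp add: divide_right_mono)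
        ultimately show ?thesis using c by simp
      next
        case False
        then have "(\<phi> x)\<^sup>2 = 0" using C(3)[of x] by simp
        then show ?thesis using C c ca by simp
      qed
      then have "ennreal ((\<phi> x)\<^sup>2 / norm x powr s) \<le>
          ennreal (C / c * (heat_const n a * norm (e - x) powr (2 * a - n) * (heat_const n b * norm x powr (2 * b - n))))"
        by (rule ennreal_leI)
      also have "\<dots> = ennreal (C / c) * ?g x"
        using C c ca by (simp add: ennreal_mult[symmetric] del: times_divide_eq_left)
      finally show ?case .
    qed
  qed
  also have "\<dots> = ennreal (C / c) * (\<integral>\<^sup>+x. ?g x \<partial>lborel)" by (rule nn_integral_cmult) measurable
  also have "\<dots> < \<infinity>"
  proof -
    have "e \<noteq> 0" using e by auto
    from riesz_composition[OF ab(1,2) ab(3)[unfolded n_def] this] show ?thesis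
      by (simp add: n_def ennreal_mult_less_top)
  qed
  finally show ?thesis .
qed

text \<open>Half of the Gaussian exponent absorbs the quadratic factor through
  \<open>u * exp (- u) \<le> 1\<close>; the other half is the Gaussian at time \<open>2 * t\<close>,
  and the power of 2 compares the normalisations. The bound is again a heat kernel, so its mass is
  known.\<close>

lemma heat_second_moment:
  fixes z :: "'a::euclidean_space"
  assumes t: "0 < t"
  shows "(norm z)\<^sup>2 * heat t z \<le> 8 * t * 2 powr (real DIM('a) / 2) * heat (2 * t) z"
proof -
  define u where "u = (norm z)\<^sup>2 / (8 * t)"
  have z: "(norm z)\<^sup>2 = 8 * t * u" "- (norm z)\<^sup>2 / (4 * t) = - u - u" "- (norm z)\<^sup>2 / (4 * (2 * t)) = - u"
    using t by (auto simp: u_def field_simps)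
  have "u * exp (- u) \<le> 1"
  proof -
    have "u \<le> exp u" using exp_ge_add_one_self[of u] by linarith
    then show ?thesis by (simp add: exp_minus field_simps)
  qed
  then have "8 * t * ((u * exp (- u)) * exp (- u)) \<le> 8 * t * (1 * exp (- u))"
    using t by (intro mult_left_mono mult_right_mono) auto
  then have f1: "(4 * pi * t) powr (- (real DIM('a) / 2)) * (8 * t * ((u * exp (- u)) * exp (- u))) \<le>
      (4 * pi * t) powr (- (real DIM('a) / 2)) * (8 * t * (1 * exp (- u)))"
    by (rule mult_left_mono) simp
  have f2: "(4 * pi * t) powr (- (real DIM('a) / 2)) = 2 powr (real DIM('a) / 2) * (4 * pi * (2 * t)) powr (- (real DIM('a) / 2))"
  proof -
    have "4 * pi * (2 * t) = 2 * (4 * pi * t)" by simp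
    then have "(4 * pi * (2 * t)) powr (- (real DIM('a) / 2)) = 2 powr (- (real DIM('a) / 2)) * (4 * pi * t) powr (- (real DIM('a) / 2))"
      using t by (simp only: powr_mult)
    then show ?thesis by (simp add: powr_minus)
  qed
  have f3: "(norm z)\<^sup>2 * heat t z = (4 * pi * t) powr (- (real DIM('a) / 2)) * (8 * t * ((u * exp (- u)) * exp (- u)))"
  proof -
    have "exp (- u - u) = exp (- u) * exp (- u)" by (simp add: exp_add[symmetric])
    then show ?thesis unfolding heat_def z(2) unfolding z(1) by simp
  qed
  have f4: "8 * t * 2 powr (real DIM('a) / 2) * heat (2 * t) z = 2 powr (real DIM('a) / 2) * (4 * pi * (2 * t)) powr (- (real DIM('a) / 2)) * (8 * t * (1 * exp (- u)))"
    unfolding heat_def z by simp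
  show ?thesis unfolding f3 f4 f2[symmetric] by (rule f1)
qed

text \<open>The Lipschitz bound turns the squared difference into the squared distance, which costs
  a factor \<open>t\<close> by \<open>heat_second_moment\<close>. The integrand vanishes unless one
  of the points lies in the supporting ball, and each of the two alternatives contributes at most
  the volume of that ball.\<close>

lemma lipschitz_heat_form:
  fixes \<phi> :: "'a::euclidean_space \<Rightarrow> real"
  assumes "lipschitz_compact_support \<phi>"
  shows "\<exists>C\<ge>0. \<forall>t>0. (\<integral>\<^sup>+x. \<integral>\<^sup>+y. ennreal ((\<phi> x - \<phi> y)\<^sup>2) * ennreal (heat t (x - y)) \<partial>lborel \<partial>lborel) \<le> ennreal (C * t)"
proof -
  obtain L R where L: "L \<ge> 0" "\<And>x y. \<bar>\<phi> x - \<phi> y\<bar> \<le> L * norm (x - y)"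
    and R: "0 < R" "\<And>x. R < norm x \<Longrightarrow> \<phi> x = 0"
    using assms unfolding lipschitz_compact_support_def by blast
  define v where "v = measure lborel (cball (0::'a) R)"
  have v: "emeasure lborel (cball (0::'a) R) = ennreal v"
    unfolding v_def using emeasure_lborel_cball_finite[of "0::'a" R] by (intro emeasure_eq_ennreal_measure) auto
  let ?B = "cball (0::'a) R"
  define c where "c = L\<^sup>2 * (8 * 2 powr (real DIM('a) / 2))"
  have "(\<integral>\<^sup>+x. \<integral>\<^sup>+y. ennreal ((\<phi> x - \<phi> y)\<^sup>2) * ennreal (heat t (x - y)) \<partial>lborel \<partial>lborel) \<le> ennreal (2 * c * v * t)" if t: "0 < t" for t
  proof -
    have [measurable]: "?B \<in> sets borel" by simp
    have 1: "(\<integral>\<^sup>+x. \<integral>\<^sup>+y. indicator ?B x * ennreal (heat (2 * t) (x - y)) \<partial>lborel \<partial>lborel) = ennreal v"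
      using t by (subst heat_form_fst) (auto simp: v borel_measurable_indicator)
    have 2: "(\<integral>\<^sup>+x. \<integral>\<^sup>+y. indicator ?B y * ennreal (heat (2 * t) (x - y)) \<partial>lborel \<partial>lborel) = ennreal v"
      by (subst heat_form_swap[of "\<lambda>x y. indicator ?B x"]) (measurable, rule 1)
    have "(\<integral>\<^sup>+x. \<integral>\<^sup>+y. ennreal ((\<phi> x - \<phi> y)\<^sup>2) * ennreal (heat t (x - y)) \<partial>lborel \<partial>lborel) \<le>
       (\<integral>\<^sup>+x. \<integral>\<^sup>+y. ennreal (c * t) * (indicator ?B x * ennreal (heat (2 * t) (x - y)) + indicator ?B y * ennreal (heat (2 * t) (x - y))) \<partial>lborel \<partial>lborel)"
    proof (intro nn_integral_mono)
      fix x y :: 'a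
      show "ennreal ((\<phi> x - \<phi> y)\<^sup>2) * ennreal (heat t (x - y)) \<le>
        ennreal (c * t) * (indicator ?B x * ennreal (heat (2 * t) (x - y)) + indicator ?B y * ennreal (heat (2 * t) (x - y)))"
      proof (cases "x \<in> ?B \<or> y \<in> ?B")
        case False
        then show ?thesis using R by simp
      next
        case True
        have "\<bar>\<phi> x - \<phi> y\<bar>\<^sup>2 \<le> (L * norm (x - y))\<^sup>2" using L by (intro power_mono) auto
        then have "(\<phi> x - \<phi> y)\<^sup>2 * heat t (x - y) \<le> (L * norm (x - y))\<^sup>2 * heat t (x - y)"
          by (intro mult_right_mono) auto
        also have "\<dots> = L\<^sup>2 * ((norm (x - y))\<^sup>2 * heat t (x - y))" by (simp add: power_mult_distrib)
        also have "\<dots> \<le> L\<^sup>2 * (8 * t * 2 powr (real DIM('a) / 2) * heat (2 * t) (x - y))"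
          by (intro mult_left_mono heat_second_moment t) auto
        also have "\<dots> = c * t * heat (2 * t) (x - y)" by (simp add: c_def)
        finally have "ennreal ((\<phi> x - \<phi> y)\<^sup>2) * ennreal (heat t (x - y)) \<le> ennreal (c * t) * ennreal (heat (2 * t) (x - y))"
          using t by (simp add: ennreal_mult[symmetric] c_def ennreal_leI)
        also have "\<dots> \<le> ennreal (c * t) * (indicator ?B x * ennreal (heat (2 * t) (x - y)) + indicator ?B y * ennreal (heat (2 * t) (x - y)))"
          using True by (intro mult_left_mono) (auto simp: indicator_def)
        finally show ?thesis .
      qed
    qed
    also have "\<dots> = ennreal (c * t) * ((\<integral>\<^sup>+x. \<integral>\<^sup>+y. indicator ?B x * ennreal (heat (2 * t) (x - y)) \<partial>lborel \<partial>lborel) +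
         (\<integral>\<^sup>+x. \<integral>\<^sup>+y. indicator ?B y * ennreal (heat (2 * t) (x - y)) \<partial>lborel \<partial>lborel))"
      by (subst nn_integral_add[symmetric], measurable, subst nn_integral_cmult[symmetric], measurable, intro nn_integral_cong,
          subst nn_integral_add[symmetric], measurable, subst nn_integral_cmult[symmetric], measurable)
    also have "\<dots> = ennreal (2 * c * v * t)"
      unfolding 1 2 using t by (simp add: c_def v_def ennreal_mult[symmetric] ennreal_plus[symmetric] del: ennreal_plus)
    finally show ?thesis .
  qed
  moreover have "0 \<le> 2 * c * v" by (simp add: c_def v_def)
  ultimately show ?thesis by blast
qed

text \<open>By subordination it suffices to bound the heat form in time. The linear bound for
  \<open>t \<le> 1\<close> leaves \<open>t powr (- k)\<close>, integrable because
  \<open>k < 1\<close>; the uniform bound for \<open>t > 1\<close> leaves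
  \<open>t powr (- 1 - k)\<close>, integrable because \<open>k > 0\<close>.\<close>

lemma lipschitz_compact_support_gagliardo:
  fixes \<phi> :: "'a::euclidean_space \<Rightarrow> real"
  assumes lip: "lipschitz_compact_support \<phi>" and s: "0 < s" "s < 2"
  shows "(\<integral>\<^sup>+x. \<integral>\<^sup>+y. ennreal ((\<phi> x - \<phi> y)\<^sup>2 / norm (x - y) powr (real DIM('a) + s)) \<partial>lborel \<partial>lborel) < \<infinity>"
    (is "?E < _")
proof -
  note [measurable] = lipschitz_compact_support_measurable[OF lip]
  define k where "k = s / 2"
  have k: "0 < k" "k < 1" using s by (auto simp: k_def)
  define e where "e t = (\<integral>\<^sup>+x. \<integral>\<^sup>+y. ennreal ((\<phi> x - \<phi> y)\<^sup>2) * ennreal (heat t (x - y)) \<partial>lborel \<partial>lborel)" for t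
  obtain C where C: "C \<ge> 0" "\<And>t. 0 < t \<Longrightarrow> e t \<le> ennreal (C * t)"
    unfolding e_def using lipschitz_heat_form[OF lip] by blast
  define m where "m = enn2real (\<integral>\<^sup>+x. ennreal ((\<phi> x)\<^sup>2) \<partial>lborel)"
  have m: "0 \<le> m" "(\<integral>\<^sup>+x. ennreal ((\<phi> x)\<^sup>2) \<partial>lborel) = ennreal m"
    unfolding m_def using lipschitz_compact_support_L2[OF lip] by auto
  have e4: "e t \<le> ennreal (4 * m)" if "0 < t" for t
    using heat_form_difference_le[OF _ that, of \<phi>] m by (simp add: e_def ennreal_mult)
  have "- k < real DIM('a) / 2" using k by (smt (verit) divide_nonneg_nonneg of_nat_0_le_iff)
  then have c: "0 < heat_const (real DIM('a)) (- k)" by (rule heat_const_pos)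
  have "ennreal (heat_const (real DIM('a)) (- k)) * ?E = (\<integral>\<^sup>+t. ennreal (t powr (- 1 - k)) * e t \<partial>half_line)"
    using subordination_real[of "\<lambda>x y. (\<phi> x - \<phi> y)\<^sup>2" k] k by (simp add: e_def k_def)
  also have "\<dots> \<le> (\<integral>\<^sup>+t. ennreal C * (ennreal (t powr (- k)) * indicator {0..1} t) + ennreal (4 * m) * (ennreal (t powr (- 1 - k)) * indicator {1..} t) \<partial>half_line)"
  proof (rule nn_integral_mono_AE)
    show "AE t in half_line. ennreal (t powr (- 1 - k)) * e t \<le>
       ennreal C * (ennreal (t powr (- k)) * indicator {0..1} t) + ennreal (4 * m) * (ennreal (t powr (- 1 - k)) * indicator {1..} t)"
      using AE_half_line
    proof eventually_elim
      case (elim t)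
      show ?case
      proof (cases "t \<le> 1")
        case True
        have "t powr (- 1 - k) * t = t powr (- k)"
          using elim powr_add[of t "- 1 - k" 1] by simp
        then have "ennreal (t powr (- 1 - k)) * ennreal (C * t) = ennreal C * ennreal (t powr (- k))"
          using C elim by (simp add: ennreal_mult[symmetric] mult_ac)
        moreover have "ennreal (t powr (- 1 - k)) * e t \<le> ennreal (t powr (- 1 - k)) * ennreal (C * t)"
          using C(2)[OF elim] by (intro mult_left_mono) auto
        ultimately show ?thesis using True elim by (simp add: add_increasing2)
      next
        case False
        have "ennreal (t powr (- 1 - k)) * e t \<le> ennreal (t powr (- 1 - k)) * ennreal (4 * m)"
          using e4[OF elim] by (intro mult_left_mono) auto
        then show ?thesis using False by (simp add: mult_ac)
      qed
    qed
  qed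
  also have "\<dots> = ennreal C * (\<integral>\<^sup>+t. ennreal (t powr (- k)) * indicator {0..1} t \<partial>half_line) +
      ennreal (4 * m) * (\<integral>\<^sup>+t. ennreal (t powr (- 1 - k)) * indicator {1..} t \<partial>half_line)"
    by (simp add: nn_integral_add nn_integral_cmult)
  also have "\<dots> < \<infinity>"
  proof -
    have le: "(\<integral>\<^sup>+t. f t \<partial>half_line) \<le> (\<integral>\<^sup>+t. f t \<partial>lborel)" if "f \<in> borel_measurable borel" for f
      using that by (subst nn_integral_half_line) (auto intro!: nn_integral_mono simp: indicator_def)
    have "(\<integral>\<^sup>+t. ennreal (t powr (- k)) * indicator {0..1} t \<partial>half_line) \<le> (\<integral>\<^sup>+t. ennreal (t powr (- k)) * indicator {0..1} t \<partial>lborel)"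
      by (rule le) measurable
    also have "\<dots> = ennreal (1 powr (- k + 1) / (- k + 1))"
      by (rule nn_integral_has_integral_lebesgue'[OF _ has_integral_powr_from_0]) (use k in auto)
    finally have 1: "(\<integral>\<^sup>+t. ennreal (t powr (- k)) * indicator {0..1} t \<partial>half_line) < \<infinity>"
      by (rule le_less_trans) simp
    have "(\<integral>\<^sup>+t. ennreal (t powr (- 1 - k)) * indicator {1..} t \<partial>half_line) \<le> (\<integral>\<^sup>+t. ennreal (t powr (- 1 - k)) * indicator {1..} t \<partial>lborel)"
      by (rule le) measurable
    also have "\<dots> = ennreal (- (1 powr (- 1 - k + 1)) / (- 1 - k + 1))"
      by (rule nn_integral_has_integral_lebesgue'[OF _ has_integral_powr_to_inf]) (use k in auto)
    finally have 2: "(\<integral>\<^sup>+t. ennreal (t powr (- 1 - k)) * indicator {1..} t \<partial>half_line) < \<infinity>"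
      by (rule le_less_trans) simp
    show ?thesis using 1 2 by (simp add: ennreal_mult_less_top)
  qed
  finally have "ennreal (heat_const (real DIM('a)) (- k)) * ?E < \<infinity>" .
  then show ?thesis using c by (auto simp: ennreal_mult_less_top)
qed

text \<open>The mean value inequality with a bounded derivative. Continuity is given only for the
  derivative in each fixed direction \<open>v\<close>, hence a bound \<open>B v\<close> per
  direction by compactness of the support; adding these bounds over \<open>Basis\<close> controls
  the operator norm.\<close>

lemma test_function_lipschitz:
  fixes f :: "real^'n \<Rightarrow> real"
  assumes "test_function f"
  shows "lipschitz_compact_support f"
proof -
  define K where "K = closure {x. f x \<noteq> 0}"
  have K: "compact K" using assms by (simp add: test_function_def K_def)
  have "times_cont_differentiable 1 f" using assms by (simp add: test_function_def)
  then have d: "\<And>x. f differentiable (at x)" and c: "\<And>v. continuous_on UNIV (\<lambda>x. frechet_derivative f (at x) v)"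
    by auto
  let ?D = "\<lambda>x. frechet_derivative f (at x)"
  have D: "(f has_derivative ?D x) (at x)" for x
    using d by (simp add: frechet_derivative_works[symmetric])
  \<comment> \<open>Off the support the function vanishes on a whole open set, so its derivative
    agrees with that of the zero function. This extends the bound from the compact set to all
    points.\<close>
  have z: "?D x = (\<lambda>_. 0)" if "x \<notin> K" for x
  proof -
    have "f y = 0" if "y \<in> - K" for y
      using that closure_subset[of "{x. f x \<noteq> 0}"] by (auto simp: K_def)
    moreover have "open (- K)" unfolding K_def by (rule open_Compl) (rule closed_closure)
    ultimately have "((\<lambda>_. 0) has_derivative ?D x) (at x)"
      using that D[of x] by (intro has_derivative_transform_within_open[OF D]) auto
    then show ?thesis by (rule has_derivative_unique) simp
  qed
  have "\<exists>B. \<forall>x. \<bar>?D x v\<bar> \<le> B" for v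
  proof -
    have "bounded ((\<lambda>x. ?D x v) ` K)"
      using K c by (intro compact_imp_bounded compact_continuous_image) (auto intro: continuous_on_subset)
    then obtain B where B: "\<And>x. x \<in> K \<Longrightarrow> \<bar>?D x v\<bar> \<le> B" by (auto simp: bounded_iff)
    have "\<bar>?D x v\<bar> \<le> max B 0" for x
      by (cases "x \<in> K") (use B[of x] z[of x] in auto)
    then show ?thesis by blast
  qed
  then obtain B where B: "\<And>v x. \<bar>?D x v\<bar> \<le> B v" by metis
  define L where "L = (\<Sum>b\<in>Basis. B b)"
  have B0: "0 \<le> B v" for v using order_trans[OF abs_ge_zero B[of 0 v]] .
  have L0: "0 \<le> L" unfolding L_def by (intro sum_nonneg B0)
  have "onorm (?D x) \<le> L" for x
  proof (rule onorm_bound[OF L0])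
    fix v :: "real^'n"
    interpret linear "?D x" using D[of x] by (rule has_derivative_linear)
    have "?D x v = ?D x (\<Sum>b\<in>Basis. (v \<bullet> b) *\<^sub>R b)" by (simp add: euclidean_representation)
    also have "\<dots> = (\<Sum>b\<in>Basis. (v \<bullet> b) * ?D x b)" by (simp add: sum scaleR)
    finally have "\<bar>?D x v\<bar> \<le> (\<Sum>b\<in>Basis. \<bar>(v \<bullet> b) * ?D x b\<bar>)" by (simp add: sum_abs)
    also have "\<dots> \<le> (\<Sum>b\<in>Basis. norm v * B b)"
      by (intro sum_mono) (auto simp: abs_mult Basis_le_norm intro!: mult_mono B)
    also have "\<dots> = L * norm v"
      unfolding L_def sum_distrib_right by (intro sum.cong) (auto simp: mult.commute)
    finally show "norm (?D x v) \<le> L * norm v" by simp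
  qed
  then have "\<bar>f x - f y\<bar> \<le> L * norm (x - y)" for x y
    using differentiable_bound[of UNIV f ?D L x y] D by simp
  moreover obtain R where "0 < R" "\<And>x. x \<in> K \<Longrightarrow> norm x \<le> R"
    using compact_imp_bounded[OF K] by (auto simp: bounded_pos)
  moreover have "f x = 0" if "x \<notin> K" for x
    using that closure_subset[of "{x. f x \<noteq> 0}"] by (auto simp: K_def)
  ultimately show ?thesis
    unfolding lipschitz_compact_support_def using L0 by (metis not_le)
qed

section \<open>Passage to the completion\<close>

text \<open>Fatou turns the Cauchy property together with almost everywhere convergence into
  convergence in the mean square, and the integrals of the squares then converge. It is stated for
  one sequence on an arbitrary measure space because it is applied three times, to weighted versions
  of the same functions.\<close>

lemma L2_Cauchy_limit:
  fixes f :: "nat \<Rightarrow> 'a \<Rightarrow> real"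
  assumes [measurable]: "\<And>n. f n \<in> borel_measurable M" "g \<in> borel_measurable M"
    and fin: "\<And>n. (\<integral>\<^sup>+x. ennreal ((f n x)\<^sup>2) \<partial>M) < \<infinity>"
    and Cauchy: "\<And>e. 0 < e \<Longrightarrow> \<exists>K. \<forall>m\<ge>K. \<forall>n\<ge>K. (\<integral>\<^sup>+x. ennreal ((f m x - f n x)\<^sup>2) \<partial>M) \<le> ennreal e"
    and lim: "AE x in M. (\<lambda>n. f n x) \<longlonglongrightarrow> g x"
  shows "(\<integral>\<^sup>+x. ennreal ((g x)\<^sup>2) \<partial>M) < \<infinity>"
    and "(\<lambda>n. \<integral>\<^sup>+x. ennreal ((f n x)\<^sup>2) \<partial>M) \<longlonglongrightarrow> (\<integral>\<^sup>+x. ennreal ((g x)\<^sup>2) \<partial>M)"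
proof -
  have d: "\<exists>K. \<forall>n\<ge>K. (\<integral>\<^sup>+x. ennreal ((f n x - g x)\<^sup>2) \<partial>M) \<le> ennreal e" if "0 < e" for e
  proof -
    obtain K where K: "\<And>m n. m \<ge> K \<Longrightarrow> n \<ge> K \<Longrightarrow> (\<integral>\<^sup>+x. ennreal ((f m x - f n x)\<^sup>2) \<partial>M) \<le> ennreal e"
      using Cauchy[OF \<open>0 < e\<close>] by blast
    have "(\<integral>\<^sup>+x. ennreal ((f n x - g x)\<^sup>2) \<partial>M) \<le> ennreal e" if n: "n \<ge> K" for n
    proof -
      \<comment> \<open>With \<open>n\<close> fixed, the limit in \<open>m\<close> is written as a
        \<open>liminf\<close> under the integral, to which Fatou applies.\<close>
      have "(\<integral>\<^sup>+x. ennreal ((f n x - g x)\<^sup>2) \<partial>M) = (\<integral>\<^sup>+x. liminf (\<lambda>m. ennreal ((f n x - f m x)\<^sup>2)) \<partial>M)"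
      proof (rule nn_integral_cong_AE)
        show "AE x in M. ennreal ((f n x - g x)\<^sup>2) = liminf (\<lambda>m. ennreal ((f n x - f m x)\<^sup>2))"
          using lim
        proof eventually_elim
          case (elim x)
          then have "(\<lambda>m. ennreal ((f n x - f m x)\<^sup>2)) \<longlonglongrightarrow> ennreal ((f n x - g x)\<^sup>2)"
            by (intro tendsto_ennrealI tendsto_intros)
          then show ?case by (intro lim_imp_Liminf[symmetric]) auto
        qed
      qed
      also have "\<dots> \<le> liminf (\<lambda>m. \<integral>\<^sup>+x. ennreal ((f n x - f m x)\<^sup>2) \<partial>M)"
        by (rule nn_integral_liminf) measurable
      also have "\<dots> \<le> ennreal e"
        by (rule Liminf_le) (auto simp: eventually_sequentially intro!: exI[of _ K] K n)
      finally show ?thesis .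
    qed
    then show ?thesis by blast
  qed
  have df: "\<exists>K. \<forall>n\<ge>K. integrable M (\<lambda>x. (f n x - g x)\<^sup>2) \<and> (\<integral>x. (f n x - g x)\<^sup>2 \<partial>M) \<le> e" if e: "0 < e" for e
  proof -
    obtain K where K: "\<And>n. n \<ge> K \<Longrightarrow> (\<integral>\<^sup>+x. ennreal ((f n x - g x)\<^sup>2) \<partial>M) \<le> ennreal e"
      using d[OF e] by blast
    have "integrable M (\<lambda>x. (f n x - g x)\<^sup>2) \<and> (\<integral>x. (f n x - g x)\<^sup>2 \<partial>M) \<le> e" if "n \<ge> K" for n
    proof -
      have i: "integrable M (\<lambda>x. (f n x - g x)\<^sup>2)"
        by (intro integrableI_nonneg) (use le_less_trans[OF K[OF that]] in auto)
      have "ennreal (\<integral>x. (f n x - g x)\<^sup>2 \<partial>M) \<le> ennreal e"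
        using K[OF that] by (subst (asm) nn_integral_eq_integral[OF i]) auto
      then show ?thesis using e i by simp
    qed
    then show ?thesis by blast
  qed
  have fi: "integrable M (\<lambda>x. (f n x)\<^sup>2)" for n
    using fin[of n] by (intro integrableI_nonneg) auto
  obtain N where N: "integrable M (\<lambda>x. (f N x - g x)\<^sup>2)" using df[of 1] by auto
  have gi: "integrable M (\<lambda>x. (g x)\<^sup>2)"
  proof (rule Bochner_Integration.integrable_bound)
    show "integrable M (\<lambda>x. 2 * (f N x)\<^sup>2 + 2 * (f N x - g x)\<^sup>2)" using fi N by auto
    show "AE x in M. norm ((g x)\<^sup>2) \<le> norm (2 * (f N x)\<^sup>2 + 2 * (f N x - g x)\<^sup>2)"
    proof (rule AE_I2)
      fix x
      have "(g x)\<^sup>2 \<le> 2 * (f N x)\<^sup>2 + 2 * (f N x - g x)\<^sup>2"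
        using zero_le_power2[of "2 * f N x - g x"] by (simp add: power2_eq_square algebra_simps)
      then show "norm ((g x)\<^sup>2) \<le> norm (2 * (f N x)\<^sup>2 + 2 * (f N x - g x)\<^sup>2)" by simp
    qed
  qed measurable
  then show "(\<integral>\<^sup>+x. ennreal ((g x)\<^sup>2) \<partial>M) < \<infinity>"
    by (simp add: nn_integral_eq_integral)
  let ?a = "\<integral>x. (g x)\<^sup>2 \<partial>M"
  have a0: "0 \<le> ?a" by simp
  have "(\<lambda>n. \<integral>x. (f n x)\<^sup>2 \<partial>M) \<longlonglongrightarrow> ?a"
  proof (rule LIMSEQ_I)
    fix r :: real assume r: "0 < r"
    \<comment> \<open>The parameter of the weighted Young inequality \<open>2 * \<bar>p * q\<bar>
      \<le> p\<^sup>2 / \<delta> + \<delta> * q\<^sup>2\<close>, chosen so that the part with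
      \<open>g\<close> stays below \<open>r / 2\<close>; the added 1 covers a vanishing integral of
      \<open>g\<close> squared. The tolerance \<open>e\<close> then absorbs the large factor
      \<open>1 + 1 / \<delta>\<close>.\<close>
    define \<delta> where "\<delta> = r / (2 * (1 + ?a))"
    have \<delta>: "0 < \<delta>" using r a0 by (simp add: \<delta>_def add_pos_nonneg)
    have \<delta>a: "\<delta> * ?a < r / 2" using r a0 by (simp add: \<delta>_def field_simps add_pos_nonneg)
    define P where "P = 1 + 1 / \<delta>"
    have P: "0 < P" using \<delta> by (simp add: P_def add_pos_nonneg)
    define e where "e = r / (2 * P)"
    have e: "0 < e" using r P by (simp add: e_def)
    have ee: "(1 + 1 / \<delta>) * e \<le> r / 2" unfolding P_def[symmetric] using P by (simp add: e_def)
    obtain K where K: "\<And>n. n \<ge> K \<Longrightarrow> integrable M (\<lambda>x. (f n x - g x)\<^sup>2) \<and> (\<integral>x. (f n x - g x)\<^sup>2 \<partial>M) \<le> e"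
      using df[OF e] by blast
    have "norm ((\<integral>x. (f n x)\<^sup>2 \<partial>M) - ?a) < r" if "n \<ge> K" for n
    proof -
      note Kn = K[OF that]
      have "\<bar>(\<integral>x. (f n x)\<^sup>2 \<partial>M) - ?a\<bar> = \<bar>\<integral>x. (f n x)\<^sup>2 - (g x)\<^sup>2 \<partial>M\<bar>"
        using fi gi by simp
      also have "\<dots> \<le> (\<integral>x. \<bar>(f n x)\<^sup>2 - (g x)\<^sup>2\<bar> \<partial>M)" by (rule integral_abs_bound)
      also have "\<dots> \<le> (\<integral>x. (1 + 1 / \<delta>) * (f n x - g x)\<^sup>2 + \<delta> * (g x)\<^sup>2 \<partial>M)"
      proof (rule integral_mono)
        fix x
        define p q where "p = f n x - g x" and "q = g x"
        have "2 * \<bar>p * q\<bar> \<le> p\<^sup>2 / \<delta> + \<delta> * q\<^sup>2"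
        proof -
          have "0 \<le> (\<bar>p\<bar> - \<delta> * \<bar>q\<bar>)\<^sup>2 / \<delta>" using \<delta> by simp
          then show ?thesis using \<delta> by (simp add: power2_eq_square field_simps abs_mult)
        qed
        moreover have "(f n x)\<^sup>2 - (g x)\<^sup>2 = p\<^sup>2 + 2 * (p * q)" by (simp add: p_def q_def power2_eq_square algebra_simps)
        moreover have "\<bar>p\<^sup>2 + 2 * (p * q)\<bar> \<le> p\<^sup>2 + 2 * \<bar>p * q\<bar>"
          using abs_triangle_ineq[of "p\<^sup>2" "2 * (p * q)"] by (simp add: abs_mult)
        ultimately have "\<bar>(f n x)\<^sup>2 - (g x)\<^sup>2\<bar> \<le> (1 + 1 / \<delta>) * p\<^sup>2 + \<delta> * q\<^sup>2"
          by (simp add: distrib_right)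
        then show "\<bar>(f n x)\<^sup>2 - (g x)\<^sup>2\<bar> \<le> (1 + 1 / \<delta>) * (f n x - g x)\<^sup>2 + \<delta> * (g x)\<^sup>2"
          by (simp only: p_def q_def)
      qed (use Kn fi gi in auto)
      also have "\<dots> = (1 + 1 / \<delta>) * (\<integral>x. (f n x - g x)\<^sup>2 \<partial>M) + \<delta> * ?a"
        using Kn gi by simp
      also have "\<dots> \<le> (1 + 1 / \<delta>) * e + \<delta> * ?a"
        using Kn \<delta> by (intro add_right_mono mult_left_mono) (auto simp: add_nonneg_nonneg)
      also have "\<dots> < r / 2 + r / 2" by (rule add_le_less_mono[OF ee \<delta>a])
      finally show ?thesis by simp
    qed
    then show "\<exists>no. \<forall>n\<ge>no. norm ((\<integral>x. (f n x)\<^sup>2 \<partial>M) - ?a) < r" by blast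
  qed
  then show "(\<lambda>n. \<integral>\<^sup>+x. ennreal ((f n x)\<^sup>2) \<partial>M) \<longlonglongrightarrow> (\<integral>\<^sup>+x. ennreal ((g x)\<^sup>2) \<partial>M)"
    by (simp add: nn_integral_eq_integral fi gi tendsto_ennrealI)
qed

lemma AE_lborel_pair:
  fixes P :: "'a::euclidean_space \<Rightarrow> bool"
  assumes "AE x in lborel. P x"
  shows "AE z in (lborel :: 'a measure) \<Otimes>\<^sub>M lborel. P (fst z) \<and> P (snd z)"
proof -
  obtain N where N: "N \<in> null_sets lborel" "{x. \<not> P x} \<subseteq> N"
    using assms by (auto simp: eventually_ae_filter)
  have "N \<times> UNIV \<in> null_sets ((lborel :: 'a measure) \<Otimes>\<^sub>M lborel)" "UNIV \<times> N \<in> null_sets ((lborel :: 'a measure) \<Otimes>\<^sub>M lborel)"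
    using lborel.times_in_null_sets1[OF N(1), of UNIV] lborel.times_in_null_sets2[OF _ N(1), of UNIV "lborel :: 'a measure"] by auto
  then have "N \<times> UNIV \<union> UNIV \<times> N \<in> null_sets ((lborel :: 'a measure) \<Otimes>\<^sub>M lborel)" by (rule null_sets.Un)
  then show ?thesis
    by (rule AE_I') (use N in auto)
qed

section \<open>The three quadratic forms as squared mean-square norms\<close>

definition gagliardo_energy :: "real \<Rightarrow> ('a::euclidean_space \<Rightarrow> real) \<Rightarrow> ennreal" where
  "gagliardo_energy s \<phi> = (\<integral>\<^sup>+x. \<integral>\<^sup>+y. ennreal ((\<phi> x - \<phi> y)\<^sup>2 / norm (x - y) powr (real DIM('a) + s)) \<partial>lborel \<partial>lborel)"

definition hardy_energy :: "real \<Rightarrow> ('a::euclidean_space \<Rightarrow> real) \<Rightarrow> ennreal" where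
  "hardy_energy s \<phi> = (\<integral>\<^sup>+x. \<integral>\<^sup>+y. ennreal (hardy_quotient ((real DIM('a) - s) / 2) \<phi> x y / norm (x - y) powr (real DIM('a) + s)) \<partial>lborel \<partial>lborel)"

definition hardy_weight :: "real \<Rightarrow> ('a::euclidean_space \<Rightarrow> real) \<Rightarrow> ennreal" where
  "hardy_weight s \<phi> = (\<integral>\<^sup>+x. ennreal ((\<phi> x)\<^sup>2 / norm x powr s) \<partial>lborel)"

text \<open>Splitting the weight into two equal halves exhibits the integrand as the square of an
  expression linear in \<open>\<phi>\<close>. Linearity is what makes a difference of such
  expressions the energy of a difference, as \<open>L2_Cauchy_limit\<close> requires; the next two
  lemmas do the same for the other forms.\<close>

lemma gagliardo_energy_L2:
  fixes \<phi> :: "'a::euclidean_space \<Rightarrow> real"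
  assumes [measurable]: "\<phi> \<in> borel_measurable borel"
  shows "gagliardo_energy s \<phi> = (\<integral>\<^sup>+z. ennreal (((\<phi> (fst z) - \<phi> (snd z)) / norm (fst z - snd z) powr ((real DIM('a) + s) / 2))\<^sup>2) \<partial>(lborel \<Otimes>\<^sub>M lborel))"
  unfolding gagliardo_energy_def
  by (subst lborel.nn_integral_fst[symmetric]) (auto simp: power_divide power2_eq_square[of "_ powr _"] powr_add[symmetric])

lemma hardy_energy_L2:
  fixes \<phi> :: "'a::euclidean_space \<Rightarrow> real" and s :: real
  assumes [measurable]: "\<phi> \<in> borel_measurable borel"
  defines "a \<equiv> (real DIM('a) - s) / 2"
  shows "hardy_energy s \<phi> = (\<integral>\<^sup>+z. ennreal (((norm (fst z) powr a * \<phi> (fst z) - norm (snd z) powr a * \<phi> (snd z)) /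
     (norm (fst z) powr (a / 2) * norm (snd z) powr (a / 2) * norm (fst z - snd z) powr ((real DIM('a) + s) / 2)))\<^sup>2) \<partial>(lborel \<Otimes>\<^sub>M lborel))"
  unfolding hardy_energy_def a_def[symmetric] hardy_quotient_def
  by (subst lborel.nn_integral_fst[symmetric])
     (auto simp: power_divide power_mult_distrib power2_eq_square[of "_ powr _"] powr_add[symmetric])

lemma hardy_weight_L2:
  fixes \<phi> :: "'a::euclidean_space \<Rightarrow> real"
  assumes [measurable]: "\<phi> \<in> borel_measurable borel"
  shows "hardy_weight s \<phi> = (\<integral>\<^sup>+x. ennreal ((\<phi> x / norm x powr (s / 2))\<^sup>2) \<partial>lborel)"
  unfolding hardy_weight_def
  by (auto simp: power_divide power2_eq_square[of "_ powr _"] powr_add[symmetric])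

lemma ground_state_lipschitz:
  fixes \<phi> :: "'a::euclidean_space \<Rightarrow> real"
  assumes lip: "lipschitz_compact_support \<phi>" and s: "0 < s" "s < 2" "s < real DIM('a)"
  shows "ennreal (gagliardo_const DIM('a) s) * gagliardo_energy s \<phi> =
    ennreal (gagliardo_const DIM('a) s) * hardy_energy s \<phi> + ennreal (herbst_const (real DIM('a)) s) * hardy_weight s \<phi>"
  unfolding gagliardo_energy_def hardy_energy_def hardy_weight_def
  by (rule ground_state_representation[OF lipschitz_compact_support_measurable[OF lip] s lipschitz_compact_support_L2[OF lip]
     lipschitz_compact_support_hardy[OF lip s(1,3)] lipschitz_compact_support_gagliardo[OF lip s(1,2)]])

lemma gagliardo_const_pos:
  assumes "0 < s" "s < 2" shows "0 < gagliardo_const n s"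
  unfolding gagliardo_const_def using assms by (intro divide_pos_pos mult_pos_pos Gamma_real_pos) auto

lemma herbst_const_pos:
  assumes "0 < s" "s < n" shows "0 < herbst_const n s"
proof -
  have "0 < Gamma ((n + s) / 4)" "0 < Gamma ((n - s) / 4)" using assms by (auto intro!: Gamma_real_pos)
  then show ?thesis unfolding herbst_const_def by (intro mult_pos_pos zero_less_power divide_pos_pos) auto
qed

text \<open>Applied to the differences \<open>u m - u n\<close>, the ground state identity bounds
  the Hardy energy and the Hardy weight by the Gagliardo energy, since all its terms are
  nonnegative. So a sequence that is Cauchy for the Gagliardo form is Cauchy for all three, and each
  term of the identity passes to the limit.\<close>

lemma ground_state_limit:
  fixes \<phi> :: "'a::euclidean_space \<Rightarrow> real" and u :: "nat \<Rightarrow> 'a \<Rightarrow> real"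
  assumes s: "0 < s" "s < 2" "s < real DIM('a)"
    and [measurable]: "\<phi> \<in> borel_measurable borel" and lip: "\<And>n. lipschitz_compact_support (u n)"
    and Cauchy: "\<And>e. 0 < e \<Longrightarrow> \<exists>K. \<forall>m\<ge>K. \<forall>n\<ge>K. ennreal (gagliardo_const DIM('a) s) * gagliardo_energy s (\<lambda>x. u m x - u n x) \<le> ennreal e"
    and lim: "AE x in lborel. (\<lambda>n. u n x) \<longlonglongrightarrow> \<phi> x"
  shows "gagliardo_energy s \<phi> < \<infinity>" "hardy_energy s \<phi> < \<infinity>" "hardy_weight s \<phi> < \<infinity>"
    "ennreal (gagliardo_const DIM('a) s) * gagliardo_energy s \<phi> =
      ennreal (gagliardo_const DIM('a) s) * hardy_energy s \<phi> + ennreal (herbst_const (real DIM('a)) s) * hardy_weight s \<phi>"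
proof -
  let ?D = "gagliardo_const DIM('a) s" and ?K = "herbst_const (real DIM('a)) s"
  have D: "0 < ?D" using s by (intro gagliardo_const_pos) auto
  have K: "0 < ?K" using s by (intro herbst_const_pos) auto
  note [measurable] = lipschitz_compact_support_measurable[OF lip]
  have lipd: "lipschitz_compact_support (\<lambda>x. u m x - u n x)" for m n
    by (intro lipschitz_compact_support_diff lip)
  note [measurable] = lipschitz_compact_support_measurable[OF lipd]
  \<comment> \<open>\<open>Q\<close> stands for any of the three forms; the hypothesis
    \<open>le\<close> says that it is controlled by the Gagliardo form along differences of the
    sequence.\<close>
  have small: "\<exists>K. \<forall>m\<ge>K. \<forall>n\<ge>K. Q (\<lambda>x. u m x - u n x) \<le> ennreal e"
    if e: "0 < e" and c: "0 < c" and le: "\<And>m n. ennreal c * Q (\<lambda>x. u m x - u n x) \<le> ennreal ?D * gagliardo_energy s (\<lambda>x. u m x - u n x)"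
    for e c and Q :: "('a \<Rightarrow> real) \<Rightarrow> ennreal"
  proof -
    have "0 < c * e" using e c by simp
    from Cauchy[OF this] obtain K where K: "\<And>m n. m \<ge> K \<Longrightarrow> n \<ge> K \<Longrightarrow> ennreal ?D * gagliardo_energy s (\<lambda>x. u m x - u n x) \<le> ennreal (c * e)"
      by blast
    have "Q (\<lambda>x. u m x - u n x) \<le> ennreal e" if "m \<ge> K" "n \<ge> K" for m n
    proof -
      have "ennreal c * Q (\<lambda>x. u m x - u n x) \<le> ennreal c * ennreal e"
        using order_trans[OF le K[OF that]] c e by (simp add: ennreal_mult)
      then have "ennreal (1 / c) * (ennreal c * Q (\<lambda>x. u m x - u n x)) \<le> ennreal (1 / c) * (ennreal c * ennreal e)"
        by (rule mult_left_mono) simp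
      then show ?thesis using c by (simp add: mult.assoc[symmetric] ennreal_mult[symmetric])
    qed
    then show ?thesis by blast
  qed
  have gs: "ennreal ?D * gagliardo_energy s (u n) = ennreal ?D * hardy_energy s (u n) + ennreal ?K * hardy_weight s (u n)" for n
    by (rule ground_state_lipschitz[OF lip s])
  have gsd: "ennreal ?D * gagliardo_energy s (\<lambda>x. u m x - u n x) =
      ennreal ?D * hardy_energy s (\<lambda>x. u m x - u n x) + ennreal ?K * hardy_weight s (\<lambda>x. u m x - u n x)" for m n
    by (rule ground_state_lipschitz[OF lipd s])
  have finE: "gagliardo_energy s (u n) < \<infinity>" for n
    unfolding gagliardo_energy_def by (rule lipschitz_compact_support_gagliardo[OF lip s(1,2)])
  have finJ: "hardy_weight s (u n) < \<infinity>" for n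
    unfolding hardy_weight_def by (rule lipschitz_compact_support_hardy[OF lip s(1,3)])
  \<comment> \<open>No direct estimate of this form has been made: its finiteness is read off the
    identity, in which it is dominated by the Gagliardo energy.\<close>
  have finH: "hardy_energy s (u n) < \<infinity>" for n
  proof -
    have "ennreal ?D * hardy_energy s (u n) \<le> ennreal ?D * gagliardo_energy s (u n)" unfolding gs by simp
    also have "\<dots> < \<infinity>" using finE by (simp add: ennreal_mult_less_top)
    finally show ?thesis using D by (auto simp: ennreal_mult_less_top)
  qed
  have lim2: "AE z in (lborel :: 'a measure) \<Otimes>\<^sub>M lborel. (\<lambda>n. u n (fst z)) \<longlonglongrightarrow> \<phi> (fst z) \<and> (\<lambda>n. u n (snd z)) \<longlonglongrightarrow> \<phi> (snd z)"
    by (rule AE_lborel_pair[OF lim])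
  define n where "n = real DIM('a)"
  define a where "a = (n - s) / 2"
  let ?fE = "\<lambda>\<phi> z. (\<phi> (fst z) - \<phi> (snd z)) / norm (fst z - snd z) powr ((n + s) / 2)"
  let ?fH = "\<lambda>\<phi> z. (norm (fst z) powr a * \<phi> (fst z) - norm (snd z) powr a * \<phi> (snd z)) /
     (norm (fst z) powr (a / 2) * norm (snd z) powr (a / 2) * norm (fst z - snd z) powr ((n + s) / 2))"
  let ?fJ = "\<lambda>\<phi> x. \<phi> x / norm x powr (s / 2)"
  note LE = gagliardo_energy_L2[where 'a = 'a and s = s, folded n_def]
  note LH = hardy_energy_L2[where 'a = 'a and s = s, folded n_def, folded a_def]
  note LJ = hardy_weight_L2[where 'a = 'a and s = s]
  have E: "gagliardo_energy s \<phi> < \<infinity> \<and> (\<lambda>n. gagliardo_energy s (u n)) \<longlonglongrightarrow> gagliardo_energy s \<phi>"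
  proof -
    have eq: "?fE (u k) z - ?fE (u l) z = ?fE (\<lambda>x. u k x - u l x) z" for k l z
      by (simp add: diff_divide_distrib)
    have L: "(\<integral>\<^sup>+z. ennreal ((?fE (u k) z - ?fE (u l) z)\<^sup>2) \<partial>(lborel \<Otimes>\<^sub>M lborel)) = gagliardo_energy s (\<lambda>x. u k x - u l x)" for k l
      unfolding eq by (rule LE[of "\<lambda>x. u k x - u l x", symmetric]) measurable
    have C: "\<exists>K. \<forall>k\<ge>K. \<forall>l\<ge>K. (\<integral>\<^sup>+z. ennreal ((?fE (u k) z - ?fE (u l) z)\<^sup>2) \<partial>(lborel \<Otimes>\<^sub>M lborel)) \<le> ennreal e" if "0 < e" for e
      unfolding L
      by (rule small[OF that D]) simp
    have l: "AE z in lborel \<Otimes>\<^sub>M lborel. (\<lambda>k. ?fE (u k) z) \<longlonglongrightarrow> ?fE \<phi> z"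
      using lim2
    proof eventually_elim
      case (elim z)
      then show ?case unfolding divide_inverse by (intro tendsto_mult tendsto_diff tendsto_const) auto
    qed
    have m1: "?fE (u k) \<in> borel_measurable (lborel \<Otimes>\<^sub>M lborel)" for k by measurable
    have m2: "?fE \<phi> \<in> borel_measurable (lborel \<Otimes>\<^sub>M lborel)" by measurable
    have L1: "(\<integral>\<^sup>+z. ennreal ((?fE (u k) z)\<^sup>2) \<partial>(lborel \<Otimes>\<^sub>M lborel)) = gagliardo_energy s (u k)" for k
      by (rule LE[of "u k", symmetric]) measurable
    have L2: "(\<integral>\<^sup>+z. ennreal ((?fE \<phi> z)\<^sup>2) \<partial>(lborel \<Otimes>\<^sub>M lborel)) = gagliardo_energy s \<phi>"
      by (rule LE[of \<phi>, symmetric]) measurable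
    have fin: "(\<integral>\<^sup>+z. ennreal ((?fE (u k) z)\<^sup>2) \<partial>(lborel \<Otimes>\<^sub>M lborel)) < \<infinity>" for k
      unfolding L1 by (rule finE)
    show ?thesis
      using L2_Cauchy_limit[OF m1 m2 fin C l] unfolding L1 L2 by blast
  qed
  have H: "hardy_energy s \<phi> < \<infinity> \<and> (\<lambda>n. hardy_energy s (u n)) \<longlonglongrightarrow> hardy_energy s \<phi>"
  proof -
    have eq: "?fH (u k) z - ?fH (u l) z = ?fH (\<lambda>x. u k x - u l x) z" for k l z
      unfolding right_diff_distrib diff_divide_distrib by linarith
    have L: "(\<integral>\<^sup>+z. ennreal ((?fH (u k) z - ?fH (u l) z)\<^sup>2) \<partial>(lborel \<Otimes>\<^sub>M lborel)) = hardy_energy s (\<lambda>x. u k x - u l x)" for k l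
      unfolding eq by (rule LH[of "\<lambda>x. u k x - u l x", symmetric]) measurable
    have C: "\<exists>K. \<forall>k\<ge>K. \<forall>l\<ge>K. (\<integral>\<^sup>+z. ennreal ((?fH (u k) z - ?fH (u l) z)\<^sup>2) \<partial>(lborel \<Otimes>\<^sub>M lborel)) \<le> ennreal e" if "0 < e" for e
      unfolding L
      by (rule small[OF that D]) (simp add: gsd)
    have l: "AE z in lborel \<Otimes>\<^sub>M lborel. (\<lambda>k. ?fH (u k) z) \<longlonglongrightarrow> ?fH \<phi> z"
      using lim2
    proof eventually_elim
      case (elim z)
      then show ?case unfolding divide_inverse by (intro tendsto_mult tendsto_diff tendsto_const) auto
    qed
    have m1: "?fH (u k) \<in> borel_measurable (lborel \<Otimes>\<^sub>M lborel)" for k by measurable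
    have m2: "?fH \<phi> \<in> borel_measurable (lborel \<Otimes>\<^sub>M lborel)" by measurable
    have L1: "(\<integral>\<^sup>+z. ennreal ((?fH (u k) z)\<^sup>2) \<partial>(lborel \<Otimes>\<^sub>M lborel)) = hardy_energy s (u k)" for k
      by (rule LH[of "u k", symmetric]) measurable
    have L2: "(\<integral>\<^sup>+z. ennreal ((?fH \<phi> z)\<^sup>2) \<partial>(lborel \<Otimes>\<^sub>M lborel)) = hardy_energy s \<phi>"
      by (rule LH[of \<phi>, symmetric]) measurable
    have fin: "(\<integral>\<^sup>+z. ennreal ((?fH (u k) z)\<^sup>2) \<partial>(lborel \<Otimes>\<^sub>M lborel)) < \<infinity>" for k
      unfolding L1 by (rule finH)
    show ?thesis
      using L2_Cauchy_limit[OF m1 m2 fin C l] unfolding L1 L2 by blast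
  qed
  have J: "hardy_weight s \<phi> < \<infinity> \<and> (\<lambda>n. hardy_weight s (u n)) \<longlonglongrightarrow> hardy_weight s \<phi>"
  proof -
    have eq: "?fJ (u k) z - ?fJ (u l) z = ?fJ (\<lambda>x. u k x - u l x) z" for k l z
      by (simp add: diff_divide_distrib)
    have L: "(\<integral>\<^sup>+z. ennreal ((?fJ (u k) z - ?fJ (u l) z)\<^sup>2) \<partial>lborel) = hardy_weight s (\<lambda>x. u k x - u l x)" for k l
      unfolding eq by (rule LJ[of "\<lambda>x. u k x - u l x", symmetric]) measurable
    have C: "\<exists>K. \<forall>k\<ge>K. \<forall>l\<ge>K. (\<integral>\<^sup>+z. ennreal ((?fJ (u k) z - ?fJ (u l) z)\<^sup>2) \<partial>lborel) \<le> ennreal e" if "0 < e" for e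
      unfolding L
      by (rule small[OF that K]) (simp add: gsd)
    have l: "AE z in lborel. (\<lambda>k. ?fJ (u k) z) \<longlonglongrightarrow> ?fJ \<phi> z"
      using lim
    proof eventually_elim
      case (elim z)
      then show ?case unfolding divide_inverse by (intro tendsto_mult tendsto_diff tendsto_const) auto
    qed
    have m1: "?fJ (u k) \<in> borel_measurable lborel" for k by measurable
    have m2: "?fJ \<phi> \<in> borel_measurable lborel" by measurable
    have L1: "(\<integral>\<^sup>+z. ennreal ((?fJ (u k) z)\<^sup>2) \<partial>lborel) = hardy_weight s (u k)" for k
      by (rule LJ[of "u k", symmetric]) measurable
    have L2: "(\<integral>\<^sup>+z. ennreal ((?fJ \<phi> z)\<^sup>2) \<partial>lborel) = hardy_weight s \<phi>"
      by (rule LJ[of \<phi>, symmetric]) measurable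
    have fin: "(\<integral>\<^sup>+z. ennreal ((?fJ (u k) z)\<^sup>2) \<partial>lborel) < \<infinity>" for k
      unfolding L1 by (rule finJ)
    show ?thesis
      using L2_Cauchy_limit[OF m1 m2 fin C l] unfolding L1 L2 by blast
  qed
  show "gagliardo_energy s \<phi> < \<infinity>" "hardy_energy s \<phi> < \<infinity>" "hardy_weight s \<phi> < \<infinity>"
    using E H J by auto
  have "(\<lambda>n. ennreal ?D * gagliardo_energy s (u n)) \<longlonglongrightarrow> ennreal ?D * gagliardo_energy s \<phi>"
    using E by (intro ennreal_tendsto_cmult) auto
  moreover have "(\<lambda>n. ennreal ?D * gagliardo_energy s (u n)) \<longlonglongrightarrow> ennreal ?D * hardy_energy s \<phi> + ennreal ?K * hardy_weight s \<phi>"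
    unfolding gs using H J by (intro tendsto_add ennreal_tendsto_cmult) auto
  ultimately show "ennreal ?D * gagliardo_energy s \<phi> = ennreal ?D * hardy_energy s \<phi> + ennreal ?K * hardy_weight s \<phi>"
    by (rule LIMSEQ_unique)
qed

section \<open>Reduction to Borel functions and the Riesz potential\<close>

text \<open>The product carries completed factors, so these rules are what lets Borel expressions in
  the two coordinates be recognised as measurable there.\<close>

lemma measurable_lebesgue_fst_snd [measurable]:
  "fst \<in> borel_measurable ((lebesgue :: 'a::euclidean_space measure) \<Otimes>\<^sub>M (lebesgue :: 'a measure))"
  "snd \<in> borel_measurable ((lebesgue :: 'a::euclidean_space measure) \<Otimes>\<^sub>M (lebesgue :: 'a measure))"
proof -
  have id: "(\<lambda>x. x) \<in> lebesgue \<rightarrow>\<^sub>M (borel :: 'a measure)"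
    by (rule measurable_completion) simp
  show "fst \<in> borel_measurable ((lebesgue :: 'a measure) \<Otimes>\<^sub>M (lebesgue :: 'a measure))"
    "snd \<in> borel_measurable ((lebesgue :: 'a measure) \<Otimes>\<^sub>M (lebesgue :: 'a measure))"
    using measurable_compose[OF measurable_fst id] measurable_compose[OF measurable_snd id] by auto
qed

interpretation lebesgue_pair: pair_sigma_finite "lebesgue :: 'a::euclidean_space measure" "lebesgue :: 'a measure" ..

lemma double_integral_eq:
  assumes "double_integrable f"
  shows "double_integral f = (\<integral>(x, y). f x y \<partial>(lebesgue \<Otimes>\<^sub>M lebesgue))"
  using lebesgue_pair.integral_snd[of f] assms by (simp add: double_integral_def double_integrable_def)

text \<open>A bridge from iterated \<open>lborel\<close> integrals to the product of completed
  measures. Completion leaves \<open>nn_integral\<close> unchanged, so the iterated integrals may be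
  evaluated over \<open>lborel\<close> although \<open>f\<close> is measurable only for the
  completed measures.\<close>

lemma double_integrable_nonneg:
  fixes f :: "real^'n \<Rightarrow> real^'n \<Rightarrow> real"
  assumes f: "case_prod f \<in> borel_measurable (lebesgue \<Otimes>\<^sub>M lebesgue)" and nn: "\<And>x y. 0 \<le> f x y"
    and I: "(\<integral>\<^sup>+x. \<integral>\<^sup>+y. ennreal (f x y) \<partial>lborel \<partial>lborel) = ennreal I" "0 \<le> I"
  shows "double_integrable f \<and> double_integral f = I"
proof -
  have "(\<integral>\<^sup>+z. ennreal (case_prod f z) \<partial>(lebesgue \<Otimes>\<^sub>M lebesgue)) = ennreal I"
    using f by (subst lebesgue.nn_integral_fst[symmetric]) (simp_all add: nn_integral_completion I(1) case_prod_beta')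
  then have "has_bochner_integral (lebesgue \<Otimes>\<^sub>M lebesgue) (case_prod f) I"
    using f nn I(2) by (intro has_bochner_integral_nonneg_real) auto
  then have "double_integrable f" "(\<integral>(x, y). f x y \<partial>(lebesgue \<Otimes>\<^sub>M lebesgue)) = I"
    by (simp_all add: double_integrable_def has_bochner_integral_iff)
  then show ?thesis by (simp add: double_integral_eq)
qed

lemma ennreal_less_inftyE:
  assumes "X < (\<infinity>::ennreal)"
  obtains r where "0 \<le> r" "X = ennreal r"
  using assms by (cases X rule: ennreal_cases) auto

text \<open>\<open>hs_norm\<close> is built on a Bochner integral, which takes a default value when
  the integrand is not integrable; its smallness is informative only because the energy is already
  known to be finite.\<close>

lemma hs_norm_lipschitz:
  fixes w :: "real^'n \<Rightarrow> real"
  assumes lip: "lipschitz_compact_support w" and s: "0 < s" "s < 2" and e: "0 < e" "hs_norm s w < e"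
  shows "ennreal (gagliardo_const CARD('n) s) * gagliardo_energy s w \<le> ennreal (e\<^sup>2)"
proof -
  note [measurable] = lipschitz_compact_support_measurable[OF lip]
  have [measurable]: "w \<in> borel_measurable lebesgue" by (rule measurable_completion) measurable
  let ?f = "\<lambda>x y. \<bar>w x - w y\<bar>\<^sup>2 / norm (x - y) powr (real CARD('n) + s)"
  have D: "0 < gagliardo_const CARD('n) s" using s by (intro gagliardo_const_pos)
  obtain I where I: "0 \<le> I" "gagliardo_energy s w = ennreal I"
    using lipschitz_compact_support_gagliardo[OF lip s] unfolding gagliardo_energy_def
    by (rule ennreal_less_inftyE)
  have "double_integral ?f = I"
  proof (rule conjunct2[OF double_integrable_nonneg])
    show "(\<integral>\<^sup>+x. \<integral>\<^sup>+y. ennreal (?f x y) \<partial>lborel \<partial>lborel) = ennreal I"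
      using I(2) by (simp add: gagliardo_energy_def)
  qed (use I in \<open>simp_all\<close>)
  then have h: "sqrt (gagliardo_const CARD('n) s * I) < e" using e by (simp add: hs_norm_def)
  have "gagliardo_const CARD('n) s * I = (sqrt (gagliardo_const CARD('n) s * I))\<^sup>2" using D I by simp
  also have "\<dots> \<le> e\<^sup>2" using h D I by (intro power_mono) auto
  finally show ?thesis using D I by (simp add: ennreal_mult[symmetric] ennreal_leI)
qed

text \<open>The limit in the completion is only Lebesgue measurable, whereas the energies have been
  treated for Borel functions, so \<open>\<phi>\<close> is replaced by a Borel representative
  \<open>\<psi>\<close>. With all three values finite, the identity can be rearranged into a
  difference of reals.\<close>

lemma homogeneous_sobolev_ground_state:
  fixes \<phi> :: "real^'n \<Rightarrow> real"
  assumes s: "0 < s" "s < 2" "s < real CARD('n)" and \<phi>: "\<phi> \<in> homogeneous_sobolev s"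
  obtains \<psi> e h j where "\<psi> \<in> borel_measurable borel" "AE x in lborel. \<phi> x = \<psi> x"
    "0 \<le> e" "0 \<le> h" "0 \<le> j"
    "gagliardo_energy s \<psi> = ennreal e" "hardy_energy s \<psi> = ennreal h" "hardy_weight s \<psi> = ennreal j"
    "gagliardo_const CARD('n) s * (e - h) = herbst_const (real CARD('n)) s * j"
proof -
  have [measurable]: "\<phi> \<in> borel_measurable lebesgue" using \<phi> by (simp add: homogeneous_sobolev_def)
  obtain u where u: "\<And>n. test_function (u n)"
    and C: "\<And>e. e > 0 \<Longrightarrow> \<exists>M. \<forall>m\<ge>M. \<forall>n\<ge>M. hs_norm s (\<lambda>x. u m x - u n x) < e"
    and lim: "AE x in lebesgue. (\<lambda>n. u n x) \<longlonglongrightarrow> \<phi> x"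
    using \<phi> unfolding homogeneous_sobolev_def by blast
  obtain \<psi> where \<psi>: "\<psi> \<in> borel_measurable lborel" "AE x in lborel. \<phi> x = \<psi> x"
    using completion_ex_borel_measurable_real[of \<phi> lborel] by auto
  have lip: "lipschitz_compact_support (u n)" for n by (rule test_function_lipschitz[OF u])
  have s': "s < real DIM(real^'n)" using s by simp
  have lim': "AE x in lborel. (\<lambda>n. u n x) \<longlonglongrightarrow> \<psi> x"
    using lim[unfolded AE_completion_iff] \<psi>(2) by eventually_elim simp
  have C': "\<exists>K. \<forall>m\<ge>K. \<forall>n\<ge>K. ennreal (gagliardo_const DIM(real^'n) s) * gagliardo_energy s (\<lambda>x. u m x - u n x) \<le> ennreal e"
    if "0 < e" for e
  proof -
    from that have "0 < sqrt e" by simp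
    from C[OF this] obtain M where "\<And>m n. m \<ge> M \<Longrightarrow> n \<ge> M \<Longrightarrow> hs_norm s (\<lambda>x. u m x - u n x) < sqrt e" by blast
    then have "ennreal (gagliardo_const CARD('n) s) * gagliardo_energy s (\<lambda>x. u m x - u n x) \<le> ennreal ((sqrt e)\<^sup>2)" if "m \<ge> M" "n \<ge> M" for m n
      using that \<open>0 < sqrt e\<close> by (intro hs_norm_lipschitz lipschitz_compact_support_diff lip s)
    then show ?thesis using that by (intro exI[of _ M]) auto
  qed
  have b: "\<psi> \<in> borel_measurable borel" using \<psi>(1) by simp
  note R = ground_state_limit[OF s(1,2) s' b lip C' lim']
  obtain e where e: "0 \<le> e" "gagliardo_energy s \<psi> = ennreal e" using R(1) by (rule ennreal_less_inftyE)
  obtain h where h: "0 \<le> h" "hardy_energy s \<psi> = ennreal h" using R(2) by (rule ennreal_less_inftyE)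
  obtain j where j: "0 \<le> j" "hardy_weight s \<psi> = ennreal j" using R(3) by (rule ennreal_less_inftyE)
  note ehj = e(1) h(1) j(1) e(2) h(2) j(2)
  have D: "0 < gagliardo_const CARD('n) s" and K: "0 < herbst_const (real CARD('n)) s"
    using s by (auto intro!: gagliardo_const_pos herbst_const_pos)
  have "ennreal (gagliardo_const CARD('n) s * e) = ennreal (gagliardo_const CARD('n) s * h + herbst_const (real CARD('n)) s * j)"
    using R(4) D K ehj by (simp add: ennreal_mult)
  then have "gagliardo_const CARD('n) s * e = gagliardo_const CARD('n) s * h + herbst_const (real CARD('n)) s * j"
    using D K ehj by (subst (asm) ennreal_inj) auto
  then show ?thesis using that[OF b \<psi>(2) ehj] by (simp add: algebra_simps)
qed

section \<open>The Riesz potential acting on a power\<close>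

lemma riesz_potential_nonneg:
  fixes x :: "real^'n"
  assumes "0 < \<alpha>" "\<alpha> < real CARD('n)"
  shows "0 \<le> riesz_potential \<alpha> x"
  unfolding riesz_potential_def riesz_const_def
  using assms by (intro divide_nonneg_nonneg mult_nonneg_nonneg less_imp_le[OF Gamma_real_pos]) auto

lemma riesz_potential_measurable [measurable]:
  fixes f :: "'b \<Rightarrow> real^'n"
  assumes [measurable]: "f \<in> borel_measurable M"
  shows "(\<lambda>z. riesz_potential \<alpha> (f z)) \<in> borel_measurable M"
  unfolding riesz_potential_def by measurable

text \<open>The factor by which convolution with the Riesz potential maps the power of exponent
  \<open>- (N + \<alpha>) / 2\<close> to the one of exponent
  \<open>- (N - \<alpha>) / 2\<close>.\<close>

definition riesz_ratio :: "real \<Rightarrow> real \<Rightarrow> real" where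
  "riesz_ratio N \<alpha> = (Gamma ((N - \<alpha>) / 4) / Gamma ((N + \<alpha>) / 4))\<^sup>2 / 2 powr \<alpha>"

text \<open>Riesz composition with \<open>a = \<alpha> / 2\<close> and
  \<open>b = (N - \<alpha>) / 4\<close>; the condition \<open>a + b < N / 2\<close> amounts to
  \<open>\<alpha> < N\<close>. The potential is the power kernel of index \<open>a\<close> divided
  by \<open>Gamma a\<close>, and that factor cancels the \<open>Gamma a\<close> in the Beta
  value.\<close>

lemma riesz_potential_convolution:
  fixes x :: "real^'n"
  assumes \<alpha>: "0 < \<alpha>" "\<alpha> < real CARD('n)" and x: "x \<noteq> 0"
  defines "N \<equiv> real CARD('n)"
  shows "(\<integral>\<^sup>+y. ennreal (riesz_potential \<alpha> (x - y) / norm y powr ((N + \<alpha>) / 2)) \<partial>lborel) =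
    ennreal (riesz_ratio N \<alpha> / norm x powr ((N - \<alpha>) / 2))"
proof -
  define a b where "a = \<alpha> / 2" and "b = (N - \<alpha>) / 4"
  have N: "real DIM(real^'n) = N" by (simp add: N_def)
  have ab: "0 < a" "0 < b" "a + b < N / 2" "b < N / 2"
    using \<alpha> unfolding a_def b_def N_def by (simp_all add: field_simps)
  have ga: "0 < Gamma a" "0 < Gamma b" "0 < Gamma (a + b)" using ab by (auto intro!: Gamma_real_pos)
  have cb: "0 < heat_const N b" "0 < heat_const N (a + b)" using ab by (auto intro!: heat_const_pos)
  have e: "2 * a - N = - (N - \<alpha>)" "2 * b - N = - ((N + \<alpha>) / 2)" "2 * (a + b) - N = - ((N - \<alpha>) / 2)"
    by (simp_all add: a_def b_def field_simps)
  have four: "(4::real) powr t = 2 powr (2 * t)" for t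
  proof -
    have "(4::real) = 2 powr 2" by (simp add: powr_numeral)
    then show ?thesis by (simp only: powr_powr)
  qed
  have rc: "riesz_const CARD('n) \<alpha> = heat_const N a / Gamma a"
    unfolding riesz_const_def heat_const_def a_def N_def four by (simp add: diff_divide_distrib)
  have "(\<integral>\<^sup>+y. ennreal (riesz_potential \<alpha> (x - y) / norm y powr ((N + \<alpha>) / 2)) \<partial>lborel) =
    (\<integral>\<^sup>+y. ennreal (1 / (Gamma a * heat_const N b)) * (ennreal (heat_const N a * norm (x - y) powr (2 * a - N)) *
        ennreal (heat_const N b * norm y powr (2 * b - N))) \<partial>lborel)"
  proof (rule nn_integral_cong)
    fix y :: "real^'n"
    have ca: "0 < heat_const N a" using ab by (intro heat_const_pos) auto
    have "riesz_potential \<alpha> (x - y) / norm y powr ((N + \<alpha>) / 2) =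
      1 / (Gamma a * heat_const N b) * ((heat_const N a * norm (x - y) powr (2 * a - N)) * (heat_const N b * norm y powr (2 * b - N)))"
      unfolding riesz_potential_def rc e powr_minus_divide N_def[symmetric] using ga cb by simp
    note eq = this
    have m: "ennreal (p * (q * r)) = ennreal p * (ennreal q * ennreal r)" if "0 \<le> p" "0 \<le> q" "0 \<le> r" for p q r
      using that by (simp add: ennreal_mult)
    show "ennreal (riesz_potential \<alpha> (x - y) / norm y powr ((N + \<alpha>) / 2)) =
      ennreal (1 / (Gamma a * heat_const N b)) * (ennreal (heat_const N a * norm (x - y) powr (2 * a - N)) *
        ennreal (heat_const N b * norm y powr (2 * b - N)))"
      unfolding eq by (rule m) (use ga cb ca in auto)
  qed
  also have "\<dots> = ennreal (1 / (Gamma a * heat_const N b)) * ennreal (Beta a b * heat_const N (a + b) * norm x powr (2 * (a + b) - N))"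
    using riesz_composition[of a b x] ab x unfolding N by (subst nn_integral_cmult) simp_all
  also have "\<dots> = ennreal (1 / (Gamma a * heat_const N b) * (Beta a b * heat_const N (a + b) * norm x powr (2 * (a + b) - N)))"
    using ga cb by (intro ennreal_mult[symmetric]) (auto simp: Beta_def)
  also have "1 / (Gamma a * heat_const N b) * (Beta a b * heat_const N (a + b) * norm x powr (2 * (a + b) - N)) =
     riesz_ratio N \<alpha> / norm x powr ((N - \<alpha>) / 2)"
  proof -
    have g: "N / 2 - b = a + b" "N / 2 - (a + b) = b" "(N - \<alpha>) / 4 = b" "(N + \<alpha>) / 4 = a + b"
      by (simp_all add: a_def b_def field_simps)
    have "4 powr (a + b) = 4 powr b * (2::real) powr \<alpha>"
      unfolding four powr_add[symmetric] by (simp add: a_def algebra_simps)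
    then show ?thesis
      unfolding e powr_minus_divide riesz_ratio_def heat_const_def g Beta_def
      using ga by (simp add: power2_eq_square)
  qed
  finally show ?thesis .
qed

section \<open>The identity on the completion\<close>

theorem theoremC:
  fixes \<alpha> s :: real and \<phi> :: "real^'n \<Rightarrow> real"
  defines "N \<equiv> real CARD('n)"
  defines "E \<equiv> \<lambda>x y. \<bar>\<phi> x - \<phi> y\<bar>\<^sup>2 / norm (x - y) powr (N + s)"
      and "H \<equiv> \<lambda>x y.
             \<bar>norm x powr ((N - s) / 2) * \<phi> x - norm y powr ((N - s) / 2) * \<phi> y\<bar>\<^sup>2 /
             (norm x powr ((N - s) / 2) * norm (x - y) powr (N + s) * norm y powr ((N - s) / 2))"
      and "A \<equiv> \<lambda>x y.
             \<phi> x / norm x powr ((\<alpha> + s) / 2) * riesz_potential \<alpha> (x - y) *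
             (\<phi> y / norm y powr ((\<alpha> + s) / 2))"
      and "B \<equiv> \<lambda>x y.
             riesz_potential \<alpha> (x - y) /
             (norm x powr ((N + \<alpha>) / 2) * norm y powr ((N + \<alpha>) / 2)) *
             \<bar>\<phi> x * norm x powr ((N - s) / 2) - \<phi> y * norm y powr ((N - s) / 2)\<bar>\<^sup>2"
  assumes "0 < \<alpha>" and "\<alpha> < N" and "0 < s" and "s < 2" and "s < N"
      and "\<phi> \<in> homogeneous_sobolev s"
  shows "double_integrable E \<and> double_integrable H \<and> double_integrable A \<and> double_integrable B \<and>
    gagliardo_const CARD('n) s * (double_integral E - double_integral H) =
    1 / hardy_const CARD('n) \<alpha> s * (double_integral A + 1 / 2 * double_integral B)"
proof -
  have \<alpha>: "0 < \<alpha>" "\<alpha> < real CARD('n)" and s: "0 < s" "s < 2" "s < real CARD('n)"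
    using assms by (auto simp: N_def)
  have [measurable]: "\<phi> \<in> borel_measurable lebesgue"
    using \<open>\<phi> \<in> homogeneous_sobolev s\<close> by (simp add: homogeneous_sobolev_def)
  obtain \<psi> e h j where [measurable]: "\<psi> \<in> borel_measurable borel" and ae: "AE x in lborel. \<phi> x = \<psi> x"
    and pos: "0 \<le> e" "0 \<le> h" "0 \<le> j"
    and en: "gagliardo_energy s \<psi> = ennreal e" "hardy_energy s \<psi> = ennreal h" "hardy_weight s \<psi> = ennreal j"
    and gs: "gagliardo_const CARD('n) s * (e - h) = herbst_const (real CARD('n)) s * j"
    by (rule homogeneous_sobolev_ground_state[OF s \<open>\<phi> \<in> homogeneous_sobolev s\<close>])
  have N: "real DIM(real^'n) = N" by (simp add: N_def)
  \<comment> \<open>The values of \<open>\<phi>\<close> are passed as separate arguments, so one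
    statement transfers any integrand from \<open>\<phi>\<close> to \<open>\<psi>\<close>.\<close>
  have cong: "(\<integral>\<^sup>+x. \<integral>\<^sup>+y. F (\<phi> x) (\<phi> y) x y \<partial>lborel \<partial>lborel) = (\<integral>\<^sup>+x. \<integral>\<^sup>+y. F (\<psi> x) (\<psi> y) x y \<partial>lborel \<partial>lborel)"
    for F :: "real \<Rightarrow> real \<Rightarrow> real^'n \<Rightarrow> real^'n \<Rightarrow> ennreal"
  proof (rule nn_integral_cong_AE)
    show "AE x in lborel. (\<integral>\<^sup>+y. F (\<phi> x) (\<phi> y) x y \<partial>lborel) = (\<integral>\<^sup>+y. F (\<psi> x) (\<psi> y) x y \<partial>lborel)"
      using ae
    proof eventually_elim
      case (elim x)
      show ?case by (rule nn_integral_cong_AE) (use ae elim in \<open>auto elim!: eventually_mono\<close>)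
    qed
  qed
  have E: "double_integrable E \<and> double_integral E = e"
  proof (rule double_integrable_nonneg)
    show "case_prod E \<in> borel_measurable (lebesgue \<Otimes>\<^sub>M lebesgue)" unfolding E_def by measurable
    show "(\<integral>\<^sup>+x. \<integral>\<^sup>+y. ennreal (E x y) \<partial>lborel \<partial>lborel) = ennreal e"
      using cong[of "\<lambda>p q x y. ennreal ((p - q)\<^sup>2 / norm (x - y) powr (N + s))"] en(1)
      unfolding gagliardo_energy_def N by (simp add: E_def)
  qed (auto simp: E_def pos)
  have H: "double_integrable H \<and> double_integral H = h"
  proof (rule double_integrable_nonneg)
    show "case_prod H \<in> borel_measurable (lebesgue \<Otimes>\<^sub>M lebesgue)" unfolding H_def by measurable
    show "(\<integral>\<^sup>+x. \<integral>\<^sup>+y. ennreal (H x y) \<partial>lborel \<partial>lborel) = ennreal h"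
      using cong[of "\<lambda>p q x y. ennreal ((norm x powr ((N - s) / 2) * p - norm y powr ((N - s) / 2) * q)\<^sup>2 / (norm x powr ((N - s) / 2) * norm y powr ((N - s) / 2)) / norm (x - y) powr (N + s))"] en(2)
      unfolding hardy_energy_def hardy_quotient_def N by (simp add: H_def mult_ac)
  qed (auto simp: H_def pos)
  let ?c = "riesz_ratio N \<alpha>"
  define U where "U x = \<phi> x * norm x powr ((N - s) / 2)" for x
  define K where "K x y = riesz_potential \<alpha> (x - y) / (norm x powr ((N + \<alpha>) / 2) * norm y powr ((N + \<alpha>) / 2))" for x y :: "real^'n"
  have [measurable]: "U \<in> borel_measurable lebesgue"
  proof -
    have "(\<lambda>x. norm x powr ((N - s) / 2)) \<in> borel_measurable (lebesgue :: (real^'n) measure)"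
      by (rule measurable_completion) measurable
    then show ?thesis unfolding U_def by measurable
  qed
  have [measurable]: "case_prod K \<in> borel_measurable (lebesgue \<Otimes>\<^sub>M lebesgue)" unfolding K_def by measurable
  have K0: "0 \<le> K x y" for x y unfolding K_def using riesz_potential_nonneg[OF \<alpha>] by simp
  have Ksym: "K x y = K y x" for x y
    by (simp add: K_def riesz_potential_def norm_minus_commute mult.commute)
  have c0: "0 \<le> ?c" by (simp add: riesz_ratio_def)
  \<comment> \<open>The factor \<open>U x\<close> does not depend on \<open>y\<close>, so the inner
    integral is the convolution formula. In the remaining powers of \<open>norm x\<close> the
    exponent \<open>N - s\<close> from the square of \<open>U\<close> meets \<open>N\<close> in the
    denominator and leaves the Hardy weight.\<close>
  have KU: "(\<integral>\<^sup>+x. \<integral>\<^sup>+y. ennreal (K x y * (U x)\<^sup>2) \<partial>lborel \<partial>lborel) = ennreal (?c * j)"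
  proof -
    have "(\<integral>\<^sup>+x. \<integral>\<^sup>+y. ennreal (K x y * (U x)\<^sup>2) \<partial>lborel \<partial>lborel) = (\<integral>\<^sup>+x. ennreal ?c * ennreal ((\<psi> x)\<^sup>2 / norm x powr s) \<partial>lborel)"
    proof (rule nn_integral_cong_AE)
      show "AE x in lborel. (\<integral>\<^sup>+y. ennreal (K x y * (U x)\<^sup>2) \<partial>lborel) = ennreal ?c * ennreal ((\<psi> x)\<^sup>2 / norm x powr s)"
        using ae AE_lborel_singleton[of 0]
      proof eventually_elim
        case (elim x)
        have "(\<integral>\<^sup>+y. ennreal (K x y * (U x)\<^sup>2) \<partial>lborel) =
          (\<integral>\<^sup>+y. ennreal ((U x)\<^sup>2 / norm x powr ((N + \<alpha>) / 2)) * ennreal (riesz_potential \<alpha> (x - y) / norm y powr ((N + \<alpha>) / 2)) \<partial>lborel)"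
          by (intro nn_integral_cong) (simp add: K_def ennreal_mult[symmetric] riesz_potential_nonneg[OF \<alpha>] mult_ac)
        also have "\<dots> = ennreal ((U x)\<^sup>2 / norm x powr ((N + \<alpha>) / 2)) * ennreal (?c / norm x powr ((N - \<alpha>) / 2))"
          using riesz_potential_convolution[OF \<alpha> elim(2)] by (subst nn_integral_cmult) (simp_all add: N_def)
        also have "\<dots> = ennreal ((U x)\<^sup>2 / norm x powr ((N + \<alpha>) / 2) * (?c / norm x powr ((N - \<alpha>) / 2)))"
          using c0 by (intro ennreal_mult[symmetric]) auto
        also have "(U x)\<^sup>2 / norm x powr ((N + \<alpha>) / 2) * (?c / norm x powr ((N - \<alpha>) / 2)) = ?c * ((\<psi> x)\<^sup>2 / norm x powr s)"
        proof -
          have p: "(norm x powr ((N - s) / 2))\<^sup>2 = norm x powr (N - s)"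
            by (simp add: power2_eq_square powr_add[symmetric])
          have q: "norm x powr ((N + \<alpha>) / 2) * norm x powr ((N - \<alpha>) / 2) = norm x powr N"
            unfolding powr_add[symmetric] by (simp add: field_simps)
          have r: "norm x powr (N - s) / norm x powr N = 1 / norm x powr s"
            unfolding powr_diff[symmetric] by (simp add: powr_minus_divide)
          have "(U x)\<^sup>2 / norm x powr ((N + \<alpha>) / 2) * (?c / norm x powr ((N - \<alpha>) / 2)) =
            ?c * (\<psi> x)\<^sup>2 * ((norm x powr ((N - s) / 2))\<^sup>2 / (norm x powr ((N + \<alpha>) / 2) * norm x powr ((N - \<alpha>) / 2)))"
            by (simp add: U_def power_mult_distrib elim(1))
          then show ?thesis unfolding p q r by simp
        qed
        also have "ennreal (?c * ((\<psi> x)\<^sup>2 / norm x powr s)) = ennreal ?c * ennreal ((\<psi> x)\<^sup>2 / norm x powr s)"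
          using c0 by (intro ennreal_mult) auto
        finally show ?case .
      qed
    qed
    also have "\<dots> = ennreal ?c * ennreal j"
      unfolding en(3)[symmetric] hardy_weight_def by (rule nn_integral_cmult) measurable
    finally show ?thesis using c0 pos by (simp add: ennreal_mult)
  qed
  have KU1: "double_integrable (\<lambda>x y. K x y * (U x)\<^sup>2) \<and> double_integral (\<lambda>x y. K x y * (U x)\<^sup>2) = ?c * j"
    by (rule double_integrable_nonneg[OF _ _ KU]) (use K0 c0 pos in auto)
  \<comment> \<open>\<open>K\<close> is symmetric, so exchanging the two coordinates of the product
    measure reduces this to \<open>KU1\<close>.\<close>
  have KU2: "double_integrable (\<lambda>x y. K x y * (U y)\<^sup>2) \<and> double_integral (\<lambda>x y. K x y * (U y)\<^sup>2) = ?c * j"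
  proof -
    have i: "integrable (lebesgue \<Otimes>\<^sub>M lebesgue) (\<lambda>(x, y). K x y * (U x)\<^sup>2)" using KU1 by (simp add: double_integrable_def)
    have eq: "(\<lambda>(x, y). (\<lambda>(x, y). K x y * (U x)\<^sup>2) (y, x)) = (\<lambda>(x, y). K x y * (U y)\<^sup>2)"
      by (auto simp: Ksym)
    have d: "double_integrable (\<lambda>x y. K x y * (U y)\<^sup>2)"
      using lebesgue_pair.integrable_product_swap[OF i] unfolding eq by (simp add: double_integrable_def)
    have "(\<integral>(x, y). K x y * (U y)\<^sup>2 \<partial>(lebesgue \<Otimes>\<^sub>M lebesgue)) = (\<integral>(x, y). K x y * (U x)\<^sup>2 \<partial>(lebesgue \<Otimes>\<^sub>M lebesgue))"
      using lebesgue_pair.integral_product_swap[OF borel_measurable_integrable[OF i]] unfolding eq .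
    then have "double_integral (\<lambda>x y. K x y * (U y)\<^sup>2) = double_integral (\<lambda>x y. K x y * (U x)\<^sup>2)"
      using double_integral_eq[OF d] double_integral_eq[OF conjunct1[OF KU1]] by simp
    then show ?thesis using d KU1 by simp
  qed
  have A: "A x y = K x y * (U x * U y)" for x y
  proof -
    \<comment> \<open>This holds at the origin too, where both sides are 0 by the conventions for
      \<open>powr\<close> and division; hence \<open>A\<close> is rewritten at every point, not
      merely almost everywhere.\<close>
    have "norm x powr ((N - s) / 2) / norm x powr ((N + \<alpha>) / 2) = 1 / norm x powr ((\<alpha> + s) / 2)" for x :: "real^'n"
    proof -
      have "(N - s) / 2 - (N + \<alpha>) / 2 = - ((\<alpha> + s) / 2)" by (simp add: field_simps)
      then show ?thesis unfolding powr_diff[symmetric] by (simp only: powr_minus_divide)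
    qed
    note r = this
    have "K x y * (U x * U y) = \<phi> x * (norm x powr ((N - s) / 2) / norm x powr ((N + \<alpha>) / 2)) * riesz_potential \<alpha> (x - y) *
       (\<phi> y * (norm y powr ((N - s) / 2) / norm y powr ((N + \<alpha>) / 2)))"
      by (simp add: K_def U_def)
    then show ?thesis unfolding r by (simp add: A_def)
  qed
  have B: "B x y = K x y * (U x)\<^sup>2 + K x y * (U y)\<^sup>2 - 2 * A x y" for x y
  proof -
    have "B x y = K x y * (U x - U y)\<^sup>2" by (simp add: B_def K_def U_def)
    then show ?thesis by (simp add: A power2_eq_square algebra_simps)
  qed
  have i1: "integrable (lebesgue \<Otimes>\<^sub>M lebesgue) (\<lambda>(x, y). K x y * (U x)\<^sup>2)"
    and i2: "integrable (lebesgue \<Otimes>\<^sub>M lebesgue) (\<lambda>(x, y). K x y * (U y)\<^sup>2)"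
    using KU1 KU2 by (simp_all add: double_integrable_def)
  \<comment> \<open>\<open>A\<close> may change sign, so it is dominated:
    \<open>\<bar>U x * U y\<bar>\<close> is at most the sum of the two squares, whose products with
    \<open>K\<close> are integrable. Integrability of \<open>B\<close> then follows by
    linearity.\<close>
  have iA: "integrable (lebesgue \<Otimes>\<^sub>M lebesgue) (\<lambda>(x, y). A x y)"
  proof (rule Bochner_Integration.integrable_bound)
    show "integrable (lebesgue \<Otimes>\<^sub>M lebesgue) (\<lambda>z. (case z of (x, y) \<Rightarrow> K x y * (U x)\<^sup>2) + (case z of (x, y) \<Rightarrow> K x y * (U y)\<^sup>2))"
      by (intro Bochner_Integration.integrable_add i1 i2)
    show "(\<lambda>(x, y). A x y) \<in> borel_measurable (lebesgue \<Otimes>\<^sub>M lebesgue)" unfolding A by measurable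
    have "\<bar>A x y\<bar> \<le> K x y * (U x)\<^sup>2 + K x y * (U y)\<^sup>2" for x y
    proof -
      have "2 * (\<bar>U x\<bar> * \<bar>U y\<bar>) \<le> (U x)\<^sup>2 + (U y)\<^sup>2"
        using zero_le_power2[of "\<bar>U x\<bar> - \<bar>U y\<bar>"] by (simp add: power2_eq_square algebra_simps)
      then have "\<bar>U x\<bar> * \<bar>U y\<bar> \<le> (U x)\<^sup>2 + (U y)\<^sup>2"
        using mult_nonneg_nonneg[OF abs_ge_zero[of "U x"] abs_ge_zero[of "U y"]] by linarith
      from mult_left_mono[OF this K0[of x y]] show ?thesis
        using K0[of x y] by (simp add: A abs_mult distrib_left)
    qed
    then show "AE z in lebesgue \<Otimes>\<^sub>M lebesgue. norm (case z of (x, y) \<Rightarrow> A x y) \<le>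
        norm ((case z of (x, y) \<Rightarrow> K x y * (U x)\<^sup>2) + (case z of (x, y) \<Rightarrow> K x y * (U y)\<^sup>2))"
      by (intro AE_I2) (auto intro: order_trans[OF _ abs_ge_self])
  qed
  have Beq: "(\<lambda>(x, y). B x y) = (\<lambda>z. (case z of (x, y) \<Rightarrow> K x y * (U x)\<^sup>2) + (case z of (x, y) \<Rightarrow> K x y * (U y)\<^sup>2) - 2 * (case z of (x, y) \<Rightarrow> A x y))"
    by (auto simp: B)
  have iB: "integrable (lebesgue \<Otimes>\<^sub>M lebesgue) (\<lambda>(x, y). B x y)"
    unfolding Beq by (intro Bochner_Integration.integrable_diff Bochner_Integration.integrable_add integrable_mult_right i1 i2 iA)
  have dA: "double_integrable A" and dB: "double_integrable B"
    using iA iB by (simp_all add: double_integrable_def)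
  have "double_integral B = double_integral (\<lambda>x y. K x y * (U x)\<^sup>2) + double_integral (\<lambda>x y. K x y * (U y)\<^sup>2) - 2 * double_integral A"
    unfolding double_integral_eq[OF dB] double_integral_eq[OF dA] double_integral_eq[OF conjunct1[OF KU1]]
      double_integral_eq[OF conjunct1[OF KU2]] Beq
    using i1 i2 iA by simp
  then have AB: "double_integral A + 1 / 2 * double_integral B = ?c * j"
    using KU1 KU2 by (simp add: diff_divide_distrib mult.commute)
  \<comment> \<open>\<open>hardy_const\<close> splits into a factor in \<open>s\<close>, the
    reciprocal of \<open>herbst_const\<close>, and a factor in \<open>\<alpha>\<close>, which is
    \<open>riesz_ratio\<close>; the quotient is therefore independent of
    \<open>\<alpha>\<close>.\<close>
  have "herbst_const N s = 1 / hardy_const CARD('n) \<alpha> s * ?c"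
  proof -
    have "0 < Gamma ((N + s) / 4)" "0 < Gamma ((N - s) / 4)" "0 < Gamma ((N + \<alpha>) / 4)" "0 < Gamma ((N - \<alpha>) / 4)"
      using \<alpha> s by (auto intro!: Gamma_real_pos simp: N_def)
    then show ?thesis
      unfolding herbst_const_def hardy_const_def riesz_ratio_def N_def[symmetric]
      by (simp add: powr_add power_divide power_mult_distrib)
  qed
  then have "gagliardo_const CARD('n) s * (double_integral E - double_integral H) =
      1 / hardy_const CARD('n) \<alpha> s * (double_integral A + 1 / 2 * double_integral B)"
    unfolding AB using E H gs by (simp add: N_def)
  then show ?thesis using E H dA dB by blast
qed

end
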